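(* Let $\mathfrak h$ be an ordinary (ungraded) Lie algebra and $(\mathfrak g,[\cdots]_k)$ an $L_\infty$ algebra. A Lie algebra action of $\mathfrak h$ on $\mathfrak g$ is equivalent (via the assignment $\psi\mapsto(\mu_n)_{n\geqslant0}$ described in the context) to a collection of multilinear maps $\mu_n:\mathfrak h\times\Lambda^n\mathfrak g\to\mathfrak g$ of degree $1-n$, $n\geqslant0$, which satisfy, for all $n\geqslant0$, $h,h'\in\mathfrak h$ and homogeneous $x_1,\dots,x_n\in\mathfrak g$, $$\begin{aligned}&\sum_{p=1}^n\sum_{\sigma\in\mathrm{Sh}(p,n-p)}\chi(\sigma;x_1,\dots,x_n)\,\mu_{n-p+1}\big(h,[x_{\sigma(1)},\dots,x_{\sigma(p)}]_p,x_{\sigma(p+1)},\dots,x_{\sigma(n)}\big)\\&\quad=\sum_{p=0}^n\sum_{\sigma\in\mathrm{Sh}(p,n-p)}(-1)^{p+1}\chi(\sigma;x_1,\dots,x_n)\big[\mu_p(h,x_{\sigma(1)},\dots,x_{\sigma(p)}),x_{\sigma(p+1)},\dots,x_{\sigma(n)}\big]_{n-p+1}\end{aligned}$$ and $$\begin{aligned}\mu_n([h,h']_{\mathfrak h},x_1,\dots,x_n)=&\sum_{p=0}^n\sum_{\sigma\in\mathrm{Sh}(p,n-p)}\chi(\sigma;x_1,\dots,x_n)\,\mu_{n-p+1}\big(h,\mu_p(h',x_{\sigma(1)},\dots,x_{\sigma(p)}),x_{\sigma(p+1)},\dots,x_{\sigma(n)}\big)\\&-\sum_{p=0}^n\sum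_{\sigma\in\mathrm{Sh}(p,n-p)}\chi(\sigma;x_1,\dots,x_n)\,\mu_{n-p+1}\big(h',\mu_p(h,x_{\sigma(1)},\dots,x_{\sigma(p)}),x_{\sigma(p+1)},\dots,x_{\sigma(n)}\big).\end{aligned}$$
   Context: $\mathbb K$ is $\mathbb R$ or $\mathbb C$; vector spaces are $\mathbb Z$-graded over $\mathbb K$; $(V[1])^i=V^{i+1}$, and $\tilde v=v[1]\in V[1]$ corresponds to $v\in V$. $\mathrm{Sh}(p,q)$ denotes the set of $(p,q)$-shuffles, i.e. permutations $\sigma$ of $\{1,\dots,p+q\}$ with $\sigma(1)<\cdots<\sigma(p)$ and $\sigma(p+1)<\cdots<\sigma(p+q)$. The Koszul sign $\chi$ is defined by $v_1\wedge\cdots\wedge v_n=\chi(\sigma;v_1,\dots,v_n)v_{\sigma(1)}\wedge\cdots\wedge v_{\sigma(n)}$ in the exterior algebra $\Lambda(V)$; $\odot$ denotes the product in the symmetric algebra $S(V)$. An $L_\infty$ algebra is a graded vector space $\mathfrak g$ with graded skew-symmetric maps $[\cdots]_k:\Lambda^k\mathfrak g\to\mathfrak g$ of degree $2-k$, $k\geqslant1$, such that for all $n\geqslant1$ and homogeneous $x_i$: $\sum_{i=1}^n\sum_{\sigma\in\mathrm{Sh}(i,n-i)}(-1)^i\chi(\sigma;x_1,\dots,x_n)[[x_{\sigma(1)},\dots,x_{\sigma(i)}]_i,x_{\sigma(i+1)},\dots,x_{\sigma(n)}]_{n-i+1}=0$. $S(\mathfrak g[1])=\bigoplus_{n\geqslant0}S^n(\mathfrak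 g[1])$ is a graded coalgebra under the shuffle comultiplication. A coderivation $D$ of it is determined by its components $D_k:S^k(\mathfrak g[1])\xrightarrow{D}S(\mathfrak g[1])\to\mathfrak g[1]$, $k\geqslant0$. The $L_\infty$ structure corresponds to the degree $1$ coderivation $Q$ with $Q^2=0$, $Q_0=0$ and $Q_n(\tilde x_1\odot\cdots\odot\tilde x_n)=(-1)^{\frac{n(n+1)}2+\sum_{i=1}^n(n-i)|x_i|}([x_1,\dots,x_n]_n)[1]$. The space $\mathrm{Coder}(S(\mathfrak g[1]))$ of coderivations is a dgla (differential graded Lie algebra) under the graded commutator with differential $[Q,\cdot]$. A Lie algebra action of $\mathfrak h$ on $\mathfrak g$ is a dgla homomorphism $\psi:\mathfrak h\to\mathrm{Coder}(S(\mathfrak g[1]))$, with $\mathfrak h$ regarded as a dgla in degree $0$ with zero differential. Write $\gamma(h)=\psi(h)_0(1)\in\mathfrak g[1]^0$ and $\theta(h)_n=\psi(h)_n$ for $n\geqslant1$. The associated maps $\mu_n$ are defined by $$\mu_0(h)[1]:=-\gamma(h),\qquad\mu_n(h,x_1,\dots,x_n)[1]:=(-1)^{\frac{(n+1)(n+2)}2+\sum_{i=1}^n(n-i)|x_i|}\,\theta(h)_n(\tilde x_1\odot\cdots\odot\tilde x_n)\quad(n\geqslant1).$$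
   Formalization: The bijection is proved for ψ ↦ (−μ_n), i.e. with every sign in the definition of the associated maps reversed; with the literal signs the second equation fails, e.g. for gl_2 acting on K^2 in degree 0 with zero brackets. *)

theory Defs
  imports
    Complex_Main
    "HOL-Library.Poly_Mapping"
    "HOL-Library.Function_Algebras"
    "HOL-Combinatorics.Permutations"
begin

text \<open>
  The ground field is a type of class \<^class>\<open>real_normed_field\<close>: by the Gelfand-Mazur theorem the
  types of this class are exactly the copies of the real and of the complex numbers.
\<close>

section \<open>Graded vector spaces and multilinear maps\<close>

definition graded_vector_space ::
  "('k::field \<Rightarrow> 'v \<Rightarrow> 'v) \<Rightarrow> (int \<Rightarrow> 'v::ab_group_add set) \<Rightarrow> bool" where
  "graded_vector_space scale V \<longleftrightarrow>
     vector_space scale \<and> (\<forall>i. module.subspace scale (V i)) \<and>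
     (\<forall>x. \<exists>!f :: int \<Rightarrow>\<^sub>0 'v. (\<forall>i. Poly_Mapping.lookup f i \<in> V i) \<and>
                        x = (\<Sum>i\<in>Poly_Mapping.keys f. Poly_Mapping.lookup f i))"

text \<open>\<open>V[1]\<close> has the same underlying space as \<open>V\<close>, and \<open>v[1]\<close> is \<open>v\<close> itself.\<close>

definition shift :: "(int \<Rightarrow> 'v set) \<Rightarrow> int \<Rightarrow> 'v set" where
  "shift V i = V (i + 1)"

text \<open>Since the zero vector has every degree, the degrees of the entries of a list of homogeneous
  vectors are carried along in a separate list.\<close>

definition homog :: "(int \<Rightarrow> 'v set) \<Rightarrow> int list \<Rightarrow> 'v list \<Rightarrow> bool" where
  "homog V ds xs \<longleftrightarrow> list_all2 (\<lambda>d x. x \<in> V d) ds xs"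

text \<open>A function on lists encodes a sequence of maps, one of each arity; the arity of an
  application is the length of the list. The arity 0 component is an arbitrary vector.\<close>

definition multilinear ::
  "('k \<Rightarrow> 'v \<Rightarrow> 'v) \<Rightarrow> ('k \<Rightarrow> 'w \<Rightarrow> 'w) \<Rightarrow> ('v::plus list \<Rightarrow> 'w::plus) \<Rightarrow> bool" where
  "multilinear scaleV scaleW m \<longleftrightarrow>
     (\<forall>xs a b ys. m (xs @ (a + b) # ys) = m (xs @ a # ys) + m (xs @ b # ys)) \<and>
     (\<forall>xs c a ys. m (xs @ scaleV c a # ys) = scaleW c (m (xs @ a # ys)))"

definition graded_skew ::
  "('k::field \<Rightarrow> 'w \<Rightarrow> 'w) \<Rightarrow> (int \<Rightarrow> 'v set) \<Rightarrow> ('v list \<Rightarrow> 'w::uminus) \<Rightarrow> bool" where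
  "graded_skew scaleW V m \<longleftrightarrow>
     (\<forall>i j. \<forall>a\<in>V i. \<forall>b\<in>V j. \<forall>xs ys.
        m (xs @ a # b # ys) = - scaleW ((-1) powi (i * j)) (m (xs @ b # a # ys)))"


section \<open>Shuffles and Koszul signs\<close>

text \<open>Permutations act on the positions \<open>0, \<dots>, n - 1\<close> of a list.\<close>

definition Sh :: "nat \<Rightarrow> nat \<Rightarrow> (nat \<Rightarrow> nat) set" where
  "Sh p q = {\<sigma>. \<sigma> permutes {..<p + q} \<and> strict_mono_on {..<p} \<sigma> \<and> strict_mono_on {p..<p + q} \<sigma>}"

definition inversions :: "nat \<Rightarrow> (nat \<Rightarrow> nat) \<Rightarrow> (nat \<times> nat) set" where
  "inversions n \<sigma> = {(i, j). i < j \<and> j < n \<and> \<sigma> j < \<sigma> i}"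

text \<open>The signs with \<open>v\<^sub>1 \<wedge> \<dots> \<wedge> v\<^sub>n = \<chi> v\<^bsub>\<sigma> 1\<^esub> \<wedge> \<dots> \<wedge> v\<^bsub>\<sigma> n\<^esub>\<close> in the exterior algebra and
  \<open>v\<^sub>1 \<odot> \<dots> \<odot> v\<^sub>n = \<epsilon> v\<^bsub>\<sigma> 1\<^esub> \<odot> \<dots> \<odot> v\<^bsub>\<sigma> n\<^esub>\<close> in the symmetric algebra, for vectors of degrees \<open>ds\<close>:
  each transposition of neighbours \<open>a\<close>, \<open>b\<close> costs \<open>-(-1)\<^bsup>|a||b|\<^esup>\<close> and \<open>(-1)\<^bsup>|a||b|\<^esup>\<close>,
  respectively. This makes sense also when the products vanish.\<close>

definition koszul_skew :: "(nat \<Rightarrow> nat) \<Rightarrow> int list \<Rightarrow> 'k::field" ("\<chi>") where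
  "\<chi> \<sigma> ds = (\<Prod>(i, j)\<in>inversions (length ds) \<sigma>. - ((-1) powi (ds ! \<sigma> i * ds ! \<sigma> j)))"

definition koszul_sym :: "(nat \<Rightarrow> nat) \<Rightarrow> int list \<Rightarrow> 'k::field" ("\<epsilon>") where
  "\<epsilon> \<sigma> ds = (\<Prod>(i, j)\<in>inversions (length ds) \<sigma>. (-1) powi (ds ! \<sigma> i * ds ! \<sigma> j))"

text \<open>\<open>first p \<sigma> xs\<close> is \<open>x\<^bsub>\<sigma> 1\<^esub>, \<dots>, x\<^bsub>\<sigma> p\<^esub>\<close> and \<open>rest p \<sigma> xs\<close> is \<open>x\<^bsub>\<sigma> (p+1)\<^esub>, \<dots>, x\<^bsub>\<sigma> n\<^esub>\<close>.\<close>

definition first :: "nat \<Rightarrow> (nat \<Rightarrow> nat) \<Rightarrow> 'a list \<Rightarrow> 'a list" where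
  "first p \<sigma> xs = take p (permute_list \<sigma> xs)"

definition rest :: "nat \<Rightarrow> (nat \<Rightarrow> nat) \<Rightarrow> 'a list \<Rightarrow> 'a list" where
  "rest p \<sigma> xs = drop p (permute_list \<sigma> xs)"


section \<open>Lie algebras, $L_\infty$ algebras, homomorphisms of dglas\<close>

definition lie_algebra ::
  "('k::field \<Rightarrow> 'h \<Rightarrow> 'h) \<Rightarrow> ('h \<Rightarrow> 'h \<Rightarrow> 'h::ab_group_add) \<Rightarrow> bool" where
  "lie_algebra scale br \<longleftrightarrow>
     vector_space scale \<and>
     (\<forall>x. Vector_Spaces.linear scale scale (br x)) \<and>
     (\<forall>y. Vector_Spaces.linear scale scale (\<lambda>x. br x y)) \<and>
     (\<forall>x. br x x = 0) \<and>
     (\<forall>x y z. br x (br y z) + br y (br z x) + br z (br x y) = 0)"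

text \<open>\<open>l [x\<^sub>1, \<dots>, x\<^sub>k]\<close> is \<open>[x\<^sub>1, \<dots>, x\<^sub>k]\<^sub>k\<close> for \<open>k \<ge> 1\<close>; the value of \<open>l []\<close> is irrelevant.\<close>

definition linf_algebra ::
  "('k::field \<Rightarrow> 'g \<Rightarrow> 'g) \<Rightarrow> (int \<Rightarrow> 'g set) \<Rightarrow> ('g list \<Rightarrow> 'g::ab_group_add) \<Rightarrow> bool" where
  "linf_algebra scale G l \<longleftrightarrow>
     graded_vector_space scale G \<and>
     multilinear scale scale l \<and> graded_skew scale G l \<and>
     (\<forall>ds xs. homog G ds xs \<and> xs \<noteq> [] \<longrightarrow> l xs \<in> G (sum_list ds + 2 - int (length xs))) \<and>
     (\<forall>ds xs. homog G ds xs \<and> xs \<noteq> [] \<longrightarrow>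
        (\<Sum>i=1..length xs. \<Sum>\<sigma>\<in>Sh i (length xs - i).
           scale ((-1) ^ i * \<chi> \<sigma> ds) (l (l (first i \<sigma> xs) # rest i \<sigma> xs))) = 0)"

text \<open>A dgla inside an ambient vector space is given by its homogeneous components \<open>A i\<close>, its
  bracket \<open>br i j\<close> on \<open>A i \<times> A j\<close> and its differential \<open>d i\<close> on \<open>A i\<close>.\<close>

definition dgla_hom ::
  "('k::field \<Rightarrow> 'a \<Rightarrow> 'a) \<Rightarrow> (int \<Rightarrow> 'a set) \<Rightarrow> (int \<Rightarrow> int \<Rightarrow> 'a \<Rightarrow> 'a \<Rightarrow> 'a) \<Rightarrow> (int \<Rightarrow> 'a \<Rightarrow> 'a) \<Rightarrow>
   ('k \<Rightarrow> 'b \<Rightarrow> 'b) \<Rightarrow> (int \<Rightarrow> 'b set) \<Rightarrow> (int \<Rightarrow> int \<Rightarrow> 'b \<Rightarrow> 'b \<Rightarrow> 'b) \<Rightarrow> (int \<Rightarrow> 'b \<Rightarrow> 'b) \<Rightarrow>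
   ('a::ab_group_add \<Rightarrow> 'b::ab_group_add) \<Rightarrow> bool" where
  "dgla_hom scaleA A brA dA scaleB B brB dB \<phi> \<longleftrightarrow>
     Vector_Spaces.linear scaleA scaleB \<phi> \<and>
     (\<forall>i. \<phi> ` A i \<subseteq> B i) \<and>
     (\<forall>i j. \<forall>x\<in>A i. \<forall>y\<in>A j. \<phi> (brA i j x y) = brB i j (\<phi> x) (\<phi> y)) \<and>
     (\<forall>i. \<forall>x\<in>A i. \<phi> (dA i x) = dB i (\<phi> x))"


section \<open>Vector spaces given by generators and relations\<close>

text \<open>The symmetric algebra and the tensor product are quotients of free vector spaces. Such a
  quotient depends on the scalar multiplication and on the grading and can therefore not be
  formed as a type. Instead, \<open>presents s f R\<close> says that the given type, with scalar
  multiplication \<open>s\<close>, is a copy of the quotient of the free vector space on \<open>'b\<close> by the span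
  of \<open>R\<close>, where \<open>f b\<close> is the class of the generator \<open>b\<close>.\<close>

definition free_scale :: "'k::field \<Rightarrow> ('b \<Rightarrow>\<^sub>0 'k) \<Rightarrow> ('b \<Rightarrow>\<^sub>0 'k)" where
  "free_scale c = Poly_Mapping.map ((*) c)"

definition lin_ext ::
  "('k::field \<Rightarrow> 'v \<Rightarrow> 'v) \<Rightarrow> ('b \<Rightarrow> 'v) \<Rightarrow> ('b \<Rightarrow>\<^sub>0 'k) \<Rightarrow> 'v::ab_group_add" where
  "lin_ext s f t = (\<Sum>b\<in>Poly_Mapping.keys t. s (Poly_Mapping.lookup t b) (f b))"

definition presents ::
  "('k::field \<Rightarrow> 'v \<Rightarrow> 'v) \<Rightarrow> ('b \<Rightarrow> 'v::ab_group_add) \<Rightarrow> ('b \<Rightarrow>\<^sub>0 'k) set \<Rightarrow> bool" where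
  "presents s f R \<longleftrightarrow>
     vector_space s \<and> surj (lin_ext s f) \<and>
     (\<forall>t. lin_ext s f t = 0 \<longleftrightarrow> t \<in> module.span free_scale R)"

lemma lookup_free_scale: "Poly_Mapping.lookup (free_scale c t) b = c * Poly_Mapping.lookup t b"
  by (auto simp: free_scale_def map.rep_eq when_def)

lemma vector_space_free_scale:
  "vector_space (free_scale :: 'k::field \<Rightarrow> ('b \<Rightarrow>\<^sub>0 'k) \<Rightarrow> _)"
  by unfold_locales
    (auto simp: lookup_free_scale lookup_add algebra_simps intro!: poly_mapping_eqI)

lemma lin_ext_superset:
  assumes "vector_space s" "finite A" "Poly_Mapping.keys t \<subseteq> A"
  shows "lin_ext s f t = (\<Sum>b\<in>A. s (Poly_Mapping.lookup t b) (f b))"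
proof -
  interpret vector_space s by fact
  show ?thesis unfolding lin_ext_def
    by (rule sum.mono_neutral_left) (use assms in \<open>auto simp: in_keys_iff\<close>)
qed

lemma linear_lin_ext:
  fixes s :: "'k::field \<Rightarrow> 'v \<Rightarrow> 'v::ab_group_add" and f :: "'b \<Rightarrow> 'v"
  assumes "vector_space s"
  shows "Vector_Spaces.linear free_scale s (lin_ext s f)"
proof -
  interpret S: vector_space s by fact
  interpret F: vector_space "free_scale :: 'k \<Rightarrow> ('b \<Rightarrow>\<^sub>0 'k) \<Rightarrow> _" by (rule vector_space_free_scale)
  have add: "lin_ext s f (t + u) = lin_ext s f t + lin_ext s f u" for t u
  proof -
    let ?A = "Poly_Mapping.keys t \<union> Poly_Mapping.keys u"
    have "Poly_Mapping.keys (t + u) \<subseteq> ?A" by (rule Poly_Mapping.keys_add)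
    then show ?thesis
      using lin_ext_superset[OF assms, of ?A]
      by (simp add: lookup_add S.scale_left_distrib sum.distrib)
  qed
  have scl: "lin_ext s f (free_scale c t) = s c (lin_ext s f t)" for c t
  proof -
    have "Poly_Mapping.keys (free_scale c t) \<subseteq> Poly_Mapping.keys t"
      by (auto simp: in_keys_iff lookup_free_scale)
    then show ?thesis
      using lin_ext_superset[OF assms, of "Poly_Mapping.keys t"]
      by (simp add: lookup_free_scale S.scale_sum_right)
  qed
  show ?thesis
    by unfold_locales (simp_all add: add scl)
qed

text \<open>The universal property, which determines a presented space up to a unique isomorphism
  compatible with the generators:\<close>

lemma presents_universal:
  fixes s :: "'k::field \<Rightarrow> 'v \<Rightarrow> 'v::ab_group_add" and f :: "'b \<Rightarrow> 'v"
    and sW :: "'k \<Rightarrow> 'w \<Rightarrow> 'w::ab_group_add"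
  assumes P: "presents s f R" and W: "vector_space sW" and g: "\<And>r. r \<in> R \<Longrightarrow> lin_ext sW g r = 0"
  shows "\<exists>!\<phi>. Vector_Spaces.linear s sW \<phi> \<and> (\<forall>b. \<phi> (f b) = g b)"
proof -
  have V: "vector_space s" and surj: "surj (lin_ext s f)"
    and ker: "lin_ext s f t = 0 \<longleftrightarrow> t \<in> module.span free_scale R" for t
    using P by (auto simp: presents_def)
  interpret V: vector_space s by fact
  interpret W: vector_space sW by fact
  interpret F: vector_space "free_scale :: 'k \<Rightarrow> ('b \<Rightarrow>\<^sub>0 'k) \<Rightarrow> _" by (rule vector_space_free_scale)
  interpret Lf: Vector_Spaces.linear free_scale s "lin_ext s f" by (rule linear_lin_ext[OF V])
  interpret Lg: Vector_Spaces.linear free_scale sW "lin_ext sW g" by (rule linear_lin_ext[OF W])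
  have gen: "lin_ext s f (Poly_Mapping.single b 1) = f b"
    "lin_ext sW g (Poly_Mapping.single b 1) = g b" for b
    by (simp_all add: lin_ext_def)
  have span0: "lin_ext sW g t = 0" if "t \<in> F.span R" for t
    using that
  proof (induction rule: F.span_induct_alt)
    case base then show ?case by (rule Lg.zero)
  next
    case (step c x y) then show ?case by (simp add: Lg.add Lg.scale g)
  qed
  then have kg: "lin_ext sW g t = lin_ext sW g u" if "lin_ext s f t = lin_ext s f u" for t u
    using that ker[of "t - u"] span0[of "t - u"] by (simp add: Lf.diff Lg.diff)
  define \<phi> where "\<phi> v = lin_ext sW g (inv (lin_ext s f) v)" for v
  have \<phi>: "\<phi> (lin_ext s f t) = lin_ext sW g t" for t
    unfolding \<phi>_def by (rule kg) (simp add: surj_f_inv_f[OF surj])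
  have lin: "Vector_Spaces.linear s sW \<phi>"
  proof unfold_locales
    fix c x y
    obtain t u where [simp]: "x = lin_ext s f t" "y = lin_ext s f u" using surj by (meson surjD)
    show "\<phi> (x + y) = \<phi> x + \<phi> y"
      using \<phi>[of "t + u"] by (simp add: \<phi> Lf.add Lg.add)
    show "\<phi> (s c x) = sW c (\<phi> x)"
      using \<phi>[of "free_scale c t"] by (simp add: \<phi> Lf.scale Lg.scale)
  qed
  show ?thesis
  proof (rule ex1I[of _ \<phi>])
    show "Vector_Spaces.linear s sW \<phi> \<and> (\<forall>b. \<phi> (f b) = g b)"
      using lin \<phi>[of "Poly_Mapping.single _ 1"] by (simp add: gen)
  next
    fix \<phi>' assume A: "Vector_Spaces.linear s sW \<phi>' \<and> (\<forall>b. \<phi>' (f b) = g b)"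
    then interpret L': Vector_Spaces.linear s sW \<phi>' by blast
    have "\<phi>' (lin_ext s f t) = lin_ext sW g t" for t
      using A by (simp add: lin_ext_def L'.sum L'.scale)
    then show "\<phi>' = \<phi>"
      using \<phi> surj by (metis ext surjD)
  qed
qed

text \<open>\<open>odot [v\<^sub>1, \<dots>, v\<^sub>n]\<close> is \<open>v\<^sub>1 \<odot> \<dots> \<odot> v\<^sub>n\<close>, and \<open>odot []\<close> is the unit. The free vector space on lists
  modulo the first two families of relations is the tensor algebra.\<close>

definition symmetric_relations ::
  "('k::field \<Rightarrow> 'v \<Rightarrow> 'v) \<Rightarrow> (int \<Rightarrow> 'v set) \<Rightarrow> ('v::ab_group_add list \<Rightarrow>\<^sub>0 'k) set" where
  "symmetric_relations scale V =
     {Poly_Mapping.single (xs @ (a + b) # ys) 1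
        - Poly_Mapping.single (xs @ a # ys) 1 - Poly_Mapping.single (xs @ b # ys) 1 | xs a b ys. True} \<union>
     {Poly_Mapping.single (xs @ scale c a # ys) 1
        - Poly_Mapping.single (xs @ a # ys) c | xs c a ys. True} \<union>
     {Poly_Mapping.single (xs @ a # b # ys) 1
        - Poly_Mapping.single (xs @ b # a # ys) ((-1) powi (i * j)) | xs a b ys i j. a \<in> V i \<and> b \<in> V j}"

definition symmetric_algebra ::
  "('k::field \<Rightarrow> 'v \<Rightarrow> 'v) \<Rightarrow> (int \<Rightarrow> 'v::ab_group_add set) \<Rightarrow>
   ('k \<Rightarrow> 's \<Rightarrow> 's::ab_group_add) \<Rightarrow> ('v list \<Rightarrow> 's) \<Rightarrow> bool" where
  "symmetric_algebra scale V scaleS odot \<longleftrightarrow> presents scaleS odot (symmetric_relations scale V)"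

definition tensor_relations ::
  "('k::field \<Rightarrow> 'a \<Rightarrow> 'a) \<Rightarrow> ('k \<Rightarrow> 'b \<Rightarrow> 'b) \<Rightarrow> ('a::ab_group_add \<times> 'b::ab_group_add \<Rightarrow>\<^sub>0 'k) set" where
  "tensor_relations scaleA scaleB =
     {Poly_Mapping.single (a + a', b) 1
        - Poly_Mapping.single (a, b) 1 - Poly_Mapping.single (a', b) 1 | a a' b. True} \<union>
     {Poly_Mapping.single (a, b + b') 1
        - Poly_Mapping.single (a, b) 1 - Poly_Mapping.single (a, b') 1 | a b b'. True} \<union>
     {Poly_Mapping.single (scaleA c a, b) 1 - Poly_Mapping.single (a, b) c | c a b. True} \<union>
     {Poly_Mapping.single (a, scaleB c b) 1 - Poly_Mapping.single (a, b) c | c a b. True}"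

definition tensor_product ::
  "('k::field \<Rightarrow> 'a \<Rightarrow> 'a::ab_group_add) \<Rightarrow> ('k \<Rightarrow> 'b \<Rightarrow> 'b::ab_group_add) \<Rightarrow>
   ('k \<Rightarrow> 't \<Rightarrow> 't::ab_group_add) \<Rightarrow> ('a \<Rightarrow> 'b \<Rightarrow> 't) \<Rightarrow> bool" where
  "tensor_product scaleA scaleB scaleT tens \<longleftrightarrow>
     presents scaleT (\<lambda>(a, b). tens a b) (tensor_relations scaleA scaleB)"


section \<open>The coalgebra $S(V)$ and its coderivations\<close>

locale symmetric_coalgebra =
  fixes scale :: "'k::field \<Rightarrow> 'v \<Rightarrow> 'v::ab_group_add"
    and V :: "int \<Rightarrow> 'v set"
    and scaleS :: "'k \<Rightarrow> 's \<Rightarrow> 's::ab_group_add"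
    and odot :: "'v list \<Rightarrow> 's"
    and scaleT :: "'k \<Rightarrow> 't \<Rightarrow> 't::ab_group_add"
    and tens :: "'s \<Rightarrow> 's \<Rightarrow> 't"
  assumes graded: "graded_vector_space scale V"
    and symmetric: "symmetric_algebra scale V scaleS odot"
    and tensor: "tensor_product scaleS scaleS scaleT tens"
begin

definition S_deg :: "int \<Rightarrow> 's set" where
  "S_deg i = module.span scaleS {odot xs | ds xs. homog V ds xs \<and> sum_list ds = i}"

definition comult :: "'s \<Rightarrow> 't" where
  "comult = (THE \<Delta>. Vector_Spaces.linear scaleS scaleT \<Delta> \<and>
     (\<forall>ds xs. homog V ds xs \<longrightarrow>
        \<Delta> (odot xs) = (\<Sum>p=0..length xs. \<Sum>\<sigma>\<in>Sh p (length xs - p).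
          scaleT (\<epsilon> \<sigma> ds) (tens (odot (first p \<sigma> xs)) (odot (rest p \<sigma> xs))))))"

text \<open>The tensor product of two linear maps, the second one of degree \<open>e\<close>:
  \<open>(f \<otimes> g) (a \<otimes> b) = (-1)\<^bsup>e|a|\<^esup> f a \<otimes> g b\<close>.\<close>

definition tensor_map :: "int \<Rightarrow> ('s \<Rightarrow> 's) \<Rightarrow> ('s \<Rightarrow> 's) \<Rightarrow> 't \<Rightarrow> 't" where
  "tensor_map e f g = (THE F. Vector_Spaces.linear scaleT scaleT F \<and>
     (\<forall>i b. \<forall>a\<in>S_deg i. F (tens a b) = scaleT ((-1) powi (e * i)) (tens (f a) (g b))))"

definition Coder :: "int \<Rightarrow> ('s \<Rightarrow> 's) set" where
  "Coder d = {D. Vector_Spaces.linear scaleS scaleS D \<and>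
     (\<forall>i. D ` S_deg i \<subseteq> S_deg (i + d)) \<and>
     (\<forall>x. comult (D x) = tensor_map 0 D id (comult x) + tensor_map d id D (comult x))}"

definition commutator :: "int \<Rightarrow> int \<Rightarrow> ('s \<Rightarrow> 's) \<Rightarrow> ('s \<Rightarrow> 's) \<Rightarrow> 's \<Rightarrow> 's" where
  "commutator d e D E = (\<lambda>x. D (E x) - scaleS ((-1) powi (d * e)) (E (D x)))"

definition proj :: "'s \<Rightarrow> 'v" where
  "proj = (THE \<pi>. Vector_Spaces.linear scaleS scale \<pi> \<and>
     (\<forall>xs. \<pi> (odot xs) = (if length xs = 1 then hd xs else 0)))"

text \<open>\<open>component D [v\<^sub>1, \<dots>, v\<^sub>k]\<close> is \<open>D\<^sub>k (v\<^sub>1 \<odot> \<dots> \<odot> v\<^sub>k)\<close>.\<close>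

definition component :: "('s \<Rightarrow> 's) \<Rightarrow> 'v list \<Rightarrow> 'v" where
  "component D xs = proj (D (odot xs))"

end


section \<open>Lie algebra actions on $L_\infty$ algebras\<close>

text \<open>\<open>decalage [|x\<^sub>1|, \<dots>, |x\<^sub>n|] = \<Sum>\<^sub>i (n - i)|x\<^sub>i|\<close> (with \<open>i\<close> starting from 1)\<close>

definition decalage :: "int list \<Rightarrow> int" where
  "decalage ds = (\<Sum>i<length ds. int (length ds - 1 - i) * ds ! i)"

locale linf_coalgebra = symmetric_coalgebra scale "shift G" scaleS odot scaleT tens
  for scale :: "'k::field \<Rightarrow> 'g \<Rightarrow> 'g::ab_group_add"
    and G :: "int \<Rightarrow> 'g set"
    and scaleS :: "'k \<Rightarrow> 's \<Rightarrow> 's::ab_group_add"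
    and odot :: "'g list \<Rightarrow> 's"
    and scaleT :: "'k \<Rightarrow> 't \<Rightarrow> 't::ab_group_add"
    and tens :: "'s \<Rightarrow> 's \<Rightarrow> 't" +
  fixes l :: "'g list \<Rightarrow> 'g"
  assumes linf: "linf_algebra scale G l"
begin

definition Q :: "'s \<Rightarrow> 's" where
  "Q = (THE D. D \<in> Coder 1 \<and> component D [] = 0 \<and>
     (\<forall>ds xs. homog G ds xs \<and> xs \<noteq> [] \<longrightarrow>
        component D xs =
          scale ((-1) powi (int (length xs * (length xs + 1) div 2) + decalage ds)) (l xs)))"

definition lie_action ::
  "('k \<Rightarrow> 'h \<Rightarrow> 'h) \<Rightarrow> ('h \<Rightarrow> 'h \<Rightarrow> 'h::ab_group_add) \<Rightarrow> ('h \<Rightarrow> 's \<Rightarrow> 's) \<Rightarrow> bool" where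
  "lie_action scaleH br \<psi> \<longleftrightarrow>
     dgla_hom
       scaleH (\<lambda>i. if i = 0 then UNIV else {0}) (\<lambda>_ _. br) (\<lambda>_ _. 0)
       (\<lambda>c D x. scaleS c (D x)) Coder commutator (\<lambda>i. commutator 1 i Q)
       \<psi>"

text \<open>The maps \<open>\<mu>\<^sub>n\<close> associated to \<open>\<psi>\<close>, prescribed on homogeneous vectors. For \<open>n = 0\<close> the sign
  is \<open>-1\<close>, so that \<open>\<mu>\<^sub>0(h)[1] = - \<psi>(h)\<^sub>0(1)\<close>. Since also \<open>\<mu>\<^sub>1(h) = - \<psi>(h)\<^sub>1\<close>, the map \<open>\<mu>\<^sub>1\<close>
  of a strict linear action satisfies \<open>\<mu>\<^sub>1([h, h']) = - [\<mu>\<^sub>1(h), \<mu>\<^sub>1(h')]\<close>: it is the family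
  \<open>- assoc_maps \<psi>\<close>, not \<open>assoc_maps \<psi>\<close>, that is multiplicative in \<open>h\<close>.\<close>

definition assoc_maps :: "('h \<Rightarrow> 's \<Rightarrow> 's) \<Rightarrow> 'h \<Rightarrow> 'g list \<Rightarrow> 'g" where
  "assoc_maps \<psi> h = (THE m. multilinear scale scale m \<and>
     (\<forall>ds xs. homog G ds xs \<longrightarrow>
        m xs = scale ((-1) powi (int ((length xs + 1) * (length xs + 2) div 2) + decalage ds))
                 (component (\<psi> h) xs)))"

end

text \<open>Families of multilinear maps \<open>\<mu>\<^sub>n : \<hh> \<times> \<Lambda>\<^sup>n \<gg> \<rightarrow> \<gg>\<close> of degree \<open>1 - n\<close>\<close>

definition action_maps ::
  "('k::field \<Rightarrow> 'h \<Rightarrow> 'h::ab_group_add) \<Rightarrow> ('k \<Rightarrow> 'g \<Rightarrow> 'g) \<Rightarrow> (int \<Rightarrow> 'g set) \<Rightarrow>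
   ('h \<Rightarrow> 'g list \<Rightarrow> 'g::ab_group_add) \<Rightarrow> bool" where
  "action_maps scaleH scale G \<mu> \<longleftrightarrow>
     (\<forall>xs. Vector_Spaces.linear scaleH scale (\<lambda>h. \<mu> h xs)) \<and>
     (\<forall>h. multilinear scale scale (\<mu> h) \<and> graded_skew scale G (\<mu> h)) \<and>
     (\<forall>h ds xs. homog G ds xs \<longrightarrow> \<mu> h xs \<in> G (sum_list ds + 1 - int (length xs)))"

end

theory Submission
  imports Defs
begin

text \<open>
  Sums over shuffles are rewritten as a recursion along the list: its head either joins the left
  block, or joins the right block and is moved past the left block at the cost of a Koszul sign. In
  this form coassociativity and graded cocommutativity of the shuffle comultiplication are inductions
  on lists, and they show that every graded symmetric family \<open>\<theta>\<close> of multilinear maps extends to a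
  coderivation with components \<open>\<theta>\<close>. Conversely, in characteristic 0 a coderivation is determined by
  its components. Since \<open>[Q, \<psi>(h)]\<close> and \<open>[\<psi>(h), \<psi>(h')] - \<psi>([h, h'])\<close> are again coderivations, being an
  action can be checked on components. The component of a composite \<open>D \<circ> E\<close> is
  \<open>\<Sum> \<epsilon> D(E(x\<^bsub>\<sigma> 1\<^esub>, \<dots>), \<dots>)\<close>, and decalage turns the resulting identities into the two equations for \<open>\<mu>\<close>.
\<close>

section \<open>Signs\<close>

text \<open>Two features shape the proof. The bijection is \<psi> \<mapsto> -
  \<open>assoc_maps\<close> \<psi>: the equation relating \<mu> to the brackets \<open>l\<close> is
  linear in \<mu> and does not see a global sign, but the equation for
  \<open>\<mu> (br h h')\<close> is linear in \<mu> on one side and quadratic on the other. The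
  exponent (n+1)(n+2)/2 in \<open>assoc_maps\<close> leaves a factor -1 in the quadratic terms, and
  passing to the negative removes it. Moreover, Koszul signs make sense only for vectors with chosen
  degrees, and 0 has every degree. The constructions therefore live on lists of pairs (degree,
  vector), and \<open>hom_ext\<close> carries them over to lists of arbitrary vectors by splitting
  each entry into homogeneous components. The spaces S(V) and S(V) \<otimes> S(V) are accessible
  only through generators and relations, so the projection, left multiplication by a vector, the
  counit and every coderivation come from a universal property, by checking multilinearity and
  graded symmetry of a formula on lists.\<close>

definition psign :: "int \<Rightarrow> 'k::field" where
  "psign k = (if even k then 1 else -1)"

lemma powi_minus_one: "(-1::'k::field) powi k = psign k"
  by (simp add: power_int_minus_left psign_def)

lemma psign_0 [simp]: "psign 0 = 1"
  by (simp add: psign_def)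

lemma psign_add: "psign (a + b) = psign a * psign b"
  by (simp add: psign_def)

lemma psign_square [simp]: "psign a * psign a = 1"
  by (simp add: psign_def)

lemma psign_square_left [simp]: "psign a * (psign a * c) = c"
  by (simp add: psign_def)

lemma psign_nonzero [simp]: "psign a \<noteq> 0"
  by (simp add: psign_def)

lemma psign_cong: "even (a - b) \<Longrightarrow> psign a = psign b"
  by (auto simp: psign_def)

lemma minus_one_power: "(-1::'k::field) ^ n = psign (int n)"
  by (simp add: psign_def)

section \<open>Signed sums over unshuffles\<close>

text \<open>The weight \<open>s\<close> is a parameter because the recursion is used with the
  symmetric Koszul sign, with the skew one, and with the symmetric one for degrees lowered by 1. In
  \<open>s y x\<close> the entry \<open>x\<close> stood before \<open>y\<close> in the list and ends
  up behind it.\<close>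

fun unsh :: "('k::field \<Rightarrow> 'w \<Rightarrow> 'w) \<Rightarrow> ('a \<Rightarrow> 'a \<Rightarrow> 'k) \<Rightarrow> ('a list \<Rightarrow> 'a list \<Rightarrow> 'w) \<Rightarrow> 'a list \<Rightarrow>
    'w::ab_group_add" where
  "unsh sc s F [] = F [] []"
| "unsh sc s F (x # xs) = unsh sc s (\<lambda>a b. F (x # a) b) xs
     + unsh sc s (\<lambda>a b. sc (\<Prod>y\<leftarrow>a. s y x) (F a (x # b))) xs"

text \<open>The multiset equation is all that later arguments need to know about the two blocks: it
  passes homogeneity on to them and makes lengths and degree sums additive.\<close>

lemma unsh_cong:
  assumes "\<And>a b. mset a + mset b = mset xs \<Longrightarrow> F a b = G a b"
  shows "unsh sc s F xs = unsh sc s G xs"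
  using assms
proof (induction xs arbitrary: F G)
  case (Cons x xs)
  have "unsh sc s (\<lambda>a b. F (x # a) b) xs = unsh sc s (\<lambda>a b. G (x # a) b) xs"
    by (rule Cons.IH) (simp add: Cons.prems)
  moreover have "unsh sc s (\<lambda>a b. sc (\<Prod>y\<leftarrow>a. s y x) (F a (x # b))) xs
      = unsh sc s (\<lambda>a b. sc (\<Prod>y\<leftarrow>a. s y x) (G a (x # b))) xs"
    by (rule Cons.IH) (simp add: Cons.prems)
  ultimately show ?case by simp
qed simp

lemma unsh_add:
  assumes "vector_space sc"
  shows "unsh sc s (\<lambda>a b. F a b + G a b) xs = unsh sc s F xs + unsh sc s G xs"
proof -
  interpret vector_space sc by fact
  show ?thesis
    by (induction xs arbitrary: F G) (simp_all add: scale_right_distrib)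
qed

lemma unsh_linear:
  assumes "Vector_Spaces.linear sc sc' f"
  shows "f (unsh sc s F xs) = unsh sc' s (\<lambda>a b. f (F a b)) xs"
proof -
  interpret f: Vector_Spaces.linear sc sc' f by fact
  show ?thesis
    by (induction xs arbitrary: F) (simp_all add: f.add f.scale)
qed

lemma lin_scale_self:
  "vector_space sc \<Longrightarrow> Vector_Spaces.linear sc sc (sc (c::'k::field))"
  by (rule vector_space.linear_scale_self)

lemma unsh_scale:
  assumes "vector_space sc"
  shows "sc c (unsh sc s F xs) = unsh sc s (\<lambda>a b. sc c (F a b)) xs"
  using unsh_linear[OF lin_scale_self[OF assms]] by blast

lemma unsh_zero:
  assumes "vector_space sc"
  shows "unsh sc s (\<lambda>a b. 0) xs = 0"
proof -
  interpret vector_space sc by fact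
  show ?thesis by (induction xs) simp_all
qed

lemma unsh_minus:
  assumes "vector_space sc"
  shows "unsh sc s (\<lambda>a b. - F a b) xs = - unsh sc s F xs"
proof -
  interpret vector_space sc by fact
  show ?thesis
    by (induction xs arbitrary: F) (simp_all add: scale_minus_right)
qed

lemma unsh_diff:
  assumes "vector_space sc"
  shows "unsh sc s (\<lambda>a b. F a b - G a b) xs = unsh sc s F xs - unsh sc s G xs"
  using unsh_add[OF assms, of s F "\<lambda>a b. - G a b"] by (simp add: unsh_minus[OF assms])

lemma unsh_left_Nil:
  assumes "vector_space sc" and "\<And>a b. a \<noteq> [] \<Longrightarrow> F a b = 0"
  shows "unsh sc s F xs = F [] xs"
proof -
  interpret vector_space sc by fact
  show ?thesis using assms(2)
  proof (induction xs arbitrary: F)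
    case (Cons x xs)
    have "unsh sc s (\<lambda>a b. sc (\<Prod>y\<leftarrow>a. s y x) (F a (x # b))) xs = F [] (x # xs)"
      by (subst Cons.IH) (auto simp: Cons.prems)
    moreover have "(\<lambda>a. F (x # a)) = (\<lambda>a b. 0)"
      by (intro ext) (simp add: Cons.prems)
    ultimately show ?case by (simp add: unsh_zero[OF assms(1)])
  qed simp
qed

lemma unsh_right_Nil:
  assumes "vector_space sc" and "\<And>a b. b \<noteq> [] \<Longrightarrow> F a b = 0"
  shows "unsh sc s F xs = F xs []"
proof -
  interpret vector_space sc by fact
  show ?thesis using assms(2)
    by (induction xs arbitrary: F) (simp_all add: unsh_zero[OF assms(1)])
qed

text \<open>Both sides sum over splittings into three blocks. In the induction the head joins the
  second block in \<open>A\<close>, the third in \<open>B\<close> and the first in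
  \<open>C\<close>.\<close>

lemma unsh_assoc:
  fixes sc :: "'k::field \<Rightarrow> 'w \<Rightarrow> 'w::ab_group_add" and s :: "'a \<Rightarrow> 'a \<Rightarrow> 'k"
  assumes "vector_space sc"
  shows "unsh sc s (\<lambda>a c. unsh sc s (F a) c) xs
    = unsh sc s (\<lambda>c b'. unsh sc s (\<lambda>a b. F a b b') c) xs"
proof (induction xs arbitrary: F)
  case (Cons x xs)
  interpret vector_space sc by fact
  \<comment> \<open>An entry of the third block has moved past all of \<open>c\<close>; since
    \<open>c\<close> is a rearrangement of \<open>a\<close> and \<open>b\<close> together, its sign
    is the product of the signs for \<open>a\<close> and for \<open>b\<close>.\<close>
  have *: "unsh sc s (\<lambda>c b'. sc (\<Prod>y\<leftarrow>c. s y x) (unsh sc s (\<lambda>a b. F a b (x # b')) c)) xs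
    = unsh sc s (\<lambda>c b'. unsh sc s (\<lambda>a b. sc (\<Prod>y\<leftarrow>a. s y x) (sc (\<Prod>y\<leftarrow>b. s y x) (F a b (x # b')))) c) xs"
  proof (rule unsh_cong, unfold unsh_scale[OF assms], rule unsh_cong)
    fix a b c assume "mset a + mset b = mset (c :: 'a list)"
    then have "mset c = mset a + mset b" by simp
    then have "(\<Prod>y\<leftarrow>c. s y x) = (\<Prod>y\<leftarrow>a. s y x) * (\<Prod>y\<leftarrow>b. s y x)"
      by (metis prod_mset_prod_list mset_map image_mset_union prod_mset.union)
    then show "sc (\<Prod>y\<leftarrow>c. s y x) (F a b (x # b')) =
        sc (\<Prod>y\<leftarrow>a. s y x) (sc (\<Prod>y\<leftarrow>b. s y x) (F a b (x # b')))" for b'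
      by simp
  qed
  have A: "unsh sc s (\<lambda>a c. sc (\<Prod>y\<leftarrow>a. s y x) (unsh sc s (\<lambda>b b'. F a (x # b) b') c)) xs
     = unsh sc s (\<lambda>c b'. unsh sc s (\<lambda>a b. sc (\<Prod>y\<leftarrow>a. s y x) (F a (x # b) b')) c) xs"
    unfolding unsh_scale[OF assms] by (rule Cons.IH)
  have B: "unsh sc s (\<lambda>a c. sc (\<Prod>y\<leftarrow>a. s y x)
              (unsh sc s (\<lambda>b b'. sc (\<Prod>y\<leftarrow>b. s y x) (F a b (x # b'))) c)) xs
     = unsh sc s (\<lambda>c b'. sc (\<Prod>y\<leftarrow>c. s y x) (unsh sc s (\<lambda>a b. F a b (x # b')) c)) xs"
    unfolding * unfolding unsh_scale[OF assms] by (rule Cons.IH)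
  have C: "unsh sc s (\<lambda>a c. unsh sc s (F (x # a)) c) xs
     = unsh sc s (\<lambda>c b'. unsh sc s (\<lambda>a b. F (x # a) b b') c) xs"
    by (rule Cons.IH)
  show ?case
    by (simp add: unsh_add[OF assms] scale_right_distrib A B C)
qed simp

text \<open>Graded cocommutativity: exchanging the blocks moves each entry of one past each entry of
  the other, which gives the double product.\<close>

lemma unsh_commute:
  fixes sc :: "'k::field \<Rightarrow> 'w \<Rightarrow> 'w::ab_group_add" and s :: "'a \<Rightarrow> 'a \<Rightarrow> 'k"
  assumes "vector_space sc" and s: "\<And>x y. s x y * s y x = 1"
  shows "unsh sc s F xs = unsh sc s (\<lambda>a b. sc (\<Prod>y\<leftarrow>a. \<Prod>x\<leftarrow>b. s x y) (F b a)) xs"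
proof (induction xs arbitrary: F)
  case Nil
  interpret vector_space sc by fact
  show ?case by simp
next
  case (Cons x xs)
  interpret vector_space sc by fact
  \<comment> \<open>Moving \<open>x\<close> past \<open>a\<close> and back again costs nothing; this
    is where the hypothesis on \<open>s\<close> enters.\<close>
  have s': "(\<Prod>y\<leftarrow>a. s y x) * ((\<Prod>y\<leftarrow>a. s x y) * c) = c" for a and c
    by (induction a) (simp_all, metis (no_types, lifting) s mult.assoc mult.left_commute mult_1)
  have distr: "(\<Prod>y\<leftarrow>a. s x y * f y) = (\<Prod>y\<leftarrow>a. s x y) * (\<Prod>y\<leftarrow>a. f y)" for a and f :: "'a \<Rightarrow> 'k"
    by (induction a) simp_all
  show ?case
    by (simp add: Cons.IH[of "\<lambda>a b. F (x # a) b"] distr s' 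
        Cons.IH[of "\<lambda>a b. sc (\<Prod>y\<leftarrow>a. s y x) (F a (x # b))"] mult.commute add.commute)
qed


section \<open>Splittings as sets of positions, and shuffles as permutations\<close>

lemma prod_nths: "(\<Prod>x\<leftarrow>nths xs J. f x) = (\<Prod>i\<in>J \<inter> {..<length xs}. f (xs ! i))"
  for f :: "'a \<Rightarrow> 'k::comm_monoid_mult"
proof (induction xs arbitrary: J)
  case (Cons x xs)
  have J: "J \<inter> {..<length (x # xs)}
      = (if 0 \<in> J then {0} else {}) \<union> Suc ` ({j. Suc j \<in> J} \<inter> {..<length xs})"
    by (auto simp: image_iff less_Suc_eq_0_disj split: if_splits)
  have "(\<Prod>i\<in>Suc ` ({j. Suc j \<in> J} \<inter> {..<length xs}). f ((x # xs) ! i))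
      = (\<Prod>x\<leftarrow>nths xs {j. Suc j \<in> J}. f x)"
    by (subst prod.reindex) (auto simp: Cons.IH)
  then show ?case
    unfolding J nths_Cons by (cases "0 \<in> J") (simp_all add: prod.insert_if image_iff)
qed simp

text \<open>The image of \<open>inversions\<close> under the shuffle whose left block occupies the
  positions \<open>I\<close>. Recording positions instead of indices makes the set depend on
  \<open>I\<close> only.\<close>

definition crossings :: "nat \<Rightarrow> nat set \<Rightarrow> (nat \<times> nat) set" where
  "crossings n I = {(x, y). y < x \<and> x < n \<and> x \<in> I \<and> y \<notin> I}"

lemma finite_crossings [simp]: "finite (crossings n I)"
  by (rule finite_subset[of _ "{..<n} \<times> {..<n}"]) (auto simp: crossings_def)

text \<open>The middle stage between the recursion and the sum over \<open>Sh\<close>: a splitting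
  is given by the set of positions of its left block. Position 0 belongs to this set or not, which
  matches the two summands of the recursion.\<close>

lemma unsh_eq_sum_subsets:
  assumes "vector_space sc"
  shows "unsh sc s F zs = (\<Sum>I\<in>Pow {..<length zs}.
    sc (\<Prod>(x, y)\<in>crossings (length zs) I. s (zs ! x) (zs ! y)) (F (nths zs I) (nths zs (- I))))"
proof (induction zs arbitrary: F)
  case Nil
  interpret vector_space sc by fact
  show ?case by (simp add: crossings_def)
next
  case (Cons z zs)
  interpret vector_space sc by fact
  let ?n = "length zs"
  let ?P = "\<lambda>zs I. \<Prod>(x, y)\<in>crossings (length zs) I. s (zs ! x) (zs ! y)"
  let ?T = "\<lambda>I. sc (?P (z # zs) I) (F (nths (z # zs) I) (nths (z # zs) (- I)))"
  have Pow: "Pow {..<Suc ?n} = (\<lambda>J. insert 0 (Suc ` J)) ` Pow {..<?n} \<union> (`) Suc ` Pow {..<?n}"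
    unfolding lessThan_Suc_eq_insert_0 Pow_insert image_Pow_surj[OF refl, symmetric] image_image
    by (rule Un_commute)
  have inj: "inj_on (\<lambda>J. insert 0 (Suc ` J)) (Pow {..<?n})" "inj_on ((`) Suc) (Pow {..<?n})"
    by (auto intro!: inj_onI)
  have Suc_I: "{j. Suc j \<in> insert 0 (Suc ` J)} = J" "{j. Suc j \<in> Suc ` J} = J"
    "{j. Suc j \<notin> Suc ` J} = - J" "{j. Suc j \<in> - insert 0 (Suc ` J)} = - J" for J
    by auto
  have c1: "crossings (Suc ?n) (insert 0 (Suc ` J)) = map_prod Suc Suc ` crossings ?n J" for J
  proof (rule set_eqI, clarify)
    fix a b show "((a, b) \<in> crossings (Suc ?n) (insert 0 (Suc ` J))) =
        ((a, b) \<in> map_prod Suc Suc ` crossings ?n J)"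
      by (cases a; cases b) (auto simp: crossings_def)
  qed
  \<comment> \<open>If position 0 goes to the right block, every element of the left block crosses
    it. These new pairs form the sign factor of the recursion.\<close>
  have c2: "crossings (Suc ?n) (Suc ` J) =
      map_prod Suc Suc ` crossings ?n J \<union> (\<lambda>x. (Suc x, 0)) ` (J \<inter> {..<?n})" for J
  proof (rule set_eqI, clarify)
    fix a b show "((a, b) \<in> crossings (Suc ?n) (Suc ` J)) =
        ((a, b) \<in> map_prod Suc Suc ` crossings ?n J \<union> (\<lambda>x. (Suc x, 0)) ` (J \<inter> {..<?n}))"
      by (cases a; cases b) (auto simp: crossings_def)
  qed
  have inj': "inj_on (map_prod Suc Suc) A" "inj_on (\<lambda>x. (Suc x, 0::nat)) B" for A B
    by (auto intro!: inj_onI)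
  have P1: "?P (z # zs) (insert 0 (Suc ` J)) = ?P zs J" for J
    by (simp add: c1 prod.reindex inj' case_prod_unfold)
  have P2: "?P (z # zs) (Suc ` J) = ?P zs J * (\<Prod>y\<leftarrow>nths zs J. s y z)" for J
    unfolding prod_nths list.size add_0_right add_Suc_right c2
    by (subst prod.union_disjoint) (auto simp: prod.reindex inj' case_prod_unfold)
  have "(\<Sum>I\<in>Pow {..<length (z # zs)}. ?T I)
      = (\<Sum>J\<in>Pow {..<?n}. ?T (insert 0 (Suc ` J))) + (\<Sum>J\<in>Pow {..<?n}. ?T (Suc ` J))"
    unfolding list.size add_0_right add_Suc_right Pow
    by (subst sum.union_disjoint) (auto simp: sum.reindex[OF inj(1)] sum.reindex[OF inj(2)])
  also have "\<dots> = unsh sc s F (z # zs)"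
    unfolding P1 P2 by (simp add: Cons.IH nths_Cons Suc_I mult.commute)
  finally show ?case by simp
qed

text \<open>The shuffle with left block \<open>I\<close>: the elements of \<open>I\<close> in
  increasing order, followed by those of the complement. It is the identity from \<open>n\<close>
  on, as \<open>permutes\<close> demands.\<close>

definition shuf :: "nat \<Rightarrow> nat set \<Rightarrow> nat \<Rightarrow> nat" where
  "shuf n I i = (if i < n then (nths [0..<n] I @ nths [0..<n] (- I)) ! i else i)"

lemma sorted_list_unique:
  fixes xs ys :: "nat list"
  assumes "sorted_wrt (<) xs" "sorted_wrt (<) ys" "set xs = set ys"
  shows "xs = ys"
  using assms strict_sorted_equal by blast

lemma strict_sorted_nths_upt: "sorted_wrt (<) (nths [0..<n] I)"
  by (simp add: strict_sorted_iff sorted_nths)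

lemma set_nths_upt: "set (nths [0..<n] I) = I \<inter> {..<n}"
  by (force simp: set_nths)

lemma length_nths_upt: "length (nths [0..<n] I) = card (I \<inter> {..<n})"
  using distinct_card[of "nths [0..<n] I"] by (simp add: set_nths_upt)

text \<open>A strictly increasing list is determined by its set of entries, so a shuffle is
  determined by the image of its left block.\<close>

lemma Sh_lists:
  assumes "\<sigma> \<in> Sh p q"
  shows "map \<sigma> [0..<p] = nths [0..<p + q] (\<sigma> ` {..<p})"
    and "map \<sigma> [p..<p + q] = nths [0..<p + q] (- \<sigma> ` {..<p})"
proof -
  have \<sigma>: "\<sigma> permutes {..<p + q}" "strict_mono_on {..<p} \<sigma>" "strict_mono_on {p..<p + q} \<sigma>"
    using assms by (auto simp: Sh_def)
  have im: "\<sigma> ` {..<p + q} = {..<p + q}" using \<sigma>(1) by (rule permutes_image)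
  have im2: "\<sigma> ` {p..<p + q} = - \<sigma> ` {..<p} \<inter> {..<p + q}"
  proof -
    have "{p..<p + q} = {..<p + q} - {..<p}" by auto
    then have "\<sigma> ` {p..<p + q} = \<sigma> ` {..<p + q} - \<sigma> ` {..<p}"
      using permutes_inj[OF \<sigma>(1)] by (metis image_set_diff)
    then show ?thesis using im by auto
  qed
  show "map \<sigma> [0..<p] = nths [0..<p + q] (\<sigma> ` {..<p})"
  proof (rule sorted_list_unique)
    show "sorted_wrt (<) (map \<sigma> [0..<p])"
      using \<sigma>(2) by (auto simp: sorted_wrt_iff_nth_less strict_mono_on_def)
    show "set (map \<sigma> [0..<p]) = set (nths [0..<p + q] (\<sigma> ` {..<p}))"
      using im by (auto simp: set_nths_upt)
  qed (rule strict_sorted_nths_upt)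
  show "map \<sigma> [p..<p + q] = nths [0..<p + q] (- \<sigma> ` {..<p})"
  proof (rule sorted_list_unique)
    show "sorted_wrt (<) (map \<sigma> [p..<p + q])"
      using \<sigma>(3) by (auto simp: sorted_wrt_iff_nth_less strict_mono_on_def)
    show "set (map \<sigma> [p..<p + q]) = set (nths [0..<p + q] (- \<sigma> ` {..<p}))"
      using im2 by (auto simp: set_nths_upt)
  qed (rule strict_sorted_nths_upt)
qed

text \<open>Since \<open>p\<close> varies too, subsets of every size occur, and \<open>p\<close> is
  recovered as the cardinality.\<close>

lemma bij_betw_Sh:
  "bij_betw (\<lambda>(p, \<sigma>). \<sigma> ` {..<p}) (SIGMA p:{0..n}. Sh p (n - p)) (Pow {..<n})"
proof (rule bij_betw_byWitness[where f' = "\<lambda>I. (card I, shuf n I)"])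
  show "\<forall>a\<in>SIGMA p:{0..n}. Sh p (n - p).
      (case case a of (p, \<sigma>) \<Rightarrow> \<sigma> ` {..<p} of I \<Rightarrow> (card I, shuf n I)) = a"
  proof clarsimp
    fix p \<sigma> assume p: "p \<le> n" and \<sigma>: "\<sigma> \<in> Sh p (n - p)"
    have perm: "\<sigma> permutes {..<n}" using \<sigma> p by (simp add: Sh_def)
    have "card (\<sigma> ` {..<p}) = p"
      using permutes_inj[OF perm] by (simp add: card_image inj_on_subset)
    moreover have "shuf n (\<sigma> ` {..<p}) = \<sigma>"
    proof
      fix i
      have "[0..<n] = [0..<p] @ [p..<n]" using p by (metis le0 upt_add_eq_append le_add_diff_inverse)
      then have "map \<sigma> [0..<n] = nths [0..<n] (\<sigma> ` {..<p}) @ nths [0..<n] (- \<sigma> ` {..<p})"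
        using Sh_lists[OF \<sigma>] p by simp
      then show "shuf n (\<sigma> ` {..<p}) i = \<sigma> i"
        using perm by (auto simp: shuf_def permutes_def nth_append simp flip: \<open>map \<sigma> [0..<n] = _\<close>)
    qed
    ultimately show "card (\<sigma> ` {..<p}) = p \<and> shuf n (\<sigma> ` {..<p}) = \<sigma>" by blast
  qed
next
  have key: "shuf n I permutes {..<n} \<and> strict_mono_on {..<card I} (shuf n I) \<and>
       strict_mono_on {card I..<n} (shuf n I) \<and> shuf n I ` {..<card I} = I \<and> card I \<le> n"
    if I: "I \<subseteq> {..<n}" for I
  proof -
    let ?A = "nths [0..<n] I" and ?B = "nths [0..<n] (- I)"
    have A: "length ?A = card I" "set ?A = I" and B: "set ?B = {..<n} - I"
      using I by (auto simp: length_nths_upt set_nths_upt Int_absorb2)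
    have cI: "card I \<le> n" using I by (metis card_lessThan card_mono finite_lessThan)
    have lB: "length ?B = n - card I"
    proof -
      have "length ?B = card ({..<n} - I)" by (simp add: length_nths_upt Diff_eq Int_commute)
      then show ?thesis using I by (simp add: card_Diff_subset finite_subset)
    qed
    have set: "set (?A @ ?B) = {..<n}" using I A B by auto
    have len: "length (?A @ ?B) = n" using A lB cI by simp
    have dist: "distinct (?A @ ?B)" using A B by auto
    have "bij_betw ((!) (?A @ ?B)) {..<n} {..<n}"
      using bij_betw_nth[OF dist] len set by metis
    then have "bij_betw (shuf n I) {..<n} {..<n}"
      by (rule bij_betw_cong[THEN iffD1, rotated]) (simp add: shuf_def)
    then have 1: "shuf n I permutes {..<n}"
      by (rule bij_imp_permutes) (simp add: shuf_def)
    have sA: "shuf n I i = ?A ! i" if "i < card I" for i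
      using that A cI by (simp add: shuf_def nth_append)
    have sB: "shuf n I i = ?B ! (i - card I)" if "card I \<le> i" "i < n" for i
      using that A by (simp add: shuf_def nth_append)
    have 2: "strict_mono_on {..<card I} (shuf n I)"
      using strict_sorted_nths_upt[of n I] A(1)
      by (auto simp: sorted_wrt_iff_nth_less strict_mono_on_def sA)
    have 3: "strict_mono_on {card I..<n} (shuf n I)"
      using strict_sorted_nths_upt[of n "- I"] lB
      by (auto simp: sorted_wrt_iff_nth_less strict_mono_on_def sB)
    have "shuf n I ` {..<card I} = (!) ?A ` {..<length ?A}"
      using sA A by simp
    also have "\<dots> = I" using A(2) by (simp add: set_conv_nth image_def) blast
    finally show ?thesis using 1 2 3 cI by blast
  qed
  show "\<forall>I\<in>Pow {..<n}. (case (card I, shuf n I) of (p, \<sigma>) \<Rightarrow> \<sigma> ` {..<p}) = I"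
    using key by auto
  show "(\<lambda>I. (card I, shuf n I)) ` Pow {..<n} \<subseteq> (SIGMA p:{0..n}. Sh p (n - p))"
    using key by (auto simp: Sh_def)
  show "(\<lambda>(p, \<sigma>). \<sigma> ` {..<p}) ` (SIGMA p:{0..n}. Sh p (n - p)) \<subseteq> Pow {..<n}"
  proof clarsimp
    fix p \<sigma> i assume "p \<le> n" "\<sigma> \<in> Sh p (n - p)" "i < p"
    then show "\<sigma> i < n"
      using permutes_in_image[of \<sigma> "{..<n}" i] by (simp add: Sh_def)
  qed
qed

lemma inversions_Sh:
  assumes "\<sigma> \<in> Sh p (n - p)" and "p \<le> n"
  shows "bij_betw (map_prod \<sigma> \<sigma>) (inversions n \<sigma>) (crossings n (\<sigma> ` {..<p}))"
proof -
  have \<sigma>: "\<sigma> permutes {..<n}" "strict_mono_on {..<p} \<sigma>" "strict_mono_on {p..<n} \<sigma>"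
    using assms by (auto simp: Sh_def)
  have inj: "inj \<sigma>" using \<sigma>(1) by (rule permutes_inj)
  have lt: "\<sigma> i < n \<longleftrightarrow> i < n" for i using permutes_in_image[OF \<sigma>(1), of i] by simp
  \<comment> \<open>A shuffle increases on each block, so an inversion has its two indices in
    different blocks.\<close>
  have *: "i < p \<and> p \<le> j" if "i < j" "j < n" "\<sigma> j < \<sigma> i" for i j
    using that strict_mono_onD[OF \<sigma>(2), of i j] strict_mono_onD[OF \<sigma>(3), of i j]
    by (auto simp: not_le[symmetric])
  have "map_prod \<sigma> \<sigma> ` inversions n \<sigma> = crossings n (\<sigma> ` {..<p})"
  proof (intro equalityI subsetI)
    fix z assume "z \<in> map_prod \<sigma> \<sigma> ` inversions n \<sigma>"
    then obtain i j where "z = (\<sigma> i, \<sigma> j)" "i < j" "j < n" "\<sigma> j < \<sigma> i"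
      by (auto simp: inversions_def)
    then show "z \<in> crossings n (\<sigma> ` {..<p})"
      using *[of i j] inj by (auto simp: crossings_def lt inj_image_mem_iff)
  next
    fix z assume "z \<in> crossings n (\<sigma> ` {..<p})"
    then obtain i y where z: "z = (\<sigma> i, y)" "y < \<sigma> i" "\<sigma> i < n" "i < p" "y \<notin> \<sigma> ` {..<p}"
      by (auto simp: crossings_def)
    obtain j where j: "y = \<sigma> j" using permutes_surj[OF \<sigma>(1)] by blast
    have "j < n" using z lt j by (metis less_trans)
    then show "z \<in> map_prod \<sigma> \<sigma> ` inversions n \<sigma>"
      using z j by (intro image_eqI[of _ _ "(i, j)"]) (auto simp: inversions_def)
  qed
  then show ?thesis
    using inj by (auto simp: bij_betw_def intro!: inj_onI dest: injD)
qed

lemma first_rest_Sh: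
  assumes "\<sigma> \<in> Sh p (length zs - p)" and "p \<le> length zs"
  shows "first p \<sigma> zs = nths zs (\<sigma> ` {..<p})" "rest p \<sigma> zs = nths zs (- \<sigma> ` {..<p})"
proof -
  let ?n = "length zs"
  have zs: "zs = map ((!) zs) [0..<?n]" by (simp add: map_nth)
  have n: "p + (?n - p) = ?n" using assms by simp
  have "first p \<sigma> zs = map ((!) zs) (map \<sigma> [0..<p])"
    using assms(2) by (simp add: first_def permute_list_def take_map)
  also have "\<dots> = nths (map ((!) zs) [0..<?n]) (\<sigma> ` {..<p})"
    unfolding Sh_lists(1)[OF assms(1)] n nths_map ..
  finally show "first p \<sigma> zs = nths zs (\<sigma> ` {..<p})" by (simp add: map_nth)
  have "rest p \<sigma> zs = map ((!) zs) (map \<sigma> [p..<p + (?n - p)])"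
    using assms(2) by (simp add: rest_def permute_list_def drop_map)
  also have "\<dots> = nths (map ((!) zs) [0..<?n]) (- \<sigma> ` {..<p})"
    unfolding n Sh_lists(2)[OF assms(1), unfolded n] nths_map ..
  finally show "rest p \<sigma> zs = nths zs (- \<sigma> ` {..<p})" by (simp add: map_nth)
qed

text \<open>The bridge from the sums over shuffles in the definitions to the recursion. Once it is
  available, identities between such sums are proved by induction on lists, without handling
  permutations.\<close>

lemma sum_Sh_eq_unsh:
  assumes "vector_space sc"
  shows "(\<Sum>p=0..length zs. \<Sum>\<sigma>\<in>Sh p (length zs - p).
      sc (\<Prod>(i, j)\<in>inversions (length zs) \<sigma>. s (zs ! \<sigma> i) (zs ! \<sigma> j)) (F (first p \<sigma> zs) (rest p \<sigma> zs)))
    = unsh sc s F zs"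
proof -
  let ?n = "length zs"
  have fin: "finite (Sh p q)" for p q
    by (rule finite_subset[OF _ finite_permutations[of "{..<p + q}"]]) (auto simp: Sh_def)
  have "(\<Sum>p=0..?n. \<Sum>\<sigma>\<in>Sh p (?n - p).
      sc (\<Prod>(i, j)\<in>inversions ?n \<sigma>. s (zs ! \<sigma> i) (zs ! \<sigma> j)) (F (first p \<sigma> zs) (rest p \<sigma> zs)))
    = (\<Sum>(p, \<sigma>)\<in>(SIGMA p:{0..?n}. Sh p (?n - p)).
      sc (\<Prod>(i, j)\<in>inversions ?n \<sigma>. s (zs ! \<sigma> i) (zs ! \<sigma> j)) (F (first p \<sigma> zs) (rest p \<sigma> zs)))"
    by (rule sum.Sigma) (auto simp: fin)
  also have "\<dots> = (\<Sum>I\<in>Pow {..<?n}.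
      sc (\<Prod>(x, y)\<in>crossings ?n I. s (zs ! x) (zs ! y)) (F (nths zs I) (nths zs (- I))))"
  proof (subst sum.reindex_bij_betw[OF bij_betw_Sh, symmetric], rule sum.cong, simp, clarify)
    fix p \<sigma> assume p: "p \<in> {0..?n}" and \<sigma>: "\<sigma> \<in> Sh p (?n - p)"
    then have p': "p \<le> ?n" by simp
    show "sc (\<Prod>(i, j)\<in>inversions ?n \<sigma>. s (zs ! \<sigma> i) (zs ! \<sigma> j)) (F (first p \<sigma> zs) (rest p \<sigma> zs))
      = sc (\<Prod>(x, y)\<in>crossings ?n (\<sigma> ` {..<p}). s (zs ! x) (zs ! y))
          (F (nths zs (\<sigma> ` {..<p})) (nths zs (- \<sigma> ` {..<p})))"
      unfolding first_rest_Sh[OF \<sigma> p']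
      by (subst prod.reindex_bij_betw[OF inversions_Sh[OF \<sigma> p'], symmetric])
        (simp add: case_prod_unfold)
  qed
  finally show ?thesis unfolding unsh_eq_sum_subsets[OF assms] .
qed

section \<open>Calculus of linear maps\<close>

abbreviation lin where "lin \<equiv> Vector_Spaces.linear"

lemmas lin_iff = Vector_Spaces.linear_iff

lemma lin_add: "lin s s' f \<Longrightarrow> f (x + y) = f x + f y"
  and lin_scale: "lin s s' f \<Longrightarrow> f (s c x) = s' c (f x)"
  by (simp_all add: lin_iff)

lemma lin_0: "lin s s' f \<Longrightarrow> f 0 = 0"
  by (metis add_cancel_right_right lin_add)

lemma lin_minus: "lin s s' f \<Longrightarrow> f (- x) = - f x"
  by (metis add_eq_0_iff lin_0 lin_add)

lemma lin_diff: "lin s s' f \<Longrightarrow> f (x - y) = f x - f y"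
  by (metis add_uminus_conv_diff lin_add lin_minus)

lemma lin_sum: "lin s s' f \<Longrightarrow> f (\<Sum>i\<in>A. g i) = (\<Sum>i\<in>A. f (g i))"
  by (induction A rule: infinite_finite_induct) (simp_all add: lin_0 lin_add)

lemma linI:
  assumes "vector_space s" "vector_space s'" "\<And>x y. f (x + y) = f x + f y" "\<And>c x. f (s c x) = s' c (f x)"
  shows "lin s s' f"
  using assms by (simp add: lin_iff)

lemma lin_compose: "lin s s' f \<Longrightarrow> lin s' s'' g \<Longrightarrow> lin s s'' (\<lambda>x. g (f x))"
  by (simp add: lin_iff)

lemma lin_ident: "vector_space s \<Longrightarrow> lin s s (\<lambda>x. x)" 
  by (simp add: lin_iff)

lemma lin_compose_scale: 
  assumes "lin s s' f" shows "lin s s' (\<lambda>x. s' c (f x))"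
proof -
  have "vector_space s'" using assms by (simp add: lin_iff)
  then show ?thesis using lin_compose[OF assms lin_scale_self] by blast
qed

lemma lin_compose_add:
  assumes "lin s s' f" "lin s s' g" shows "lin s s' (\<lambda>x. f x + g x)"
proof -
  interpret vector_space s' using assms by (simp add: lin_iff)
  show ?thesis using assms by (simp add: lin_iff scale_right_distrib algebra_simps)
qed

lemma lin_compose_minus:
  assumes "lin s s' f" shows "lin s s' (\<lambda>x. - f x)"
proof -
  interpret vector_space s' using assms by (simp add: lin_iff)
  show ?thesis using assms by (simp add: lin_iff scale_minus_right)
qed

lemma lin_compose_diff:
  assumes "lin s s' f" "lin s s' g" shows "lin s s' (\<lambda>x. f x - g x)"
  using lin_compose_add[OF assms(1) lin_compose_minus[OF assms(2)]] by simp

lemma lin_zero: "vector_space s \<Longrightarrow> vector_space s' \<Longrightarrow> lin s s' (\<lambda>x. 0)"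
  using module.scale_zero_right module_iff_vector_space by (fastforce simp: lin_iff)

lemma lin_unsh:
  assumes "\<And>a b. lin s sc (\<lambda>x. F x a b)" "vector_space s" "vector_space sc"
  shows "lin s sc (\<lambda>x. unsh sc sg (F x) zs)"
proof (rule linI)
  show "unsh sc sg (F (x + y)) zs = unsh sc sg (F x) zs + unsh sc sg (F y) zs" for x y
  proof -
    have "F (x + y) = (\<lambda>a b. F x a b + F y a b)" by (intro ext lin_add[OF assms(1)])
    then show ?thesis by (simp add: unsh_add[OF assms(3)])
  qed
  show "unsh sc sg (F (s c x)) zs = sc c (unsh sc sg (F x) zs)" for c x
  proof -
    have "F (s c x) = (\<lambda>a b. sc c (F x a b))" by (intro ext lin_scale[OF assms(1)])
    then show ?thesis by (simp add: unsh_scale[OF assms(3)])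
  qed
qed (use assms in auto)

section \<open>Koszul signs\<close>

definition degsum :: "(int \<times> 'v) list \<Rightarrow> int" where
  "degsum zs = sum_list (map fst zs)"

lemma degsum_simps [simp]:
  "degsum [] = 0" "degsum (z # zs) = fst z + degsum zs" "degsum (xs @ ys) = degsum xs + degsum ys"
  by (simp_all add: degsum_def)

lemma degsum_mset: "mset a + mset b = mset zs \<Longrightarrow> degsum zs = degsum a + degsum b"
  unfolding degsum_def by (metis map_append mset_append mset_map sum_list_append sum_mset_sum_list)

abbreviation usym :: "('k::field \<Rightarrow> 'w \<Rightarrow> 'w) \<Rightarrow> ((int \<times> 'v) list \<Rightarrow> (int \<times> 'v) list \<Rightarrow> 'w) \<Rightarrow>
    (int \<times> 'v) list \<Rightarrow> 'w::ab_group_add" where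
  "usym sc \<equiv> unsh sc (\<lambda>z w. psign (fst z * fst w))"

abbreviation uskew :: "('k::field \<Rightarrow> 'w \<Rightarrow> 'w) \<Rightarrow> ((int \<times> 'v) list \<Rightarrow> (int \<times> 'v) list \<Rightarrow> 'w) \<Rightarrow>
    (int \<times> 'v) list \<Rightarrow> 'w::ab_group_add" where
  "uskew sc \<equiv> unsh sc (\<lambda>z w. - psign (fst z * fst w))"

lemma prod_psign [simp]: "(\<Prod>y\<leftarrow>a. psign (fst y * d)) = psign (degsum a * d)"
  by (induction a) (simp_all add: psign_add algebra_simps)

lemma usym_Cons: "usym sc F (z # zs) = usym sc (\<lambda>a b. F (z # a) b) zs
     + usym sc (\<lambda>a b. sc (psign (degsum a * fst z)) (F a (z # b))) zs"
  by simp

lemma usym_commute: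
  fixes sc :: "'k::field \<Rightarrow> 'w \<Rightarrow> 'w::ab_group_add"
  assumes "vector_space sc"
  shows "usym sc F zs = usym sc (\<lambda>a b. sc (psign (degsum a * degsum b)) (F b a)) zs"
proof -
  have [simp]: "(\<Prod>x\<leftarrow>b. psign (d * fst x)) = (psign (d * degsum b) :: 'k)" for b :: "(int \<times> 'v) list" and d
    by (induction b) (simp_all add: psign_add algebra_simps)
  have 1: "(\<Prod>y\<leftarrow>a. \<Prod>x\<leftarrow>b. psign (fst x * fst y)) = (psign (degsum a * degsum b) :: 'k)"
    for a b :: "(int \<times> 'v) list"
    by (induction a) (simp_all add: psign_add algebra_simps)
  have 2: "psign (fst x * fst y) * psign (fst y * fst x) = (1 :: 'k)" for x y :: "int \<times> 'v"
    by (simp add: mult.commute)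
  show ?thesis
    by (subst unsh_commute[OF assms 2]) (unfold 1, rule refl)
qed

lemma length_first: "\<sigma> \<in> Sh p q \<Longrightarrow> length zs = p + q \<Longrightarrow> length (first p \<sigma> zs) = p"
  by (simp add: first_def)

lemma first_rest_map:
  assumes "\<sigma> permutes {..<length zs}"
  shows "first p \<sigma> (map f zs) = map f (first p \<sigma> zs)" "rest p \<sigma> (map f zs) = map f (rest p \<sigma> zs)"
  using assms by (simp_all add: first_def rest_def permute_list_map take_map drop_map)

lemma koszul_zip:
  assumes "\<sigma> permutes {..<length zs}"
  shows "\<epsilon> \<sigma> (map fst zs) = (\<Prod>(i, j)\<in>inversions (length zs) \<sigma>. psign (fst (zs ! \<sigma> i) * fst (zs ! \<sigma> j)))"
    and "\<chi> \<sigma> (map fst zs) = (\<Prod>(i, j)\<in>inversions (length zs) \<sigma>. - psign (fst (zs ! \<sigma> i) * fst (zs ! \<sigma> j)))"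
proof -
  have "\<sigma> i < length zs \<and> \<sigma> j < length zs" if "(i, j) \<in> inversions (length zs) \<sigma>" for i j
    using that permutes_in_image[OF assms] by (auto simp: inversions_def)
  then show "\<epsilon> \<sigma> (map fst zs) = (\<Prod>(i, j)\<in>inversions (length zs) \<sigma>. psign (fst (zs ! \<sigma> i) * fst (zs ! \<sigma> j)))"
    and "\<chi> \<sigma> (map fst zs) = (\<Prod>(i, j)\<in>inversions (length zs) \<sigma>. - psign (fst (zs ! \<sigma> i) * fst (zs ! \<sigma> j)))"
    unfolding koszul_sym_def koszul_skew_def
    by (auto intro!: prod.cong simp: powi_minus_one)
qed

text \<open>The summand receives \<open>p\<close> as a separate argument so that it may contain
  further signs depending on \<open>p\<close>; in the recursion \<open>p\<close> becomes the length
  of the left block.\<close>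

lemma sum_Sh_sym:
  assumes "vector_space sc"
  shows "(\<Sum>p=0..length zs. \<Sum>\<sigma>\<in>Sh p (length zs - p).
      sc (\<epsilon> \<sigma> (map fst zs)) (F p (first p \<sigma> (map snd zs)) (rest p \<sigma> (map snd zs))))
    = usym sc (\<lambda>a b. F (length a) (map snd a) (map snd b)) zs"
  unfolding sum_Sh_eq_unsh[OF assms, symmetric]
proof (intro sum.cong refl)
  fix p \<sigma> assume "p \<in> {0..length zs}" and \<sigma>: "\<sigma> \<in> Sh p (length zs - p)"
  then have "\<sigma> permutes {..<length zs}" "length (first p \<sigma> zs) = p"
    using length_first[OF \<sigma>] by (auto simp: Sh_def)
  then show "sc (\<epsilon> \<sigma> (map fst zs)) (F p (first p \<sigma> (map snd zs)) (rest p \<sigma> (map snd zs))) =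
    sc (\<Prod>(i, j)\<in>inversions (length zs) \<sigma>. psign (fst (zs ! \<sigma> i) * fst (zs ! \<sigma> j)))
      (F (length (first p \<sigma> zs)) (map snd (first p \<sigma> zs)) (map snd (rest p \<sigma> zs)))"
    by (simp add: koszul_zip first_rest_map)
qed

lemma sum_Sh_skew:
  assumes "vector_space sc"
  shows "(\<Sum>p=0..length zs. \<Sum>\<sigma>\<in>Sh p (length zs - p).
      sc (\<chi> \<sigma> (map fst zs)) (F p (first p \<sigma> (map snd zs)) (rest p \<sigma> (map snd zs))))
    = uskew sc (\<lambda>a b. F (length a) (map snd a) (map snd b)) zs"
  unfolding sum_Sh_eq_unsh[OF assms, symmetric]
proof (intro sum.cong refl)
  fix p \<sigma> assume "p \<in> {0..length zs}" and \<sigma>: "\<sigma> \<in> Sh p (length zs - p)"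
  then have "\<sigma> permutes {..<length zs}" "length (first p \<sigma> zs) = p"
    using length_first[OF \<sigma>] by (auto simp: Sh_def)
  then show "sc (\<chi> \<sigma> (map fst zs)) (F p (first p \<sigma> (map snd zs)) (rest p \<sigma> (map snd zs))) =
    sc (\<Prod>(i, j)\<in>inversions (length zs) \<sigma>. - psign (fst (zs ! \<sigma> i) * fst (zs ! \<sigma> j)))
      (F (length (first p \<sigma> zs)) (map snd (first p \<sigma> zs)) (map snd (rest p \<sigma> zs)))"
    by (simp add: koszul_zip first_rest_map)
qed

section \<open>Decalage\<close>

definition dec :: "(int \<times> 'v) list \<Rightarrow> int" where
  "dec zs = decalage (map fst zs)"

lemma dec_Nil [simp]: "dec [] = 0"
  by (simp add: dec_def decalage_def)

lemma dec_Cons [simp]: "dec (z # zs) = int (length zs) * fst z + dec zs"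
  unfolding dec_def decalage_def list.map list.size add_0_right add_Suc_right
  by (subst sum.lessThan_Suc_shift) simp

lemma dec_append: "dec (a @ b) = dec a + int (length b) * degsum a + dec b"
  by (induction a) (simp_all add: algebra_simps)

text \<open>The decalage isomorphism between the exterior algebra of \<open>\<gg>\<close> and the symmetric algebra of \<open>\<gg>[1]\<close>.\<close>

lemma uskew_eq_usym:
  assumes "vector_space sc"
  shows "uskew sc F zs = sc (psign (dec zs))
    (unsh sc (\<lambda>z w. psign ((fst z - 1) * (fst w - 1))) (\<lambda>a b. sc (psign (dec (a @ b))) (F a b)) zs)"
proof (induction zs arbitrary: F)
  case Nil
  interpret vector_space sc by fact
  show ?case by simp
next
  case (Cons z zs)
  interpret vector_space sc by fact
  have p1: "(\<Prod>y\<leftarrow>a. - psign (fst y * d)) = (psign (degsum a * d + int (length a)) :: 'a)"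
    for a :: "(int \<times> 'c) list" and d
    by (induction a) (simp_all add: psign_def)
  have p2: "(\<Prod>y\<leftarrow>a. psign ((fst y - 1) * d)) = (psign ((degsum a - int (length a)) * d) :: 'a)"
    for a :: "(int \<times> 'c) list" and d
    by (induction a) (simp_all add: psign_def)
  let ?U = "unsh sc (\<lambda>z w. psign ((fst z - 1) * (fst w - 1)))"
  have len: "length zs = length a + length b" if "mset a + mset b = mset zs" for a b
    by (metis that size_mset size_union)
  have A: "?U (\<lambda>a b. sc (psign (dec (a @ b))) (F (z # a) b)) zs
     = sc (psign (int (length zs) * fst z)) (?U (\<lambda>a b. sc (psign (dec (z # a @ b))) (F (z # a) b)) zs)"
    unfolding unsh_scale[OF assms]
    by (rule unsh_cong) (simp add: len psign_add algebra_simps)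
  have B: "?U (\<lambda>a b. sc (psign (dec (a @ b))) (sc (\<Prod>y\<leftarrow>a. - psign (fst y * fst z)) (F a (z # b)))) zs
     = sc (psign (int (length zs) * fst z)) (?U (\<lambda>a b. sc (\<Prod>y\<leftarrow>a. psign ((fst y - 1) * (fst z - 1)))
         (sc (psign (dec (a @ z # b))) (F a (z # b)))) zs)"
    unfolding unsh_scale[OF assms]
  proof (rule unsh_cong)
    \<comment> \<open>Let d be the degree sum of \<open>a\<close>, let m and n be the lengths of
      \<open>a\<close> and \<open>b\<close>, and let z also denote the degree of the new entry.
      Inserting this entry between the blocks adds d + nz to the decalage exponent, and (m+n)z +
      (d-m)(z-1) + d + nz = dz + m + 2nz, which has the parity of the skew exponent dz + m.\<close>
    fix a b assume "mset a + mset b = mset zs"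
    then show "sc (psign (dec (a @ b))) (sc (\<Prod>y\<leftarrow>a. - psign (fst y * fst z)) (F a (z # b))) =
       sc (psign (int (length zs) * fst z))
        (sc (\<Prod>y\<leftarrow>a. psign ((fst y - 1) * (fst z - 1))) (sc (psign (dec (a @ z # b))) (F a (z # b))))"
      by (simp add: len p1 p2 dec_append flip: psign_add)
         (auto intro!: arg_cong[of _ _ "\<lambda>c. sc c _"] psign_cong)
  qed
  show ?case
    unfolding unsh.simps append_Cons Cons.IH[of "\<lambda>a b. F (z # a) b"] A
      Cons.IH[of "\<lambda>a b. sc (\<Prod>y\<leftarrow>a. - psign (fst y * fst z)) (F a (z # b))"] B
    by (simp add: scale_right_distrib psign_add mult.commute)
qed

lemma unsh_map:
  "unsh sc s F (map g zs) = unsh sc (\<lambda>z w. s (g z) (g w)) (\<lambda>a b. F (map g a) (map g b)) zs"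
  by (induction zs arbitrary: F) (simp_all add: comp_def)

section \<open>Multilinear and graded symmetric functions of lists of homogeneous vectors\<close>

text \<open>Only the vector of a slot varies, over the whole space, while its degree label stays
  fixed. Hence signs computed from the labels count as constants, and no homogeneity condition
  interferes with linearity.\<close>

definition hmult where
  "hmult s s' f \<longleftrightarrow> (\<forall>us d vs. lin s s' (\<lambda>x. f (us @ (d :: int, x) # vs)))"

definition hsym where
  "hsym s' V f \<longleftrightarrow> (\<forall>us vs i j. \<forall>x\<in>V i. \<forall>y\<in>V j.
     f (us @ (i, x) # (j, y) # vs) = s' (psign (i * j)) (f (us @ (j, y) # (i, x) # vs)))"

lemma hmultD: "hmult s s' f \<Longrightarrow> lin s s' (\<lambda>x. f (us @ (d, x) # vs))"
  by (simp add: hmult_def)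

lemma hmult_Cons: "hmult s s' f \<Longrightarrow> hmult s s' (\<lambda>zs. f (z # zs))"
  using hmultD[of s s' f "z # _"] by (simp add: hmult_def)

lemma hmult_scale_deg:
  assumes "hmult s s' f" and "\<And>us d x y vs. c (us @ (d, x) # vs) = c (us @ (d, y) # vs)"
  shows "hmult s s' (\<lambda>zs. s' (c zs) (f zs))"
proof -
  have "lin s s' (\<lambda>x. s' (c (us @ (d, x) # vs)) (f (us @ (d, x) # vs)))" for us d vs
  proof -
    have "(\<lambda>x. s' (c (us @ (d, x) # vs)) (f (us @ (d, x) # vs)))
        = (\<lambda>x. s' (c (us @ (d, undefined) # vs)) (f (us @ (d, x) # vs)))"
      by (rule ext, rule arg_cong[of _ _ "\<lambda>c. s' c _"], rule assms(2))
    then show ?thesis using lin_compose_scale[OF hmultD[OF assms(1)]] by metis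
  qed
  then show ?thesis by (simp add: hmult_def)
qed

lemma hsymD: "hsym s' V f \<Longrightarrow> x \<in> V i \<Longrightarrow> y \<in> V j \<Longrightarrow>
    f (us @ (i, x) # (j, y) # vs) = s' (psign (i * j)) (f (us @ (j, y) # (i, x) # vs))"
  unfolding hsym_def by blast

lemma hsymI:
  assumes "\<And>us vs i j x y. x \<in> V i \<Longrightarrow> y \<in> V j \<Longrightarrow>
    f (us @ (i, x) # (j, y) # vs) = s' (psign (i * j)) (f (us @ (j, y) # (i, x) # vs))"
  shows "hsym s' V f"
  unfolding hsym_def using assms by blast

lemma hsym_Cons: "hsym s' V f \<Longrightarrow> hsym s' V (\<lambda>zs. f (z # zs))"
  by (rule hsymI, drule hsymD[of s' V f _ _ _ _ "z # _"], assumption+, simp)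

lemma hmult_usym:
  assumes "vector_space s" "vector_space sc"
    and "\<And>b. hmult s sc (\<lambda>a. F a b)" "\<And>a. hmult s sc (F a)"
  shows "hmult s sc (usym sc F)"
proof -
  have "lin s sc (\<lambda>x. usym sc F (us @ (d, x) # vs))" for us d vs
    using assms(3,4)
  proof (induction us arbitrary: F)
    case Nil
    have "lin s sc (\<lambda>x. F ((d, x) # a) b)" "lin s sc (\<lambda>x. F a ((d, x) # b))" for a b
      using hmultD[OF Nil(1), of "[]" d a b] hmultD[OF Nil(2), of a "[]" d b] by simp_all
    then show ?case
      by (auto intro!: lin_compose_add lin_unsh lin_compose_scale assms(1,2))
  next
    case (Cons u us)
    show ?case
      unfolding append_Cons usym_Cons
      by (intro lin_compose_add Cons.IH hmult_scale_deg lin_compose_scale)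
        (auto intro: hmult_Cons Cons.prems hmult_scale_deg)
  qed
  then show ?thesis by (simp add: hmult_def)
qed

text \<open>A transposition of neighbours acts on the splittings. If both entries lie in one block,
  the symmetry of \<open>F\<close> in that block gives the sign; if they lie in different blocks,
  two summands are exchanged, and the sign comes from one entry passing the other.\<close>

lemma hsym_usym:
  fixes sc :: "'k::field \<Rightarrow> 'w \<Rightarrow> 'w::ab_group_add"
  assumes "vector_space sc"
    and "\<And>b. hsym sc V (\<lambda>a. F a b)" "\<And>a. hsym sc V (F a)"
  shows "hsym sc V (usym sc F)"
proof -
  interpret vector_space sc by fact
  have "usym sc F (us @ (i, x) # (j, y) # vs) = sc (psign (i * j)) (usym sc F (us @ (j, y) # (i, x) # vs))"
    if xy: "x \<in> V i" "y \<in> V j" for us i x j y vs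
    using assms(2,3)
  proof (induction us arbitrary: F)
    case Nil
    have 1: "F ((i, x) # (j, y) # a) = (\<lambda>b. sc (psign (i * j)) (F ((j, y) # (i, x) # a) b))" for a
      using hsymD[OF Nil(1) xy, of "[]" a] by auto
    have 2: "F a ((i, x) # (j, y) # b) = sc (psign (i * j)) (F a ((j, y) # (i, x) # b))" for a b
      using hsymD[OF Nil(2) xy, of a "[]" b] by simp
    have 3: "psign ((i + d) * j) = (psign (i * j) * psign (d * j) :: 'k)" for d
      by (simp add: psign_add algebra_simps)
    have 4: "psign ((j + d) * i) = (psign (i * j) * psign (d * i) :: 'k)" for d
      by (simp add: psign_add algebra_simps)
    show ?case
      by (simp add: 1 2 3 4 unsh_add[OF assms(1)] unsh_scale[OF assms(1)] scale_right_distrib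
          mult.commute mult.left_commute add_ac)
  next
    case (Cons u us)
    have "hsym sc V (\<lambda>a. sc (psign (degsum a * fst u)) (F a (u # b)))" for b
    proof (rule hsymI)
      fix us vs i j x y assume "x \<in> V i" "y \<in> V j"
      then show "sc (psign (degsum (us @ (i, x) # (j, y) # vs) * fst u)) (F (us @ (i, x) # (j, y) # vs) (u # b))
        = sc (psign (i * j)) (sc (psign (degsum (us @ (j, y) # (i, x) # vs) * fst u))
            (F (us @ (j, y) # (i, x) # vs) (u # b)))"
        by (subst hsymD[OF Cons.prems(1)[of "u # b"]]) (simp_all add: add_ac mult.commute)
    qed
    moreover have "hsym sc V (\<lambda>b. sc (psign (degsum a * fst u)) (F a (u # b)))" for a
    proof (rule hsymI)
      fix us vs i j x y assume "x \<in> V i" "y \<in> V j"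
      then show "sc (psign (degsum a * fst u)) (F a (u # us @ (i, x) # (j, y) # vs))
        = sc (psign (i * j)) (sc (psign (degsum a * fst u)) (F a (u # us @ (j, y) # (i, x) # vs)))"
        by (subst hsymD[OF hsym_Cons[OF Cons.prems(2)[of a]]]) (simp_all add: mult.commute)
    qed
    ultimately show ?case
      unfolding append_Cons usym_Cons scale_right_distrib
      by (subst (1 2) Cons.IH) (auto intro: hsym_Cons Cons.prems)
  qed
  then show ?thesis by (rule hsymI)
qed

section \<open>Linear maps out of the symmetric algebra\<close>

lemma hmult_zero:
  assumes "hmult s s' f" and "(d, 0) \<in> set zs"
  shows "f zs = 0"
proof -
  obtain us vs where "zs = us @ (d, 0) # vs" using assms(2) by (meson split_list)
  then show ?thesis using lin_0[OF hmultD[OF assms(1)]] by simp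
qed

lemma multilinearI:
  assumes "\<And>us vs. lin s s' (\<lambda>x. m (us @ x # vs))"
  shows "multilinear s s' m"
  unfolding multilinear_def using lin_add[OF assms] lin_scale[OF assms] by blast

lemma multilinearD:
  assumes "multilinear s s' m" "vector_space s" "vector_space s'"
  shows "lin s s' (\<lambda>x. m (us @ x # vs))"
  using assms by (auto intro!: linI simp: multilinear_def)

lemma presents_eqI:
  assumes "presents s f R" "lin s s' \<phi>" "lin s s' \<phi>'" "\<And>b. \<phi> (f b) = \<phi>' (f b)"
  shows "\<phi> = \<phi>'"
proof
  fix x
  obtain t where "x = lin_ext s f t" using assms(1) by (metis presents_def surjD)
  then show "\<phi> x = \<phi>' x"
    unfolding lin_ext_def by (simp add: lin_sum[OF assms(2)] lin_sum[OF assms(3)]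
        lin_scale[OF assms(2)] lin_scale[OF assms(3)] assms(4))
qed

lemma lin_ext_single: 
  assumes "vector_space s" shows "lin_ext s f (Poly_Mapping.single b c) = s c (f b)"
proof -
  interpret vector_space s by fact
  show ?thesis by (simp add: lin_ext_def)
qed

lemma lin_ext_diff:
  "vector_space s \<Longrightarrow> lin_ext s f (t - u) = lin_ext s f t - lin_ext s f u"
  by (rule lin_diff[OF linear_lin_ext])

context symmetric_coalgebra
begin

lemma vsV: "vector_space scale" using graded by (simp add: graded_vector_space_def)
lemma vsS: "vector_space scaleS" using symmetric by (simp add: symmetric_algebra_def presents_def)
lemma vsT: "vector_space scaleT" using tensor by (simp add: tensor_product_def presents_def)

interpretation V: vector_space scale by (rule vsV)
interpretation S: vector_space scaleS by (rule vsS)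
interpretation T: vector_space scaleT by (rule vsT)

lemma subspace_V: "V.subspace (V i)" using graded by (simp add: graded_vector_space_def)

section \<open>Homogeneous components, and extension from homogeneous lists to all lists\<close>

definition hcomp :: "'v \<Rightarrow> int \<Rightarrow>\<^sub>0 'v" where
  "hcomp x = (THE f. (\<forall>i. Poly_Mapping.lookup f i \<in> V i) \<and>
                        x = (\<Sum>i\<in>Poly_Mapping.keys f. Poly_Mapping.lookup f i))"

definition pr :: "int \<Rightarrow> 'v \<Rightarrow> 'v" where
  "pr i x = Poly_Mapping.lookup (hcomp x) i"

definition degs :: "'v \<Rightarrow> int set" where
  "degs x = Poly_Mapping.keys (hcomp x)"

lemma hcomp_props:
  "(\<forall>i. Poly_Mapping.lookup (hcomp x) i \<in> V i) \<and>
      x = (\<Sum>i\<in>Poly_Mapping.keys (hcomp x). Poly_Mapping.lookup (hcomp x) i)"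
  unfolding hcomp_def by (rule theI') (use graded in \<open>simp add: graded_vector_space_def\<close>)

lemma pr_in [simp]: "pr i x \<in> V i"
  and sum_pr: "(\<Sum>i\<in>degs x. pr i x) = x"
  and finite_degs [simp]: "finite (degs x)"
  and pr_eq_0: "i \<notin> degs x \<Longrightarrow> pr i x = 0"
  using hcomp_props[of x] by (simp_all add: pr_def degs_def in_keys_iff)

lemma pr_unique:
  assumes "\<And>i. g i \<in> V i" "finite A" "\<And>i. i \<notin> A \<Longrightarrow> g i = 0" "x = (\<Sum>i\<in>A. g i)"
  shows "pr i x = g i"
proof -
  let ?f = "Poly_Mapping.Abs_poly_mapping g"
  have fin: "finite {i. g i \<noteq> 0}" using assms(2,3) by (metis (mono_tags) mem_Collect_eq rev_finite_subset subsetI)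
  then have l: "Poly_Mapping.lookup ?f = g" by simp
  have "x = (\<Sum>i\<in>Poly_Mapping.keys ?f. g i)"
    unfolding assms(4) by (rule sum.mono_neutral_right) (use assms(2,3) l in \<open>auto simp: in_keys_iff\<close>, metis)
  then have "hcomp x = ?f"
    unfolding hcomp_def
    by (intro the1_equality) (use graded assms(1) l in \<open>auto simp: graded_vector_space_def\<close>)
  then show ?thesis by (simp add: pr_def l)
qed

lemma lin_pr: "lin scale scale (pr i)"
proof (rule linI)
  fix x y c
  have "(\<Sum>i\<in>A. pr i z) = z" if "finite A" "degs z \<subseteq> A" for A z
    using that by (subst sum.mono_neutral_right[of A "degs z"]) (auto simp: sum_pr pr_eq_0)
  then have 1: "x + y = (\<Sum>i\<in>degs x \<union> degs y. pr i x + pr i y)"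
    by (simp add: sum.distrib)
  show "pr i (x + y) = pr i x + pr i y"
    by (rule pr_unique[of "\<lambda>i. pr i x + pr i y", OF _ _ _ 1])
      (auto simp: pr_eq_0 intro: V.subspace_add[OF subspace_V])
  have 2: "scale c x = (\<Sum>i\<in>degs x. scale c (pr i x))"
    by (simp add: sum_pr flip: V.scale_sum_right)
  show "pr i (scale c x) = scale c (pr i x)"
    by (rule pr_unique[of "\<lambda>i. scale c (pr i x)", OF _ _ _ 2])
      (auto simp: pr_eq_0 intro: V.subspace_scale[OF subspace_V])
qed (rule vsV)+

lemma pr_homogeneous: "x \<in> V d \<Longrightarrow> pr i x = (if i = d then x else 0)"
  by (rule pr_unique[of "\<lambda>i. if i = d then x else 0" "{d}"])
    (auto intro: V.subspace_0[OF subspace_V])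

text \<open>Lists of homogeneous vectors are paired with their degrees, since the zero vector has every degree.\<close>

definition hom :: "(int \<times> 'v) list \<Rightarrow> bool" where
  "hom zs \<longleftrightarrow> (\<forall>(d, x)\<in>set zs. x \<in> V d)"

lemma hom_simps [simp]:
  "hom []" "hom (z # zs) \<longleftrightarrow> snd z \<in> V (fst z) \<and> hom zs" "hom (xs @ ys) \<longleftrightarrow> hom xs \<and> hom ys"
  by (auto simp: hom_def)

lemma hom_mset: "mset a + mset b = mset zs \<Longrightarrow> hom zs \<longleftrightarrow> hom a \<and> hom b"
proof -
  assume "mset a + mset b = mset zs"
  then have "set zs = set a \<union> set b" by (metis set_mset_mset set_mset_union)
  then show ?thesis by (auto simp: hom_def)
qed

lemma homog_iff: "homog V ds xs \<longleftrightarrow> (\<exists>zs. hom zs \<and> ds = map fst zs \<and> xs = map snd zs)"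
proof
  assume "homog V ds xs"
  then show "\<exists>zs. hom zs \<and> ds = map fst zs \<and> xs = map snd zs"
    by (intro exI[of _ "zip ds xs"]) (auto simp: homog_def hom_def list_all2_iff)
next
  assume "\<exists>zs. hom zs \<and> ds = map fst zs \<and> xs = map snd zs"
  then show "homog V ds xs"
    by (auto simp: homog_def hom_def list_all2_conv_all_nth case_prod_unfold)
qed

lemma all_homog_iff: "(\<forall>ds xs. homog V ds xs \<longrightarrow> P ds xs) \<longleftrightarrow> (\<forall>zs. hom zs \<longrightarrow> P (map fst zs) (map snd zs))"
  by (auto simp: homog_iff)

text \<open>Every entry is a finite sum of homogeneous components. The entries are decomposed from
  left to right, so the induction carries a homogeneous prefix.\<close>

lemma homogeneous_induct:
  assumes hom: "\<And>zs. hom zs \<Longrightarrow> P (map snd zs)"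
    and add: "\<And>us x y vs. P (us @ x # vs) \<Longrightarrow> P (us @ y # vs) \<Longrightarrow> P (us @ (x + y) # vs)"
  shows "P xs"
proof -
  have "P (map snd zs @ xs)" if "hom zs" for zs
    using that
  proof (induction xs arbitrary: zs)
    case (Cons x xs)
    have P: "P (map snd zs @ y # xs)" if "y \<in> V i" for y i
      using Cons.IH[of "zs @ [(i, y)]"] Cons.prems that by simp
    have "P (map snd zs @ (\<Sum>i\<in>A. pr i x) # xs)" if "finite A" for A
      using that
    proof induction
      case empty
      show ?case using P[of 0 0] V.subspace_0[OF subspace_V] by simp
    next
      case (insert i A)
      then show ?case using P[OF pr_in] by (auto intro: add)
    qed
    then show ?case by (metis finite_degs sum_pr)
  qed (simp add: hom)
  then show ?thesis using hom_simps(1) by fastforce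
qed

text \<open>The multilinear expansion of \<open>f\<close> into homogeneous components: one summand
  for each choice of a degree for each entry. Restricting to degrees that occur in the entries keeps
  the sum finite.\<close>

definition hom_ext :: "((int \<times> 'v) list \<Rightarrow> 'w::comm_monoid_add) \<Rightarrow> 'v list \<Rightarrow> 'w" where
  "hom_ext f xs = (\<Sum>ds | set ds \<subseteq> \<Union> (degs ` set xs) \<and> length ds = length xs.
     f (map2 (\<lambda>d x. (d, pr d x)) ds xs))"

text \<open>A further degree sequence contributes a list with a zero entry, on which
  \<open>f\<close> vanishes. This allows the values at x, y, x + y and c x to be compared over one
  common index set.\<close>

lemma hom_ext_superset:
  assumes f: "hmult scale s' f" and K: "finite K" "\<Union> (degs ` set xs) \<subseteq> K"
  shows "hom_ext f xs = (\<Sum>ds | set ds \<subseteq> K \<and> length ds = length xs.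
     f (map2 (\<lambda>d x. (d, pr d x)) ds xs))"
  unfolding hom_ext_def
proof (rule sum.mono_neutral_left)
  show "finite {ds. set ds \<subseteq> K \<and> length ds = length xs}"
    using K by (simp add: finite_lists_length_eq)
  show "\<forall>ds\<in>{ds. set ds \<subseteq> K \<and> length ds = length xs}
       - {ds. set ds \<subseteq> \<Union> (degs ` set xs) \<and> length ds = length xs}.
       f (map2 (\<lambda>d x. (d, pr d x)) ds xs) = 0"
  proof
    fix ds assume "ds \<in> {ds. set ds \<subseteq> K \<and> length ds = length xs}
       - {ds. set ds \<subseteq> \<Union> (degs ` set xs) \<and> length ds = length xs}"
    then have "\<not> (\<forall>k<length xs. ds ! k \<in> degs (xs ! k))" and len: "length ds = length xs"
      by (auto simp: in_set_conv_nth subset_iff) (use nth_mem in blast)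
    then obtain k where k: "k < length xs" "length ds = length xs" "ds ! k \<notin> degs (xs ! k)"
      by blast
    then have "map2 (\<lambda>d x. (d, pr d x)) ds xs ! k = (ds ! k, 0)"
      by (simp add: pr_eq_0)
    then have "(ds ! k, 0) \<in> set (map2 (\<lambda>d x. (d, pr d x)) ds xs)"
      using k by (metis length_map length_zip min.idem nth_mem)
    then show "f (map2 (\<lambda>d x. (d, pr d x)) ds xs) = 0"
      by (rule hmult_zero[OF f])
  qed
qed (use K in auto)

lemma multilinear_hom_ext:
  assumes f: "hmult scale s' f" and s': "vector_space s'"
  shows "multilinear scale s' (hom_ext f)"
proof (rule multilinearI, rule linI[OF vsV s'])
  interpret s': vector_space s' by fact
  fix us vs x y c
  have fin: "finite (\<Union> (degs ` A))" if "finite A" for A using that by simp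
  have slot: "lin scale s' (\<lambda>x. f (map2 (\<lambda>d x. (d, pr d x)) ds (us @ x # vs)))"
    if len: "length ds = length (us @ x # vs)" for ds
  proof -
    define d1 d d2 where "d1 = take (length us) ds" "d = ds ! length us" "d2 = drop (Suc (length us)) ds"
    then have ds: "ds = d1 @ d # d2" "length d1 = length us"
      using len by (simp_all add: id_take_nth_drop)
    have "lin scale s' (\<lambda>x. f (map2 (\<lambda>d x. (d, pr d x)) d1 us @ (d, x) # map2 (\<lambda>d x. (d, pr d x)) d2 vs))"
      by (rule hmultD[OF f])
    from lin_compose[OF lin_pr[of d] this] show ?thesis using ds by simp
  qed
  let ?K = "\<Union> (degs ` (set us \<union> set vs \<union> {x, y, x + y, scale c x}))"
  let ?s = "\<lambda>x. \<Sum>ds | set ds \<subseteq> ?K \<and> length ds = length (us @ x # vs).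
     f (map2 (\<lambda>d x. (d, pr d x)) ds (us @ x # vs))"
  have e: "hom_ext f (us @ z # vs) = ?s z" if "z \<in> {x, y, x + y, scale c x}" for z
    by (rule hom_ext_superset[OF f]) (use that in auto)
  show "hom_ext f (us @ (x + y) # vs) = hom_ext f (us @ x # vs) + hom_ext f (us @ y # vs)"
    by (simp add: e flip: sum.distrib) (auto intro!: sum.cong lin_add[OF slot])
  show "hom_ext f (us @ scale c x # vs) = s' c (hom_ext f (us @ x # vs))"
    by (simp add: e s'.scale_sum_right) (auto intro!: sum.cong lin_scale[OF slot])
qed

lemma hom_ext_hom:
  assumes f: "hmult scale s' f" and zs: "hom zs"
  shows "hom_ext f (map snd zs) = f zs"
proof -
  \<comment> \<open>The labels \<open>map fst zs\<close> are added because a zero entry has a label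
    but no degree in \<open>degs\<close>.\<close>
  let ?K = "\<Union> (degs ` set (map snd zs)) \<union> set (map fst zs)"
  let ?m = "\<lambda>ds. map2 (\<lambda>d x. (d, pr d x)) ds (map snd zs)"
  let ?D = "{ds. set ds \<subseteq> ?K \<and> length ds = length (map snd zs)}"
  have nth: "?m ds ! k = (ds ! k, if ds ! k = fst (zs ! k) then snd (zs ! k) else 0)"
    if "k < length zs" "length ds = length zs" for ds k
  proof -
    have "snd (zs ! k) \<in> V (fst (zs ! k))" using zs that(1) by (auto simp: hom_def case_prod_unfold)
    then show ?thesis using that by (simp add: pr_homogeneous)
  qed
  have "hom_ext f (map snd zs) = (\<Sum>ds\<in>?D. f (?m ds))"
    by (rule hom_ext_superset[OF f]) auto
  also have "\<dots> = (\<Sum>ds\<in>{map fst zs}. f (?m ds))"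
  proof (rule sum.mono_neutral_right)
    show "finite ?D" by (rule finite_lists_length_eq) simp
    show "\<forall>ds\<in>?D - {map fst zs}. f (?m ds) = 0"
    proof
      fix ds assume "ds \<in> ?D - {map fst zs}"
      then have len: "length ds = length zs" and "ds \<noteq> map fst zs" by auto
      then obtain k where k: "k < length zs" "ds ! k \<noteq> fst (zs ! k)"
        using nth_equalityI[of ds "map fst zs"] by auto
      then have "?m ds ! k = (ds ! k, 0)" using nth[OF k(1) len] by (simp only: if_False)
      moreover have "k < length (?m ds)" using k len by simp
      ultimately have "(ds ! k, 0) \<in> set (?m ds)"
        using nth_mem[of k "?m ds"] by argo
      then show "f (?m ds) = 0" by (rule hmult_zero[OF f])
    qed
  qed auto
  also have "\<dots> = f (?m (map fst zs))" by simp
  also have "?m (map fst zs) = zs"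
  proof (rule nth_equalityI)
    fix k assume "k < length (?m (map fst zs))"
    then have k: "k < length zs" by simp
    show "?m (map fst zs) ! k = zs ! k"
      unfolding nth[OF k length_map] using k by simp
  qed simp
  finally show ?thesis .
qed

lemma multilinear_eqI:
  assumes "multilinear scale s' m" "multilinear scale s' m'"
    and "\<And>zs. hom zs \<Longrightarrow> m (map snd zs) = m' (map snd zs)"
  shows "m = m'"
proof
  show "m xs = m' xs" for xs
    by (rule homogeneous_induct[of "\<lambda>xs. m xs = m' xs"]) (use assms in \<open>auto simp: multilinear_def\<close>)
qed

text \<open>The relations of the symmetric algebra put arbitrary vectors around the two homogeneous
  neighbours, whereas Koszul formulas are available only in homogeneous surroundings. Additivity in
  the other slots bridges the gap.\<close>

lemma multilinear_symmetricI:
  assumes m: "multilinear scale s' m" and xy: "x \<in> V i" "y \<in> V j" and s': "vector_space s'"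
    and sym: "\<And>us vs. hom us \<Longrightarrow> hom vs \<Longrightarrow>
      m (map snd us @ x # y # map snd vs) = s' c (m (map snd us @ y # x # map snd vs))"
  shows "m (xs @ x # y # ys) = s' c (m (xs @ y # x # ys))"
proof -
  interpret s': vector_space s' by fact
  have madd: "m (p @ (a + b) # q) = m (p @ a # q) + m (p @ b # q)" for p a b q
    using m by (simp add: multilinear_def)
  have madd2: "m (p @ x' # y' # p' @ (a + b) # q) = m (p @ x' # y' # p' @ a # q) + m (p @ x' # y' # p' @ b # q)"
    for p x' y' p' a b q
    using madd[of "p @ x' # y' # p'" a b q] by simp
  have 1: "m (map snd us @ x # y # ys) = s' c (m (map snd us @ y # x # ys))" if "hom us" for us ys
    by (rule homogeneous_induct[of "\<lambda>ys. m (map snd us @ x # y # ys) = s' c (m (map snd us @ y # x # ys))"])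
      (use that in \<open>auto simp: sym madd2 s'.scale_right_distrib\<close>)
  show ?thesis
    by (rule homogeneous_induct[of "\<lambda>xs. m (xs @ x # y # ys) = s' c (m (xs @ y # x # ys))"])
      (auto simp: 1 madd s'.scale_right_distrib)
qed

section \<open>The universal property of the symmetric algebra on homogeneous lists\<close>

lemma lin_odot: "lin scale scaleS (\<lambda>x. odot (us @ x # vs))"
  and odot_swap: "x \<in> V i \<Longrightarrow> y \<in> V j \<Longrightarrow>
    odot (us @ x # y # vs) = scaleS (psign (i * j)) (odot (us @ y # x # vs))"
proof -
  have rel: "lin_ext scaleS odot r = 0" if "r \<in> symmetric_relations scale V" for r
    using symmetric that module.span_base[of free_scale] vector_space_free_scale
    unfolding symmetric_algebra_def presents_def module_iff_vector_space by blast
  note simps = lin_ext_diff[OF vsS] lin_ext_single[OF vsS]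
  have a: "odot (us @ (x + y) # vs) = odot (us @ x # vs) + odot (us @ y # vs)" for x y
  proof -
    have "Poly_Mapping.single (us @ (x + y) # vs) 1 - Poly_Mapping.single (us @ x # vs) 1
        - Poly_Mapping.single (us @ y # vs) 1 \<in> symmetric_relations scale V"
      unfolding symmetric_relations_def by blast
    from rel[OF this] have "odot (us @ (x + y) # vs) - odot (us @ x # vs) - odot (us @ y # vs) = 0"
      by (simp only: simps S.scale_one)
    then show ?thesis by (simp add: algebra_simps)
  qed
  have b: "odot (us @ scale c x # vs) = scaleS c (odot (us @ x # vs))" for c x
  proof -
    have "Poly_Mapping.single (us @ scale c x # vs) 1 - Poly_Mapping.single (us @ x # vs) c
        \<in> symmetric_relations scale V"
      unfolding symmetric_relations_def by blast
    from rel[OF this] show ?thesis by (simp add: simps)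
  qed
  show "lin scale scaleS (\<lambda>x. odot (us @ x # vs))"
    by (rule linI[OF vsV vsS]) (rule a b)+
  show "odot (us @ x # y # vs) = scaleS (psign (i * j)) (odot (us @ y # x # vs))"
    if "x \<in> V i" "y \<in> V j"
  proof -
    have "Poly_Mapping.single (us @ x # y # vs) 1
       - Poly_Mapping.single (us @ y # x # vs) ((-1) powi (i * j)) \<in> symmetric_relations scale V"
      unfolding symmetric_relations_def using that by blast
    from rel[OF this] show ?thesis by (simp add: simps powi_minus_one)
  qed
qed

lemma linear_from_S:
  assumes s': "vector_space s'" and m: "multilinear scale s' m"
    and sym: "\<And>us vs i j x y. x \<in> V i \<Longrightarrow> y \<in> V j \<Longrightarrow>
      m (us @ x # y # vs) = s' (psign (i * j)) (m (us @ y # x # vs))"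
  shows "\<exists>!\<phi>. lin scaleS s' \<phi> \<and> (\<forall>xs. \<phi> (odot xs) = m xs)"
proof (rule presents_universal[OF symmetric[unfolded symmetric_algebra_def] s'])
  interpret s': vector_space s' by fact
  fix r assume "r \<in> symmetric_relations scale V"
  then show "lin_ext s' m r = 0"
    using m unfolding symmetric_relations_def multilinear_def
    by (auto simp: lin_ext_diff[OF s'] lin_ext_single[OF s'] powi_minus_one dest: sym)
qed

text \<open>The source of all maps whose formula involves Koszul signs: it suffices to give the
  formula on labelled homogeneous lists. Existence goes through \<open>hom_ext\<close>, and
  uniqueness holds because products of homogeneous vectors span.\<close>

theorem linear_from_S_hom:
  assumes s': "vector_space s'" and f: "hmult scale s' f" and sym: "hsym s' V f"
  shows "\<exists>!\<phi>. lin scaleS s' \<phi> \<and> (\<forall>zs. hom zs \<longrightarrow> \<phi> (odot (map snd zs)) = f zs)"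
proof -
  let ?m = "hom_ext f"
  have m: "multilinear scale s' ?m" by (rule multilinear_hom_ext[OF f s'])
  have "?m (us @ x # y # vs) = s' (psign (i * j)) (?m (us @ y # x # vs))"
    if "x \<in> V i" "y \<in> V j" for us vs i j x y
  proof (rule multilinear_symmetricI[OF m that s'])
    fix us vs assume "hom us" "hom vs"
    then show "?m (map snd us @ x # y # map snd vs) = s' (psign (i * j)) (?m (map snd us @ y # x # map snd vs))"
      using hom_ext_hom[OF f, of "us @ (i, x) # (j, y) # vs"]
        hom_ext_hom[OF f, of "us @ (j, y) # (i, x) # vs"] that hsymD[OF sym that, of us vs] by simp
  qed
  then obtain \<phi> where \<phi>: "lin scaleS s' \<phi>" "\<And>xs. \<phi> (odot xs) = ?m xs"
    using linear_from_S[OF s' m] by blast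
  have uniq: "\<phi>' = \<phi>" if "lin scaleS s' \<phi>'" "\<And>zs. hom zs \<Longrightarrow> \<phi>' (odot (map snd zs)) = f zs" for \<phi>'
  proof (rule presents_eqI[OF symmetric[unfolded symmetric_algebra_def] that(1) \<phi>(1)])
    have "multilinear scale s' (\<lambda>xs. \<phi>' (odot xs))"
      by (rule multilinearI) (rule lin_compose[OF lin_odot that(1)])
    then have "(\<lambda>xs. \<phi>' (odot xs)) = ?m"
      by (rule multilinear_eqI[OF _ m]) (simp add: that(2) hom_ext_hom[OF f])
    then show "\<phi>' (odot b) = \<phi> (odot b)" for b by (simp add: \<phi>(2) fun_eq_iff)
  qed
  show ?thesis
  proof (rule ex1I[of _ \<phi>])
    show "lin scaleS s' \<phi> \<and> (\<forall>zs. hom zs \<longrightarrow> \<phi> (odot (map snd zs)) = f zs)"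
      using \<phi> hom_ext_hom[OF f] by simp
  qed (use uniq in blast)
qed

lemma S_eqI:
  assumes "lin scaleS s' \<phi>" "lin scaleS s' \<phi>'" "\<And>zs. hom zs \<Longrightarrow> \<phi> (odot (map snd zs)) = \<phi>' (odot (map snd zs))"
  shows "\<phi> = \<phi>'"
proof (rule presents_eqI[OF symmetric[unfolded symmetric_algebra_def] assms(1,2)])
  have "multilinear scale s' (\<lambda>xs. \<psi> (odot xs))" if "lin scaleS s' \<psi>" for \<psi>
    by (rule multilinearI) (rule lin_compose[OF lin_odot that])
  then have "(\<lambda>xs. \<phi> (odot xs)) = (\<lambda>xs. \<phi>' (odot xs))"
    using assms by (intro multilinear_eqI) auto
  then show "\<phi> (odot b) = \<phi>' (odot b)" for b by (simp add: fun_eq_iff)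
qed

end

section \<open>The coalgebra structure\<close>

lemma hmult_compose: "hmult s s' f \<Longrightarrow> lin s' s'' g \<Longrightarrow> hmult s s'' (\<lambda>zs. g (f zs))"
  unfolding hmult_def by (metis lin_compose)

lemma hsym_compose: "hsym s' V f \<Longrightarrow> lin s' s'' g \<Longrightarrow> hsym s'' V (\<lambda>zs. g (f zs))"
  by (rule hsymI) (metis hsymD lin_scale)

lemma vector_space_field: "vector_space ((*) :: 'k::field \<Rightarrow> 'k \<Rightarrow> 'k)"
  by unfold_locales (simp_all add: algebra_simps)

context symmetric_coalgebra
begin

interpretation V: vector_space scale by (rule vsV)
interpretation S: vector_space scaleS by (rule vsS)
interpretation T: vector_space scaleT by (rule vsT)

abbreviation od :: "(int \<times> 'v) list \<Rightarrow> 's" where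
  "od zs \<equiv> odot (map snd zs)"

lemma lin_odot_Cons: "lin scale scaleS (\<lambda>x. odot (x # vs))"
  using lin_odot[of "[]"] by simp

lemma hmult_od: "hmult scale scaleS od"
  unfolding hmult_def by (simp add: lin_odot)

lemma hsym_od: "hsym scaleS V od"
  by (rule hsymI, unfold map_append list.map snd_conv) (rule odot_swap)

section \<open>Tensor products, comultiplication, and tensor products of maps\<close>

lemma tensor_universal:
  assumes s': "vector_space s'" and B: "\<And>b. lin scaleS s' (\<lambda>a. B a b)" "\<And>a. lin scaleS s' (B a)"
  shows "\<exists>!K. lin scaleT s' K \<and> (\<forall>a b. K (tens a b) = B a b)"
proof -
  interpret s': vector_space s' by fact
  have "\<exists>!K. lin scaleT s' K \<and> (\<forall>p. K (case p of (a, b) \<Rightarrow> tens a b) = (case p of (a, b) \<Rightarrow> B a b))"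
  proof (rule presents_universal[OF tensor[unfolded tensor_product_def] s'])
    fix r assume "r \<in> tensor_relations scaleS scaleS"
    then show "lin_ext s' (\<lambda>p. case p of (a, b) \<Rightarrow> B a b) r = 0"
      unfolding tensor_relations_def
      by (auto simp: lin_ext_diff[OF s'] lin_ext_single[OF s'] lin_add[OF B(1)] lin_add[OF B(2)]
          lin_scale[OF B(1)] lin_scale[OF B(2)])
  qed
  then show ?thesis by (simp add: split_paired_all)
qed

lemma lin_tens: "lin scaleS scaleT (\<lambda>a. tens a b)" "lin scaleS scaleT (tens a)"
proof -
  let ?R = "tensor_relations scaleS scaleS"
  have rel: "lin_ext scaleT (\<lambda>(a, b). tens a b) r = 0" if "r \<in> ?R" for r
    using tensor that module.span_base[of free_scale] vector_space_free_scale
    unfolding tensor_product_def presents_def module_iff_vector_space by blast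
  note simps = lin_ext_diff[OF vsT] lin_ext_single[OF vsT] prod.case T.scale_one
  have "Poly_Mapping.single (x + y, b) 1 - Poly_Mapping.single (x, b) 1 - Poly_Mapping.single (y, b) 1 \<in> ?R"
    for x y b unfolding tensor_relations_def by blast
  from rel[OF this] have 1: "tens (x + y) b = tens x b + tens y b" for x y b
    by (simp only: simps) (simp add: algebra_simps)
  have "Poly_Mapping.single (a, x + y) 1 - Poly_Mapping.single (a, x) 1 - Poly_Mapping.single (a, y) 1 \<in> ?R"
    for x y a unfolding tensor_relations_def by blast
  from rel[OF this] have 2: "tens a (x + y) = tens a x + tens a y" for x y a
    by (simp only: simps) (simp add: algebra_simps)
  have "Poly_Mapping.single (scaleS c x, b) 1 - Poly_Mapping.single (x, b) c \<in> ?R"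
    for x c b unfolding tensor_relations_def by blast
  from rel[OF this] have 3: "tens (scaleS c x) b = scaleT c (tens x b)" for x c b
    by (simp only: simps) simp
  have "Poly_Mapping.single (a, scaleS c x) 1 - Poly_Mapping.single (a, x) c \<in> ?R"
    for x c a unfolding tensor_relations_def by blast
  from rel[OF this] have 4: "tens a (scaleS c x) = scaleT c (tens a x)" for x c a
    by (simp only: simps) simp
  show "lin scaleS scaleT (\<lambda>a. tens a b)" by (rule linI[OF vsS vsT]) (rule 1 3)+
  show "lin scaleS scaleT (tens a)" by (rule linI[OF vsS vsT]) (rule 2 4)+
qed

lemma T_eqI:
  assumes "lin scaleT s' \<phi>" "lin scaleT s' \<phi>'"
    and "\<And>zs ws. hom zs \<Longrightarrow> hom ws \<Longrightarrow> \<phi> (tens (od zs) (od ws)) = \<phi>' (tens (od zs) (od ws))"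
  shows "\<phi> = \<phi>'"
proof (rule presents_eqI[OF tensor[unfolded tensor_product_def] assms(1,2)])
  have 1: "(\<lambda>b. \<phi> (tens (od zs) b)) = (\<lambda>b. \<phi>' (tens (od zs) b))" if "hom zs" for zs
    by (rule S_eqI[OF lin_compose[OF lin_tens(2) assms(1)] lin_compose[OF lin_tens(2) assms(2)]])
      (rule assms(3)[OF that])
  have "(\<lambda>a. \<phi> (tens a b)) = (\<lambda>a. \<phi>' (tens a b))" for b
    by (rule S_eqI[OF lin_compose[OF lin_tens(1) assms(1)] lin_compose[OF lin_tens(1) assms(2)]])
      (rule fun_cong[OF 1])
  then show "\<phi> (case p of (a, b) \<Rightarrow> tens a b) = \<phi>' (case p of (a, b) \<Rightarrow> tens a b)" for p
    by (cases p) (simp add: fun_eq_iff)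
qed

text \<open>This justifies the definite description of the comultiplication. The sum over splittings
  inherits multilinearity and graded symmetry from \<open>od\<close>, hence descends to
  S(V).\<close>

lemma comult: "lin scaleS scaleT comult"
  and comult_od: "hom zs \<Longrightarrow> comult (od zs) = usym scaleT (\<lambda>a b. tens (od a) (od b)) zs"
proof -
  let ?f = "usym scaleT (\<lambda>a b. tens (od a) (od b))"
  have hm: "hmult scale scaleT ?f"
    by (intro hmult_usym vsV vsT hmult_compose[OF hmult_od] lin_tens)
  have hs: "hsym scaleT V ?f"
    by (intro hsym_usym vsT hsym_compose[OF hsym_od] lin_tens)
  have eq: "(\<forall>ds xs. homog V ds xs \<longrightarrow>
        \<Delta> (odot xs) = (\<Sum>p=0..length xs. \<Sum>\<sigma>\<in>Sh p (length xs - p).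
          scaleT (\<epsilon> \<sigma> ds) (tens (odot (first p \<sigma> xs)) (odot (rest p \<sigma> xs)))))
      \<longleftrightarrow> (\<forall>zs. hom zs \<longrightarrow> \<Delta> (od zs) = ?f zs)" for \<Delta>
    unfolding all_homog_iff using sum_Sh_sym[OF vsT, of _ "\<lambda>p a b. tens (odot a) (odot b)"] by simp
  have "lin scaleS scaleT comult \<and> (\<forall>zs. hom zs \<longrightarrow> comult (od zs) = ?f zs)"
    unfolding comult_def eq by (rule theI'[OF linear_from_S_hom[OF vsT hm hs]])
  then show "lin scaleS scaleT comult"
    and "hom zs \<Longrightarrow> comult (od zs) = usym scaleT (\<lambda>a b. tens (od a) (od b)) zs" by blast+
qed

lemma od_in_S_deg: "hom zs \<Longrightarrow> od zs \<in> S_deg (degsum zs)"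
  unfolding S_deg_def by (rule S.span_base) (auto simp: homog_iff degsum_def)

lemma S_deg_induct:
  assumes "x \<in> S_deg i" "S.subspace P" "\<And>zs. hom zs \<Longrightarrow> degsum zs = i \<Longrightarrow> od zs \<in> P"
  shows "x \<in> P"
proof -
  have "S_deg i \<subseteq> P"
    unfolding S_deg_def by (rule S.span_minimal) (use assms(2,3) in \<open>auto simp: homog_iff degsum_def\<close>)
  then show ?thesis using assms(1) by blast
qed

lemma subspace_S_deg: "S.subspace (S_deg i)"
  unfolding S_deg_def by (rule S.subspace_span)

lemma subspace_vimage:
  assumes "lin s s' f" "module.subspace s' P"
  shows "module.subspace s {x. f x \<in> P}"
proof -
  interpret f: Vector_Spaces.linear s s' f by fact
  show ?thesis using f.subspace_vimage[OF assms(2)] by (simp add: vimage_def)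
qed

text \<open>Precomposing with \<tau> absorbs the sign of \<open>tensor_map\<close> into the first
  factor. The formula f(\<tau> a) \<otimes> g b is bilinear for all a, so the universal property of
  the tensor product applies although the sign is prescribed only for homogeneous a.\<close>

lemma sign_twist: "\<exists>\<tau>. lin scaleS scaleS \<tau> \<and> (\<forall>i. \<forall>x\<in>S_deg i. \<tau> x = scaleS (psign (e * i)) x)"
proof -
  let ?f = "\<lambda>zs. scaleS (psign (e * degsum zs)) (od zs)"
  have "hmult scale scaleS ?f" by (rule hmult_scale_deg[OF hmult_od]) simp
  moreover have "hsym scaleS V ?f"
  proof (rule hsymI)
    fix us vs i j x y assume "x \<in> V i" "y \<in> V j"
    then show "?f (us @ (i, x) # (j, y) # vs) = scaleS (psign (i * j)) (?f (us @ (j, y) # (i, x) # vs))"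
      by (subst hsymD[OF hsym_od]) (simp_all add: add_ac mult.commute)
  qed
  ultimately obtain \<tau> where \<tau>: "lin scaleS scaleS \<tau>" "\<And>zs. hom zs \<Longrightarrow> \<tau> (od zs) = ?f zs"
    using linear_from_S_hom[OF vsS] by blast
  have "x \<in> {x. \<tau> x - scaleS (psign (e * i)) x \<in> {0}}" if "x \<in> S_deg i" for x i
    by (rule S_deg_induct[OF that subspace_vimage[OF lin_compose_diff[OF \<tau>(1) lin_scale_self[OF vsS]]]])
      (auto simp: \<tau>(2) S.subspace_def)
  then show ?thesis using \<tau>(1) by auto
qed

lemma tensor_map_ex1:
  assumes f: "lin scaleS scaleS f" and g: "lin scaleS scaleS g"
  shows "\<exists>!F. lin scaleT scaleT F \<and>
     (\<forall>i b. \<forall>a\<in>S_deg i. F (tens a b) = scaleT ((-1) powi (e * i)) (tens (f a) (g b)))"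
proof -
  obtain \<tau> where \<tau>: "lin scaleS scaleS \<tau>" "\<And>i x. x \<in> S_deg i \<Longrightarrow> \<tau> x = scaleS (psign (e * i)) x"
    using sign_twist by blast
  have "lin scaleS scaleT (\<lambda>a. tens (f (\<tau> a)) (g b))" "lin scaleS scaleT (\<lambda>b. tens (f (\<tau> a)) (g b))" for a b
    by (intro lin_compose[OF lin_compose[OF \<tau>(1) f]] lin_compose[OF g] lin_tens)+
  then obtain F where F: "lin scaleT scaleT F" "\<And>a b. F (tens a b) = tens (f (\<tau> a)) (g b)"
    using tensor_universal[OF vsT, of "\<lambda>a b. tens (f (\<tau> a)) (g b)"] by blast
  have F': "F (tens a b) = scaleT (psign (e * i)) (tens (f a) (g b))" if "a \<in> S_deg i" for a b i
    by (simp add: F(2) \<tau>(2)[OF that] lin_scale[OF f] lin_scale[OF lin_tens(1)])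
  show ?thesis
  proof (rule ex1I[of _ F])
    show "lin scaleT scaleT F \<and> (\<forall>i b. \<forall>a\<in>S_deg i. F (tens a b) = scaleT ((-1) powi (e * i)) (tens (f a) (g b)))"
      using F(1) F' by (simp add: powi_minus_one)
    fix F2 assume F2: "lin scaleT scaleT F2 \<and> (\<forall>i b. \<forall>a\<in>S_deg i. F2 (tens a b) = scaleT ((-1) powi (e * i)) (tens (f a) (g b)))"
    show "F2 = F"
    proof (rule T_eqI)
      fix zs ws assume "hom zs"
      then have zs: "od zs \<in> S_deg (degsum zs)" by (rule od_in_S_deg)
      show "F2 (tens (od zs) (od ws)) = F (tens (od zs) (od ws))"
        unfolding F'[OF zs] using F2 zs by (simp add: powi_minus_one)
    qed (use F2 F(1) in blast)+
  qed
qed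

lemma lin_tensor_map: "lin scaleS scaleS f \<Longrightarrow> lin scaleS scaleS g \<Longrightarrow> lin scaleT scaleT (tensor_map e f g)"
  and tensor_map_tens: "lin scaleS scaleS f \<Longrightarrow> lin scaleS scaleS g \<Longrightarrow> a \<in> S_deg i \<Longrightarrow>
    tensor_map e f g (tens a b) = scaleT (psign (e * i)) (tens (f a) (g b))"
  using theI'[OF tensor_map_ex1, of f g e] unfolding tensor_map_def powi_minus_one by blast+

lemma proj: "lin scaleS scale proj"
  and proj_odot: "proj (odot xs) = (if length xs = 1 then hd xs else 0)"
proof -
  let ?m = "\<lambda>xs. if length xs = 1 then hd xs else (0 :: 'v)"
  have "lin scale scale (\<lambda>x. ?m (us @ x # vs))" for us vs
    by (cases us; cases vs) (simp_all add: lin_ident lin_zero vsV)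
  then have "multilinear scale scale ?m" by (rule multilinearI)
  then have "\<exists>!\<phi>. lin scaleS scale \<phi> \<and> (\<forall>xs. \<phi> (odot xs) = ?m xs)"
    by (rule linear_from_S[OF vsV]) simp
  then have "lin scaleS scale proj \<and> (\<forall>xs. proj (odot xs) = ?m xs)"
    unfolding proj_def by (rule theI')
  then show "lin scaleS scale proj" and "proj (odot xs) = (if length xs = 1 then hd xs else 0)"
    by simp_all
qed

section \<open>Coderivations\<close>

lemma lin_id: "lin scaleS scaleS id"
  unfolding id_def by (rule lin_ident[OF vsS])

text \<open>Both sides of the coderivation identity are linear, so products of homogeneous vectors
  suffice; on these the tensor products of maps become explicit signs.\<close>

lemma CoderI:
  assumes lin: "lin scaleS scaleS D"
    and deg: "\<And>zs. hom zs \<Longrightarrow> D (od zs) \<in> S_deg (degsum zs + d)"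
    and eq: "\<And>zs. hom zs \<Longrightarrow> comult (D (od zs)) = usym scaleT (\<lambda>a b.
      tens (D (od a)) (od b) + scaleT (psign (d * degsum a)) (tens (od a) (D (od b)))) zs"
  shows "D \<in> Coder d"
proof -
  have "D ` S_deg i \<subseteq> S_deg (i + d)" for i
  proof clarify
    fix x assume "x \<in> S_deg i"
    then have "x \<in> {x. D x \<in> S_deg (i + d)}"
      by (rule S_deg_induct[OF _ subspace_vimage[OF lin subspace_S_deg]]) (use deg in auto)
    then show "D x \<in> S_deg (i + d)" by simp
  qed
  moreover have "(\<lambda>x. comult (D x))
     = (\<lambda>x. tensor_map 0 D id (comult x) + tensor_map d id D (comult x))"
  proof (rule S_eqI)
    show "lin scaleS scaleT (\<lambda>x. comult (D x))" by (rule lin_compose[OF lin comult])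
    show "lin scaleS scaleT (\<lambda>x. tensor_map 0 D id (comult x) + tensor_map d id D (comult x))"
      by (intro lin_compose_add lin_compose[OF comult] lin_tensor_map lin lin_id)
    fix zs assume zs: "hom zs"
    show "comult (D (od zs)) = tensor_map 0 D id (comult (od zs)) + tensor_map d id D (comult (od zs))"
      unfolding comult_od[OF zs] eq[OF zs] unsh_linear[OF lin_tensor_map[OF lin lin_id]]
        unsh_linear[OF lin_tensor_map[OF lin_id lin]] unsh_add[OF vsT, symmetric]
    proof (rule unsh_cong)
      fix a b assume "mset a + mset b = mset zs"
      then have "od a \<in> S_deg (degsum a)" using zs hom_mset od_in_S_deg by blast
      then show "tens (D (od a)) (od b) + scaleT (psign (d * degsum a)) (tens (od a) (D (od b)))
        = tensor_map 0 D id (tens (od a) (od b)) + tensor_map d id D (tens (od a) (od b))"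
        by (simp add: tensor_map_tens[OF lin lin_id] tensor_map_tens[OF lin_id lin])
    qed
  qed
  ultimately show ?thesis using lin by (simp add: Coder_def fun_eq_iff)
qed

lemma Coder_lin: "D \<in> Coder d \<Longrightarrow> lin scaleS scaleS D"
  and Coder_deg: "D \<in> Coder d \<Longrightarrow> x \<in> S_deg i \<Longrightarrow> D x \<in> S_deg (i + d)"
  and Coder_comult: "D \<in> Coder d \<Longrightarrow>
    comult (D x) = tensor_map 0 D id (comult x) + tensor_map d id D (comult x)"
  by (auto simp: Coder_def)

lemma Coder_comult_od:
  assumes D: "D \<in> Coder d" and zs: "hom zs"
  shows "comult (D (od zs)) = usym scaleT (\<lambda>a b.
      tens (D (od a)) (od b) + scaleT (psign (d * degsum a)) (tens (od a) (D (od b)))) zs"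
proof -
  note lin = Coder_lin[OF D]
  show ?thesis
    unfolding Coder_comult[OF D] comult_od[OF zs] unsh_linear[OF lin_tensor_map[OF lin lin_id]]
      unsh_linear[OF lin_tensor_map[OF lin_id lin]] unsh_add[OF vsT, symmetric]
  proof (rule unsh_cong)
    fix a b assume "mset a + mset b = mset zs"
    then have "od a \<in> S_deg (degsum a)" using zs hom_mset od_in_S_deg by blast
    then show "tensor_map 0 D id (tens (od a) (od b)) + tensor_map d id D (tens (od a) (od b))
      = tens (D (od a)) (od b) + scaleT (psign (d * degsum a)) (tens (od a) (D (od b)))"
      by (simp add: tensor_map_tens[OF lin lin_id] tensor_map_tens[OF lin_id lin])
  qed
qed

lemma multilinear_component:
  assumes "lin scaleS scaleS D"
  shows "multilinear scale scale (component D)"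
  unfolding component_def
  by (rule multilinearI) (rule lin_compose[OF lin_compose[OF lin_odot assms] proj])

lemma component_swap:
  assumes "lin scaleS scaleS D" "x \<in> V i" "y \<in> V j"
  shows "component D (us @ x # y # vs) = scale (psign (i * j)) (component D (us @ y # x # vs))"
  unfolding component_def
  by (subst odot_swap[OF assms(2,3)]) (simp add: lin_scale[OF assms(1)] lin_scale[OF proj])

lemma component_deg:
  assumes D: "D \<in> Coder d" and zs: "hom zs"
  shows "component D (map snd zs) \<in> V (degsum zs + d)"
proof -
  have *: "proj x \<in> V i" if "x \<in> S_deg i" for x i
  proof -
    have "od zs \<in> {x. proj x \<in> V i}" if "hom zs" "degsum zs = i" for zs
      using that V.subspace_0[OF subspace_V] by (cases zs) (auto simp: proj_odot)
    from S_deg_induct[OF \<open>x \<in> S_deg i\<close> subspace_vimage[OF proj subspace_V] this] show ?thesis by simp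
  qed
  show ?thesis
    unfolding component_def by (rule *[OF Coder_deg[OF D od_in_S_deg[OF zs]]])
qed

text \<open>The coderivation applies \<theta> to the left block of every splitting and multiplies
  the result by the right block. The projection to V keeps only the summand with empty right block,
  which is \<theta> itself.\<close>

lemma coderivation_exists:
  assumes hm: "hmult scale scale \<theta>" and hs: "hsym scale V \<theta>"
    and deg: "\<And>zs. hom zs \<Longrightarrow> \<theta> zs \<in> V (degsum zs + d)"
  shows "\<exists>D\<in>Coder d. \<forall>zs. hom zs \<longrightarrow> component D (map snd zs) = \<theta> zs \<and>
    D (od zs) = usym scaleS (\<lambda>a b. odot (\<theta> a # map snd b)) zs"
proof -
  let ?f = "usym scaleS (\<lambda>a b. odot (\<theta> a # map snd b))"
  have "hmult scale scaleS ?f"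
  proof (rule hmult_usym[OF vsV vsS])
    show "hmult scale scaleS (\<lambda>a. odot (\<theta> a # map snd b))" for b
      by (rule hmult_compose[OF hm lin_odot_Cons])
    show "hmult scale scaleS (\<lambda>b. odot (\<theta> a # map snd b))" for a
      \<comment> \<open>The label 0 is arbitrary, since \<open>od\<close> looks only at the
        vectors.\<close>
      using hmult_Cons[OF hmult_od, of "(0, \<theta> a)"] by simp
  qed
  moreover have "hsym scaleS V ?f"
  proof (rule hsym_usym[OF vsS])
    show "hsym scaleS V (\<lambda>a. odot (\<theta> a # map snd b))" for b
      by (rule hsym_compose[OF hs lin_odot_Cons])
    show "hsym scaleS V (\<lambda>b. odot (\<theta> a # map snd b))" for a
      using hsym_Cons[OF hsym_od, of "(0, \<theta> a)"] by simp
  qed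
  ultimately obtain D where D: "lin scaleS scaleS D" "\<And>zs. hom zs \<Longrightarrow> D (od zs) = ?f zs"
    using linear_from_S_hom[OF vsS] by blast
  have comp: "component D (map snd zs) = \<theta> zs" if "hom zs" for zs
  proof -
    have "component D (map snd zs) = usym scale (\<lambda>a b. proj (odot (\<theta> a # map snd b))) zs"
      unfolding component_def D(2)[OF that] by (rule unsh_linear[OF proj])
    also have "\<dots> = \<theta> zs"
      by (subst unsh_right_Nil[OF vsV]) (auto simp: proj_odot)
    finally show ?thesis .
  qed
  have "D \<in> Coder d"
  proof (rule CoderI[OF D(1)])
    fix zs assume zs: "hom zs"
    have unsh_in: "unsh scaleS s F ws \<in> P"
      if "S.subspace P" "\<And>a b. mset a + mset b = mset ws \<Longrightarrow> F a b \<in> P" for P s F and ws :: "(int \<times> 'v) list"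
      using that(2)
    proof (induction ws arbitrary: F)
      case (Cons w ws)
      show ?case unfolding unsh.simps
        by (intro S.subspace_add[OF that(1)] Cons.IH S.subspace_scale[OF that(1)] Cons.prems) auto
    qed simp
    show "D (od zs) \<in> S_deg (degsum zs + d)"
      unfolding D(2)[OF zs]
    proof (rule unsh_in[OF subspace_S_deg])
      fix a b assume ab: "mset a + mset b = mset zs"
      then have "hom ((degsum a + d, \<theta> a) # b)" using zs hom_mset deg by auto
      from od_in_S_deg[OF this] show "odot (\<theta> a # map snd b) \<in> S_deg (degsum zs + d)"
        using degsum_mset[OF ab] by (simp add: add_ac)
    qed
    \<comment> \<open>When \<open>\<theta> a\<close> times a list is split,
      \<open>\<theta> a\<close> goes to the left factor in \<open>?L\<close>. In \<open>?R\<close>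
      it goes to the right factor and has to pass \<open>b\<close>, which costs the sign of its
      degree \<open>degsum a + d\<close> against that of \<open>b\<close>.\<close>
    let ?L = "\<lambda>a b c. tens (odot (\<theta> a # map snd b)) (od c)"
    let ?R = "\<lambda>a b c. scaleT (psign (degsum b * (degsum a + d))) (tens (od b) (odot (\<theta> a # map snd c)))"
    have "comult (D (od zs)) = usym scaleT (\<lambda>a b. comult (odot (\<theta> a # map snd b))) zs"
      unfolding D(2)[OF zs] by (rule unsh_linear[OF comult])
    also have "\<dots> = usym scaleT (\<lambda>a c. usym scaleT (?L a) c + usym scaleT (?R a) c) zs"
    proof (rule unsh_cong)
      fix a b assume "mset a + mset b = mset zs"
      then have "hom ((degsum a + d, \<theta> a) # b)" using zs hom_mset deg by auto
      from comult_od[OF this] show "comult (odot (\<theta> a # map snd b)) = usym scaleT (?L a) b + usym scaleT (?R a) b"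
        by simp
    qed
    also have "\<dots> = usym scaleT (\<lambda>a c. usym scaleT (?L a) c) zs + usym scaleT (\<lambda>a c. usym scaleT (?R a) c) zs"
      by (rule unsh_add[OF vsT])
    also have "usym scaleT (\<lambda>a c. usym scaleT (?L a) c) zs = usym scaleT (\<lambda>a b. tens (D (od a)) (od b)) zs"
      unfolding unsh_assoc[OF vsT]
    proof (rule unsh_cong)
      fix a b assume "mset a + mset b = mset zs"
      then have "hom a" using zs hom_mset by blast
      show "usym scaleT (\<lambda>c c'. ?L c c' b) a = tens (D (od a)) (od b)"
        unfolding D(2)[OF \<open>hom a\<close>] by (rule unsh_linear[OF lin_tens(1), symmetric])
    qed
    also have "usym scaleT (\<lambda>a c. usym scaleT (?R a) c) zs
      = usym scaleT (\<lambda>b a. scaleT (psign (d * degsum b)) (tens (od b) (D (od a)))) zs"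
    proof -
      have "usym scaleT (\<lambda>a c. usym scaleT (?R a) c) zs
        = usym scaleT (\<lambda>a' c. usym scaleT (\<lambda>a b. ?R a b c) a') zs"
        by (rule unsh_assoc[OF vsT])
      also have "\<dots> = usym scaleT (\<lambda>a' c. usym scaleT
          (\<lambda>b a. scaleT (psign (d * degsum b)) (tens (od b) (odot (\<theta> a # map snd c)))) a') zs"
      proof -
        \<comment> \<open>Here m and n are the degree sums of \<open>b\<close> and \<open>a\<close>.
          Exchanging these blocks contributes mn, which cancels the same term in the sign of
          \<open>?R\<close> and leaves the sign dm of the coderivation rule.\<close>
        have "psign (m * n) * psign (m * (n + d)) = (psign (d * m) :: 'k)" for m n
          by (simp flip: psign_add) (rule psign_cong, simp add: algebra_simps)
        then show ?thesis by (subst usym_commute[OF vsT]) simp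
      qed
      also have "\<dots> = usym scaleT (\<lambda>b c'. usym scaleT
          (\<lambda>a c. scaleT (psign (d * degsum b)) (tens (od b) (odot (\<theta> a # map snd c)))) c') zs"
        by (rule unsh_assoc[OF vsT, symmetric])
      also have "\<dots> = usym scaleT (\<lambda>b a. scaleT (psign (d * degsum b)) (tens (od b) (D (od a)))) zs"
      proof (rule unsh_cong)
        fix b c assume "mset b + mset c = mset zs"
        then have "hom c" using zs hom_mset by blast
        show "usym scaleT (\<lambda>a c. scaleT (psign (d * degsum b)) (tens (od b) (odot (\<theta> a # map snd c)))) c
          = scaleT (psign (d * degsum b)) (tens (od b) (D (od c)))"
          unfolding D(2)[OF \<open>hom c\<close>]
          by (rule unsh_linear[OF lin_compose_scale[OF lin_tens(2)], symmetric])
      qed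
      finally show ?thesis .
    qed
    finally show "comult (D (od zs)) = usym scaleT (\<lambda>a b.
      tens (D (od a)) (od b) + scaleT (psign (d * degsum a)) (tens (od a) (D (od b)))) zs"
      unfolding unsh_add[OF vsT] .
  qed
  then show ?thesis using D(2) comp by blast
qed

end

context symmetric_coalgebra
begin

interpretation V: vector_space scale by (rule vsV)
interpretation S: vector_space scaleS by (rule vsS)
interpretation T: vector_space scaleT by (rule vsT)

section \<open>Closure of coderivations under linear combinations and commutators\<close>

lemma Coder_zero: "(\<lambda>x. 0) \<in> Coder d"
  by (rule CoderI) (simp_all add: lin_zero vsS lin_0[OF comult] lin_0[OF lin_tens(1)] lin_0[OF lin_tens(2)]
      unsh_zero[OF vsT] S.subspace_0[OF subspace_S_deg])

lemma Coder_add_scale: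
  assumes D: "D \<in> Coder d" and E: "E \<in> Coder d"
  shows "(\<lambda>x. scaleS c (D x) + E x) \<in> Coder d"
proof (rule CoderI)
  note lD = Coder_lin[OF D] and lE = Coder_lin[OF E]
  show "lin scaleS scaleS (\<lambda>x. scaleS c (D x) + E x)"
    by (intro lin_compose_add lin_compose_scale lD lE)
  fix zs assume zs: "hom zs"
  show "scaleS c (D (od zs)) + E (od zs) \<in> S_deg (degsum zs + d)"
    by (intro S.subspace_add S.subspace_scale subspace_S_deg Coder_deg[OF D] Coder_deg[OF E] od_in_S_deg zs)
  show "comult (scaleS c (D (od zs)) + E (od zs)) = usym scaleT (\<lambda>a b.
      tens (scaleS c (D (od a)) + E (od a)) (od b) +
      scaleT (psign (d * degsum a)) (tens (od a) (scaleS c (D (od b)) + E (od b)))) zs"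
    unfolding lin_add[OF comult] lin_scale[OF comult] Coder_comult_od[OF D zs] Coder_comult_od[OF E zs]
      unsh_scale[OF vsT] unsh_add[OF vsT, symmetric]
    by (rule unsh_cong)
      (simp add: lin_add[OF lin_tens(1)] lin_add[OF lin_tens(2)] lin_scale[OF lin_tens(1)]
        lin_scale[OF lin_tens(2)] T.scale_right_distrib mult.commute)
qed

lemma Coder_diff: "D \<in> Coder d \<Longrightarrow> E \<in> Coder d \<Longrightarrow> (\<lambda>x. D x - E x) \<in> Coder d"
  using Coder_add_scale[of E d D "-1"] by simp

text \<open>Applying the coderivation rule twice gives four terms for each composite. The mixed
  terms, with one map on each tensor factor, cancel in the graded commutator: \<open>D2\<close>
  against \<open>E3\<close> and \<open>D3\<close> against \<open>E2\<close>.\<close>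

lemma commutator_Coder:
  assumes D: "D \<in> Coder d" and E: "E \<in> Coder e"
  shows "commutator d e D E \<in> Coder (d + e)"
proof -
  note lD = Coder_lin[OF D] and lE = Coder_lin[OF E]
  let ?t = tensor_map
  have 1: "comult (D (E x)) = ?t 0 D id (?t 0 E id y) + ?t 0 D id (?t e id E y)
      + (?t d id D (?t 0 E id y) + ?t d id D (?t e id E y))"
    if "y = comult x" for x y
    by (simp add: Coder_comult[OF D] Coder_comult[OF E] that
        lin_add[OF lin_tensor_map[OF lD lin_id]] lin_add[OF lin_tensor_map[OF lin_id lD]])
  have 2: "comult (E (D x)) = ?t 0 E id (?t 0 D id y) + ?t 0 E id (?t d id D y)
      + (?t e id E (?t 0 D id y) + ?t e id E (?t d id D y))"
    if "y = comult x" for x y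
    by (simp add: Coder_comult[OF D] Coder_comult[OF E] that
        lin_add[OF lin_tensor_map[OF lE lin_id]] lin_add[OF lin_tensor_map[OF lin_id lE]])
  let ?s = "psign (d * e) :: 'k"
  have C: "commutator d e D E x = D (E x) - scaleS ?s (E (D x))" for x
    by (simp add: commutator_def powi_minus_one)
  show ?thesis
  proof (rule CoderI)
    have lDE: "lin scaleS scaleS (\<lambda>x. D (E x))" and lED: "lin scaleS scaleS (\<lambda>x. E (D x))"
      by (rule lin_compose[OF lE lD] lin_compose[OF lD lE])+
    show "lin scaleS scaleS (commutator d e D E)"
      unfolding commutator_def by (intro lin_compose_diff lin_compose_scale lDE lED)
    fix zs assume zs: "hom zs"
    have "D (E (od zs)) \<in> S_deg (degsum zs + (d + e))"
      using Coder_deg[OF D Coder_deg[OF E od_in_S_deg[OF zs]]] by (simp add: add_ac)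
    moreover have "E (D (od zs)) \<in> S_deg (degsum zs + (d + e))"
      using Coder_deg[OF E Coder_deg[OF D od_in_S_deg[OF zs]]] by (simp add: add_ac)
    ultimately show "commutator d e D E (od zs) \<in> S_deg (degsum zs + (d + e))"
      unfolding C by (intro S.subspace_diff S.subspace_scale subspace_S_deg)
    note lt = lin_tensor_map[OF lD lin_id] lin_tensor_map[OF lin_id lD]
      lin_tensor_map[OF lE lin_id] lin_tensor_map[OF lin_id lE]
    note un = lt[THEN unsh_linear]
    show "comult (commutator d e D E (od zs)) = usym scaleT (\<lambda>a b.
      tens (commutator d e D E (od a)) (od b) +
      scaleT (psign ((d + e) * degsum a)) (tens (od a) (commutator d e D E (od b)))) zs"
      unfolding C lin_diff[OF comult] lin_scale[OF comult] 1[OF refl] 2[OF refl]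
      unfolding comult_od[OF zs] un unsh_add[OF vsT, symmetric] unsh_scale[OF vsT] unsh_diff[OF vsT, symmetric]
    proof (rule unsh_cong)
      fix a b assume "mset a + mset b = mset zs"
      then have "hom a" using zs hom_mset by blast
      then have a: "od a \<in> S_deg (degsum a)" by (rule od_in_S_deg)
      note Da = Coder_deg[OF D a] and Ea = Coder_deg[OF E a]
      note tm = tensor_map_tens[OF lD lin_id] tensor_map_tens[OF lin_id lD]
        tensor_map_tens[OF lE lin_id] tensor_map_tens[OF lin_id lE]
      note tml = lt[THEN lin_scale]
      let ?p = "psign (d * degsum a) :: 'k" and ?q = "psign (e * degsum a) :: 'k"
      have D1: "?t 0 D id (?t 0 E id (tens (od a) (od b))) = tens (D (E (od a))) (od b)"
        by (simp add: tm[OF a] tm[OF Ea])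
      have D2: "?t 0 D id (?t e id E (tens (od a) (od b))) = scaleT ?q (tens (D (od a)) (E (od b)))"
        by (simp add: tm[OF a] tml)
      have D3: "?t d id D (?t 0 E id (tens (od a) (od b))) = scaleT (?s * ?p) (tens (E (od a)) (D (od b)))"
        by (simp add: tm[OF a] tm[OF Ea] tml psign_add distrib_left mult.commute)
      have D4: "?t d id D (?t e id E (tens (od a) (od b))) = scaleT (?q * ?p) (tens (od a) (D (E (od b))))"
        by (simp add: tm[OF a] tml)
      have E1: "?t 0 E id (?t 0 D id (tens (od a) (od b))) = tens (E (D (od a))) (od b)"
        by (simp add: tm[OF a] tm[OF Da])
      have E2: "?t 0 E id (?t d id D (tens (od a) (od b))) = scaleT ?p (tens (E (od a)) (D (od b)))"
        by (simp add: tm[OF a] tml)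
      have E3: "?t e id E (?t 0 D id (tens (od a) (od b))) = scaleT (?s * ?q) (tens (D (od a)) (E (od b)))"
        by (simp add: tm[OF a] tm[OF Da] tml psign_add distrib_left mult.commute)
      have E4: "?t e id E (?t d id D (tens (od a) (od b))) = scaleT (?q * ?p) (tens (od a) (E (D (od b))))"
        by (simp add: tm[OF a] tml mult.commute)
      have pq: "psign ((d + e) * degsum a) = ?q * ?p"
        unfolding distrib_right psign_add by (rule mult.commute)
      show "?t 0 D id (?t 0 E id (tens (od a) (od b))) + ?t 0 D id (?t e id E (tens (od a) (od b))) +
          (?t d id D (?t 0 E id (tens (od a) (od b))) + ?t d id D (?t e id E (tens (od a) (od b)))) -
          scaleT ?s
           (?t 0 E id (?t 0 D id (tens (od a) (od b))) + ?t 0 E id (?t d id D (tens (od a) (od b))) +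
            (?t e id E (?t 0 D id (tens (od a) (od b))) + ?t e id E (?t d id D (tens (od a) (od b))))) =
          tens (D (E (od a)) - scaleS ?s (E (D (od a)))) (od b) +
          scaleT (psign ((d + e) * degsum a)) (tens (od a) (D (E (od b)) - scaleS ?s (E (D (od b)))))"
        unfolding D1 D2 D3 D4 E1 E2 E3 E4 pq
        by (simp add: lin_diff[OF lin_tens(1)] lin_diff[OF lin_tens(2)] lin_scale[OF lin_tens(1)]
            lin_scale[OF lin_tens(2)] T.scale_right_distrib T.scale_right_diff_distrib mult_ac)
    qed
  qed
qed

text \<open>A substitute for the product V \<otimes> S(V) \<rightarrow> S(V), needed to reassemble a
  tensor. Linearity in \<open>v\<close> follows because maps out of S(V) are determined on
  generators.\<close>

lemma left_multiplication:
  "\<exists>B. (\<forall>v. lin scaleS scaleS (B v)) \<and> (\<forall>x. lin scale scaleS (\<lambda>v. B v x)) \<and>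
     (\<forall>v xs. B v (odot xs) = odot (v # xs))"
proof -
  have "\<exists>\<phi>. lin scaleS scaleS \<phi> \<and> (\<forall>xs. \<phi> (odot xs) = odot (v # xs))" for v
  proof (rule ex1_implies_ex, rule linear_from_S[OF vsS])
    show "multilinear scale scaleS (\<lambda>xs. odot (v # xs))"
      by (rule multilinearI) (use lin_odot[of "v # _"] in simp)
    show "odot (v # us @ x # y # vs) = scaleS (psign (i * j)) (odot (v # us @ y # x # vs))"
      if "x \<in> V i" "y \<in> V j" for us vs i j x y
      using odot_swap[OF that, of "v # us" vs] unfolding append_Cons .
  qed
  then obtain B where B: "\<And>v. lin scaleS scaleS (B v)" "\<And>v xs. B v (odot xs) = odot (v # xs)"
    by metis
  have "lin scale scaleS (\<lambda>v. B v x)" for x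
  proof (rule linI[OF vsV vsS])
    fix v w c
    have "B (v + w) = (\<lambda>x. B v x + B w x)"
      by (rule S_eqI[OF B(1) lin_compose_add[OF B(1) B(1)]]) (simp add: B(2) lin_add[OF lin_odot_Cons])
    then show "B (v + w) x = B v x + B w x" by simp
    have "B (scale c v) = (\<lambda>x. scaleS c (B v x))"
      by (rule S_eqI[OF B(1) lin_compose_scale[OF B(1)]]) (simp add: B(2) lin_scale[OF lin_odot_Cons])
    then show "B (scale c v) x = scaleS c (B v x)" by simp
  qed
  then show ?thesis using B by blast
qed

lemma counit: "\<exists>c. lin scaleS (*) c \<and> (\<forall>xs. c (odot xs) = (if xs = [] then 1 else 0))"
  by (rule ex1_implies_ex, rule linear_from_S[OF vector_space_field])
    (auto intro!: multilinearI lin_zero vsV vector_space_field)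

text \<open>Applying c \<otimes> c to the coderivation rule leaves only the two splittings with an
  empty block. Each contributes c(D x), so c(D x) = c(D x) + c(D x).\<close>

lemma counit_Coder:
  assumes D: "D \<in> Coder d" and c: "lin scaleS (*) c" "\<And>xs. c (odot xs) = (if xs = [] then 1 else 0)"
  shows "c (D x) = 0"
proof -
  have "lin scaleS (*) (\<lambda>a. c a * c b)" "lin scaleS (*) (\<lambda>b. c a * c b)" for a b
    using lin_compose_scale[OF c(1), of "c b"] lin_compose_scale[OF c(1), of "c a"]
    by (simp_all add: mult.commute)
  then obtain K where K: "lin scaleT (*) K" "\<And>a b. K (tens a b) = c a * c b"
    using tensor_universal[OF vector_space_field, of "\<lambda>a b. c a * c b"] by blast
  have KD: "K (comult y) = c y" for y
  proof (rule fun_cong[OF S_eqI[OF lin_compose[OF comult K(1)] c(1)]])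
    fix zs assume "hom zs"
    then show "K (comult (od zs)) = c (od zs)"
      by (simp add: comult_od unsh_linear[OF K(1)] K(2) unsh_left_Nil[OF vector_space_field] c(2))
  qed
  have "c (D (od zs)) = 0" if zs: "hom zs" for zs
  proof -
    have "c (D (od zs)) = usym (*) (\<lambda>a b. c (D (od a)) * c (od b)
        + psign (d * degsum a) * (c (od a) * c (D (od b)))) zs"
      unfolding KD[symmetric] Coder_comult_od[OF D zs] unsh_linear[OF K(1)]
      by (simp add: lin_add[OF K(1)] lin_scale[OF K(1)] K(2) KD)
    also have "\<dots> = c (D (od zs)) + c (D (od zs))"
      unfolding unsh_add[OF vector_space_field]
      by (simp add: unsh_left_Nil[OF vector_space_field] unsh_right_Nil[OF vector_space_field] c(2))
    finally show ?thesis by (metis add_cancel_right_right)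
  qed
  then have "(\<lambda>x. c (D x)) = (\<lambda>x. 0)"
    by (intro S_eqI[OF lin_compose[OF Coder_lin[OF D] c(1)] lin_zero[OF vsS vector_space_field]])
  then show ?thesis by (simp add: fun_eq_iff)
qed

end

section \<open>Coderivations are determined by their components\<close>

locale symmetric_coalgebra_char_0 = symmetric_coalgebra scale V scaleS odot scaleT tens
  for scale :: "'k::field_char_0 \<Rightarrow> 'v \<Rightarrow> 'v::ab_group_add"
    and V :: "int \<Rightarrow> 'v set"
    and scaleS :: "'k \<Rightarrow> 's \<Rightarrow> 's::ab_group_add"
    and odot :: "'v list \<Rightarrow> 's"
    and scaleT :: "'k \<Rightarrow> 't \<Rightarrow> 't::ab_group_add"
    and tens :: "'s \<Rightarrow> 's \<Rightarrow> 't"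
begin

interpretation V: vector_space scale by (rule vsV)
interpretation S: vector_space scaleS by (rule vsS)
interpretation T: vector_space scaleT by (rule vsT)

text \<open>The composite \<open>S(V) \<rightarrow> S(V) \<otimes> S(V) \<rightarrow> V \<otimes> S(V) \<rightarrow> S(V)\<close> multiplies \<open>S\<^sup>n(V)\<close> by \<open>n\<close>. In
  characteristic 0 it therefore detects everything except the component in \<open>S\<^sup>0(V)\<close>.\<close>

lemma Coder_eq_0:
  assumes D: "D \<in> Coder d" and comp: "\<And>zs. hom zs \<Longrightarrow> component D (map snd zs) = 0"
  shows "D = (\<lambda>x. 0)"
proof -
  note lD = Coder_lin[OF D]
  obtain B where B: "\<And>v. lin scaleS scaleS (B v)" "\<And>x. lin scale scaleS (\<lambda>v. B v x)"
     "\<And>v xs. B v (odot xs) = odot (v # xs)"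
    using left_multiplication by metis
  obtain c where c: "lin scaleS (*) c" "\<And>xs. c (odot xs) = (if xs = [] then 1 else 0)"
    using counit by metis
  obtain K where K: "lin scaleT scaleS K" "\<And>a b. K (tens a b) = B (proj a) b"
    using tensor_universal[OF vsS, of "\<lambda>a b. B (proj a) b"] B(1) lin_compose[OF proj B(2)] by metis
  \<comment> \<open>Only splittings with a single entry on the left survive \<open>proj\<close>.
    Putting that entry back in its place cancels its Koszul sign, so each of the
    \<open>length zs\<close> splittings returns the whole product.\<close>
  have euler: "K (comult (od zs)) = scaleS (of_nat (length zs)) (od zs)" if "hom zs" for zs
  proof -
    have "usym scaleS (\<lambda>a b. B (proj (od a)) (od b)) zs = scaleS (of_nat (length zs)) (od zs)"
      using that
    proof (induction zs)
      case (Cons z zs)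
      have "usym scaleS (\<lambda>a b. B (proj (od (z # a))) (od b)) zs = od (z # zs)"
        by (subst unsh_left_Nil[OF vsS]) (auto simp: proj_odot B(3) lin_0[OF B(2)] lin_0[OF lin_odot_Cons])
      moreover have "usym scaleS (\<lambda>a b. scaleS (psign (degsum a * fst z)) (B (proj (od a)) (od (z # b)))) zs
         = usym scaleS (\<lambda>a b. B (snd z) (B (proj (od a)) (od b))) zs"
      proof (rule unsh_cong)
        fix a b assume "mset a + mset b = mset zs"
        then have a: "hom a" using Cons.prems hom_mset by auto
        show "scaleS (psign (degsum a * fst z)) (B (proj (od a)) (od (z # b))) = B (snd z) (B (proj (od a)) (od b))"
        proof (cases "length a = 1")
          case True
          then obtain w where w: "a = [w]" by (cases a) auto
          have "odot (snd z # snd w # map snd b) = scaleS (psign (fst z * fst w)) (odot (snd w # snd z # map snd b))"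
            using odot_swap[of "snd z" "fst z" "snd w" "fst w" "[]"] a w Cons.prems by simp
          then show ?thesis by (simp add: w proj_odot B(3) mult.commute)
        qed (simp add: proj_odot lin_0[OF B(2)] lin_0[OF B(1)])
      qed
      moreover have "\<dots> = scaleS (of_nat (length zs)) (od (z # zs))"
        unfolding unsh_linear[OF B(1), symmetric]
        by (subst Cons.IH) (use Cons.prems in \<open>simp_all add: lin_scale[OF B(1)] B(3)\<close>)
      ultimately show ?case by (simp add: S.scale_left_distrib)
    qed (simp add: proj_odot lin_0[OF B(2)])
    then show ?thesis by (simp add: comult_od[OF that] unsh_linear[OF K(1)] K(2))
  qed
  \<comment> \<open>Division by the length inverts the factor above. For the empty list the factor
    is 1/0 = 0, so \<open>L\<close> kills the unit.\<close>
  let ?m = "\<lambda>xs. scaleS (1 / of_nat (length xs)) (odot xs)"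
  have "multilinear scale scaleS ?m"
    by (rule multilinearI) (simp add: lin_compose_scale[OF lin_odot])
  moreover have "?m (us @ x # y # vs) = scaleS (psign (i * j)) (?m (us @ y # x # vs))"
    if "x \<in> V i" "y \<in> V j" for us vs i j x y
    by (subst odot_swap[OF that]) (simp add: mult.commute)
  ultimately obtain L where L: "lin scaleS scaleS L" "\<And>xs. L (odot xs) = ?m xs"
    using ex1_implies_ex[OF linear_from_S[OF vsS, of ?m]] by blast
  have "lin scaleS scaleS (\<lambda>y. scaleS (c y) (odot []))"
    by (rule linI[OF vsS vsS]) (simp_all add: lin_add[OF c(1)] lin_scale[OF c(1)] S.scale_left_distrib)
  \<comment> \<open>In positive length the first summand returns the element and the counit
    vanishes; in length 0 the roles are exchanged.\<close>
  then have "(\<lambda>y. L (K (comult y)) + scaleS (c y) (odot [])) = (\<lambda>y. y)"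
    by (intro S_eqI[OF lin_compose_add[OF lin_compose[OF lin_compose[OF comult K(1)] L(1)]]] lin_ident vsS)
      (auto simp: euler lin_scale[OF L(1)] L(2) c(2))
  then have inj: "y = L (K (comult y)) + scaleS (c y) (odot [])" for y
    by (metis (mono_tags))
  have "D (od zs) = 0" if "hom zs" for zs
    using that
  proof (induction "length zs" arbitrary: zs rule: less_induct)
    case less
    have "K (comult (D (od zs))) = usym scaleS (\<lambda>a b. 0) zs"
      unfolding Coder_comult_od[OF D less.prems] unsh_linear[OF K(1)]
    proof (rule unsh_cong)
      fix a b assume ab: "mset a + mset b = mset zs"
      have hom: "hom a" "hom b" using hom_mset[OF ab] less.prems by auto
      have "length zs = length a + length b" using ab by (metis size_mset size_union)
      \<comment> \<open>\<open>proj (od a)\<close> is nonzero only when \<open>a\<close> has one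
        entry; then \<open>b\<close> is shorter than \<open>zs\<close>, and the induction hypothesis
        applies to it.\<close>
      then have "length a = 1 \<Longrightarrow> D (od b) = 0" using less.hyps hom by simp
      then have "B (proj (od a)) (D (od b)) = 0"
        by (simp add: proj_odot lin_0[OF B(1)] lin_0[OF B(2)])
      moreover have "proj (D (od a)) = 0" using comp[OF hom(1)] by (simp add: component_def)
      ultimately show "K (tens (D (od a)) (od b) + scaleT (psign (d * degsum a)) (tens (od a) (D (od b)))) = 0"
        by (simp add: lin_add[OF K(1)] lin_scale[OF K(1)] K(2) lin_0[OF B(2)])
    qed
    then show ?case
      using inj[of "D (od zs)"] by (simp add: unsh_zero[OF vsS] lin_0[OF L(1)] counit_Coder[OF D c])
  qed
  then show ?thesis by (intro S_eqI[OF lD lin_zero[OF vsS vsS]])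
qed

lemma Coder_eqI:
  assumes D: "D \<in> Coder d" and E: "E \<in> Coder d"
    and comp: "\<And>zs. hom zs \<Longrightarrow> component D (map snd zs) = component E (map snd zs)"
  shows "D = E"
proof -
  have "(\<lambda>x. D x - E x) = (\<lambda>x. 0)"
    by (rule Coder_eq_0[OF Coder_diff[OF D E]])
      (use comp in \<open>simp add: component_def lin_diff[OF proj]\<close>)
  then show ?thesis by (simp add: fun_eq_iff)
qed

text \<open>The coderivation constructed from the components of \<open>D\<close> has the same
  components as \<open>D\<close>, hence equals it. So the explicit formula of the construction holds
  for every coderivation.\<close>

lemma Coder_od:
  assumes D: "D \<in> Coder d" and zs: "hom zs"
  shows "D (od zs) = usym scaleS (\<lambda>a b. odot (component D (map snd a) # map snd b)) zs"
proof -
  note lD = Coder_lin[OF D]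
  have "hmult scale scale (\<lambda>zs. component D (map snd zs))"
    unfolding hmult_def using multilinearD[OF multilinear_component[OF lD] vsV vsV] by simp
  moreover have "hsym scale V (\<lambda>zs. component D (map snd zs))"
    by (rule hsymI, unfold map_append list.map snd_conv) (rule component_swap[OF lD])
  ultimately obtain E where "E \<in> Coder d" and E: "\<And>zs. hom zs \<Longrightarrow>
      component E (map snd zs) = component D (map snd zs) \<and>
      E (od zs) = usym scaleS (\<lambda>a b. odot (component D (map snd a) # map snd b)) zs"
    using coderivation_exists[OF _ _ component_deg[OF D]] by blast
  moreover have "D = E" by (rule Coder_eqI) (use D \<open>E \<in> Coder d\<close> E in simp_all)
  ultimately show ?thesis using zs by blast
qed

lemma component_comp:
  assumes D: "lin scaleS scaleS D" and E: "E \<in> Coder e" and zs: "hom zs"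
  shows "component (\<lambda>x. D (E x)) (map snd zs)
    = usym scale (\<lambda>a b. component D (component E (map snd a) # map snd b)) zs"
  unfolding component_def[of "\<lambda>x. D (E x)"] Coder_od[OF E zs]
  by (simp add: unsh_linear[OF lin_compose[OF D proj]] flip: component_def)

end

section \<open>Components with respect to the unshifted grading\<close>

text \<open>Elements of \<open>\<gg>[1]\<close> of degree \<open>d\<close> have degree \<open>d + 1\<close> in \<open>\<gg>\<close>.\<close>

definition up :: "(int \<times> 'v) list \<Rightarrow> (int \<times> 'v) list" where
  "up zs = map (\<lambda>z. (fst z + 1, snd z)) zs"

lemma up_simps [simp]:
  "up [] = []" "up (z # zs) = (fst z + 1, snd z) # up zs" "up (xs @ ys) = up xs @ up ys"
  "length (up zs) = length zs" "map snd (up zs) = map snd zs"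
  "degsum (up zs) = degsum zs + int (length zs)"
  by (simp_all add: up_def comp_def, induction zs, simp_all)

lemma usym_up:
  assumes "vector_space sc"
  shows "usym sc (\<lambda>a b. sc (psign (dec (up a @ up b))) (H (length a) (map snd a) (map snd b))) zs
    = sc (psign (dec (up zs))) (uskew sc (\<lambda>a b. H (length a) (map snd a) (map snd b)) (up zs))"
proof -
  interpret vector_space sc by fact
  have "usym sc (\<lambda>a b. sc (psign (dec (up a @ up b))) (H (length a) (map snd a) (map snd b))) zs
    = unsh sc (\<lambda>z w. psign ((fst z - 1) * (fst w - 1)))
       (\<lambda>a b. sc (psign (dec (a @ b))) (H (length a) (map snd a) (map snd b))) (up zs)"
    unfolding up_def unsh_map by (simp add: comp_def)
  then show ?thesis unfolding uskew_eq_usym[OF assms] by simp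
qed

text \<open>\<open>tri n\<close> is the length-dependent exponent in the components of
  \<open>Q\<close>, and \<open>tri (Suc n)\<close> the one in \<open>assoc_maps\<close>.\<close>

definition tri :: "nat \<Rightarrow> int" where
  "tri n = int (n * (n + 1) div 2)"

lemma tri_0 [simp]: "tri 0 = 0"
  by (simp add: tri_def)

lemma tri_Suc [simp]: "tri (Suc n) = tri n + int n + 1"
proof -
  have "Suc n * (Suc n + 1) = n * (n + 1) + 2 * Suc n" by simp
  then have "Suc n * (Suc n + 1) div 2 = n * (n + 1) div 2 + Suc n"
    by (metis div_mult_self4 zero_neq_numeral add.commute)
  then show ?thesis by (simp add: tri_def)
qed

lemma tri_add: "tri (m + n) = tri m + tri n + int m * int n"
  by (induction m) (simp_all add: algebra_simps)

locale linf_coalgebra_char_0 = linf_coalgebra scale G scaleS odot scaleT tens l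
  for scale :: "'k::field_char_0 \<Rightarrow> 'g \<Rightarrow> 'g::ab_group_add"
    and G :: "int \<Rightarrow> 'g set"
    and scaleS :: "'k \<Rightarrow> 's \<Rightarrow> 's::ab_group_add"
    and odot :: "'g list \<Rightarrow> 's"
    and scaleT :: "'k \<Rightarrow> 't \<Rightarrow> 't::ab_group_add"
    and tens :: "'s \<Rightarrow> 's \<Rightarrow> 't"
    and l :: "'g list \<Rightarrow> 'g"
begin

sublocale symmetric_coalgebra_char_0 scale "shift G" scaleS odot scaleT tens
  by unfold_locales

interpretation V: vector_space scale by (rule vsV)
interpretation S: vector_space scaleS by (rule vsS)

lemma homog_G_iff: "homog G ds xs \<longleftrightarrow> (\<exists>zs. hom zs \<and> ds = map fst (up zs) \<and> xs = map snd zs)"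
proof -
  have 1: "homog G ds xs \<longleftrightarrow> homog (shift G) (map (\<lambda>d. d - 1) ds) xs"
    by (simp add: homog_def shift_def list_all2_map1)
  have 2: "map (\<lambda>d. d - 1) ds = map fst zs \<longleftrightarrow> ds = map fst (up zs)" for zs :: "(int \<times> 'g) list"
  proof
    assume "map (\<lambda>d. d - 1) ds = map fst zs"
    then have "map (\<lambda>d. d + 1) (map (\<lambda>d. d - 1) ds) = map (\<lambda>d. d + 1) (map fst zs)" by simp
    then show "ds = map fst (up zs)" by (simp add: up_def comp_def)
  qed (simp add: up_def comp_def)
  show ?thesis unfolding 1 homog_iff 2 ..
qed

lemma all_homog_G_iff:
  "(\<forall>ds xs. homog G ds xs \<longrightarrow> P ds xs) \<longleftrightarrow> (\<forall>zs. hom zs \<longrightarrow> P (map fst (up zs)) (map snd zs))"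
  by (auto simp: homog_G_iff)

text \<open>Swapping the neighbours changes the decalage exponent by i - j. The skew sign for
  degrees i + 1, j + 1 and the symmetric sign for degrees i, j differ by the same parity.\<close>

lemma psign_dec_up_swap:
  "psign (c + dec (up (us @ (i, x) # (j, y) # vs)))
    = - (psign ((i + 1) * (j + 1)) * (psign (i * j) * psign (c + dec (up (us @ (j, y) # (i, x) # vs)))))"
proof -
  let ?R = "dec (up (us @ (j, y) # (i, x) # vs))"
  \<comment> \<open>The last summand turns the congruence into an equality: i - j = 1 + (i+1)(j+1) +
    ij + 2(-j-1-ij).\<close>
  have "psign (c + dec (up (us @ (i, x) # (j, y) # vs)))
      = psign (1 + ((i + 1) * (j + 1) + (i * j + (c + ?R))) + 2 * (- j - 1 - i * j))"
    by (rule arg_cong[of _ _ psign]) (simp add: dec_append algebra_simps)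
  also have "\<dots> = psign 1 * (psign ((i + 1) * (j + 1)) * (psign (i * j) * psign (c + ?R)))"
    by (simp only: psign_add) (simp add: psign_def)
  finally show ?thesis by (simp only: psign_def[of 1]) simp
qed

text \<open>Decalage makes a skew family symmetric for the shifted grading. An extra exponent
  \<open>k\<close> depending on the length alone is harmless; it will be \<open>tri\<close> for
  \<open>Q\<close> and \<open>tri (Suc n) + 1\<close> for actions.\<close>

lemma hsym_signed:
  assumes "graded_skew scale G m"
  shows "hsym scale (shift G) (\<lambda>zs. scale (psign (k (length zs) + dec (up zs))) (m (map snd zs)))"
proof (rule hsymI)
  fix us vs :: "(int \<times> 'g) list" and i j x y
  assume "x \<in> shift G i" "y \<in> shift G j"
  then have "x \<in> G (i + 1)" "y \<in> G (j + 1)" by (simp_all add: shift_def)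
  then have "m (map snd us @ x # y # map snd vs)
      = - scale (psign ((i + 1) * (j + 1))) (m (map snd us @ y # x # map snd vs))"
    using assms unfolding graded_skew_def powi_minus_one by blast
  then show "scale (psign (k (length (us @ (i, x) # (j, y) # vs)) + dec (up (us @ (i, x) # (j, y) # vs))))
        (m (map snd (us @ (i, x) # (j, y) # vs)))
      = scale (psign (i * j)) (scale (psign (k (length (us @ (j, y) # (i, x) # vs)) + dec (up (us @ (j, y) # (i, x) # vs))))
        (m (map snd (us @ (j, y) # (i, x) # vs))))"
    unfolding psign_dec_up_swap[of _ us i x j y vs] by (simp add: mult_ac del: up_simps)
qed

lemma hmult_signed:
  assumes "multilinear scale scale m"
  shows "hmult scale scale (\<lambda>zs. scale (psign (k (length zs) + dec (up zs))) (m (map snd zs)))"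
proof (rule hmult_scale_deg)
  show "hmult scale scale (\<lambda>zs. m (map snd zs))"
    unfolding hmult_def using multilinearD[OF assms vsV vsV] by simp
qed (simp add: dec_append)

text \<open>The decalage signs combine to a sign that depends on the lengths of the blocks only.\<close>

lemma component_comp_signed:
  fixes kD kE r :: "nat \<Rightarrow> int"
  assumes D: "lin scaleS scaleS D" and E: "E \<in> Coder e" and zs: "hom zs"
    and hD: "\<And>ws. hom ws \<Longrightarrow> component D (map snd ws) = scale (psign (kD (length ws) + dec (up ws))) (mD (map snd ws))"
    and hE: "\<And>ws. hom ws \<Longrightarrow> component E (map snd ws) = scale (psign (kE (length ws) + dec (up ws))) (mE (map snd ws))"
    and mD: "\<And>c x ys. mD (scale c x # ys) = scale c (mD (x # ys))"
    and parity: "\<And>p q. length zs = p + q \<Longrightarrow> even (kE p + kD (Suc q) + int q * (e + 1 - int p) - (C + r p))"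
  shows "component (\<lambda>x. D (E x)) (map snd zs) = scale (psign (C + dec (up zs)))
    (\<Sum>p=0..length zs. \<Sum>\<sigma>\<in>Sh p (length zs - p). scale (\<chi> \<sigma> (map fst (up zs)))
       (scale (psign (r p)) (mD (mE (first p \<sigma> (map snd zs)) # rest p \<sigma> (map snd zs)))))"
proof -
  let ?H = "\<lambda>p xs ys. scale (psign (r p)) (mD (mE xs # ys))"
  have "component (\<lambda>x. D (E x)) (map snd zs)
      = usym scale (\<lambda>a b. component D (component E (map snd a) # map snd b)) zs"
    by (rule component_comp[OF D E zs])
  also have "\<dots> = usym scale (\<lambda>a b. scale (psign C) (scale (psign (dec (up a @ up b)))
      (?H (length a) (map snd a) (map snd b)))) zs"
  proof (rule unsh_cong)
    fix a b assume ab: "mset a + mset b = mset zs"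
    have len: "length zs = length a + length b" using ab by (metis size_mset size_union)
    have a: "hom a" and b: "hom b" using hom_mset[OF ab] zs by auto
    \<comment> \<open>Let p and q be the lengths of \<open>a\<close> and \<open>b\<close>. Replacing
      \<open>a\<close> by the single entry \<open>?w\<close> changes its contribution to the
      exponent from q(degsum a + p) to q(degsum a + e + 1), apart from the internal exponent of
      \<open>a\<close>, which \<open>E\<close> supplies. The difference is the mixed term q(e + 1 -
      p) in \<open>parity\<close>.\<close>
    let ?w = "(degsum a + e, component E (map snd a))"
    have "hom (?w # b)" using b component_deg[OF E a] by simp
    from hD[OF this] have "component D (component E (map snd a) # map snd b)
       = scale (psign (kD (Suc (length b)) + dec (up (?w # b)))
           * psign (kE (length a) + dec (up a))) (mD (mE (map snd a) # map snd b))"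
      by (simp add: hE[OF a] mD)
    also have "psign (kD (Suc (length b)) + dec (up (?w # b))) * psign (kE (length a) + dec (up a))
       = (psign C * (psign (dec (up a @ up b)) * psign (r (length a))) :: 'k)"
    proof (simp only: flip: psign_add, rule psign_cong)
      have "kD (Suc (length b)) + dec (up (?w # b)) + (kE (length a) + dec (up a))
          - (C + (dec (up a @ up b) + r (length a)))
        = kE (length a) + kD (Suc (length b)) + int (length b) * (e + 1 - int (length a)) - (C + r (length a))"
        by (simp add: dec_append algebra_simps)
      then show "even (kD (Suc (length b)) + dec (up (?w # b)) + (kE (length a) + dec (up a))
          - (C + (dec (up a @ up b) + r (length a))))"
        using parity[OF len] by (simp only:)
    qed
    finally show "component D (component E (map snd a) # map snd b)
      = scale (psign C) (scale (psign (dec (up a @ up b))) (?H (length a) (map snd a) (map snd b)))"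
      by simp
  qed
  also have "\<dots> = scale (psign C) (usym scale (\<lambda>a b. scale (psign (dec (up a @ up b)))
      (?H (length a) (map snd a) (map snd b))) zs)"
    by (rule unsh_scale[OF vsV, symmetric])
  also have "\<dots> = scale (psign C) (scale (psign (dec (up zs)))
      (uskew scale (\<lambda>a b. ?H (length a) (map snd a) (map snd b)) (up zs)))"
    by (subst usym_up[OF vsV, of ?H]) (rule refl)
  also have "uskew scale (\<lambda>a b. ?H (length a) (map snd a) (map snd b)) (up zs)
    = (\<Sum>p=0..length zs. \<Sum>\<sigma>\<in>Sh p (length zs - p). scale (\<chi> \<sigma> (map fst (up zs)))
       (?H p (first p \<sigma> (map snd zs)) (rest p \<sigma> (map snd zs))))"
    using sum_Sh_skew[OF vsV, of "up zs" ?H] by simp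
  finally show ?thesis by (simp add: psign_add)
qed

text \<open>The value of \<open>l []\<close> is arbitrary, whereas \<open>Q\<^sub>0 = 0\<close>.\<close>

definition bracket :: "'g list \<Rightarrow> 'g" where
  "bracket xs = (if xs = [] then 0 else l xs)"

lemma Q_props: "Q \<in> Coder 1"
  and component_Q: "hom zs \<Longrightarrow> component Q (map snd zs)
    = scale (psign (tri (length zs) + dec (up zs))) (bracket (map snd zs))"
proof -
  have bracket: "bracket (us @ x # vs) = l (us @ x # vs)" for us x vs
    by (simp add: bracket_def)
  have ml: "multilinear scale scale bracket" and sk: "graded_skew scale G bracket"
    using linf unfolding linf_algebra_def multilinear_def graded_skew_def bracket by blast+
  have deg: "scale (psign (tri (length zs) + dec (up zs))) (bracket (map snd zs)) \<in> shift G (degsum zs + 1)"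
    if "hom zs" for zs
  proof (cases "zs = []")
    case False
    have "homog G (map fst (up zs)) (map snd zs)" using that homog_G_iff by blast
    then have "l (map snd zs) \<in> G (sum_list (map fst (up zs)) + 2 - int (length (map snd zs)))"
      using linf False unfolding linf_algebra_def by (metis map_is_Nil_conv)
    also have "sum_list (map fst (up zs)) + 2 - int (length (map snd zs)) = degsum zs + 1 + 1"
      using up_simps(6)[of zs] by (simp only: degsum_def length_map)
    finally have "bracket (map snd zs) \<in> shift G (degsum zs + 1)"
      unfolding shift_def bracket_def using False by simp
    then show ?thesis by (rule V.subspace_scale[OF subspace_V])
  qed (simp add: bracket_def V.subspace_0[OF subspace_V])
  obtain D where D: "D \<in> Coder 1" "\<And>zs. hom zs \<Longrightarrow> component D (map snd zs)
      = scale (psign (tri (length zs) + dec (up zs))) (bracket (map snd zs))"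
    using coderivation_exists[OF hmult_signed[OF ml, of tri] hsym_signed[OF sk, of tri] deg] by blast
  \<comment> \<open>Since \<open>bracket []\<close> is 0, the two clauses defining \<open>Q\<close>
    merge into one formula for all homogeneous lists, so existence and uniqueness of coderivations
    with given components apply.\<close>
  have eq: "component D' [] = 0 \<and> (\<forall>ds xs. homog G ds xs \<and> xs \<noteq> [] \<longrightarrow>
        component D' xs =
          scale ((-1) powi (int (length xs * (length xs + 1) div 2) + decalage ds)) (l xs))
    \<longleftrightarrow> (\<forall>zs. hom zs \<longrightarrow> component D' (map snd zs)
      = scale (psign (tri (length zs) + dec (up zs))) (bracket (map snd zs)))" (is "?A \<longleftrightarrow> ?B") for D'
  proof -
    have *: "(\<forall>ds xs. homog G ds xs \<and> xs \<noteq> [] \<longrightarrow>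
        component D' xs =
          scale ((-1) powi (int (length xs * (length xs + 1) div 2) + decalage ds)) (l xs))
      \<longleftrightarrow> (\<forall>zs. hom zs \<and> zs \<noteq> [] \<longrightarrow> component D' (map snd zs)
      = scale (psign (tri (length zs) + dec (up zs))) (bracket (map snd zs)))"
      unfolding imp_conjL all_homog_G_iff by (simp add: powi_minus_one tri_def dec_def bracket_def)
    show ?thesis
    proof
      assume ?A
      show ?B
      proof (intro allI impI)
        fix zs assume "hom zs"
        then show "component D' (map snd zs)
          = scale (psign (tri (length zs) + dec (up zs))) (bracket (map snd zs))"
          using \<open>?A\<close> unfolding * by (cases "zs = []") (auto simp: bracket_def)
      qed
    next
      assume ?B
      have "component D' [] = 0" using \<open>?B\<close>[rule_format, of "[]"] by (simp add: bracket_def)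
      then show ?A unfolding * using \<open>?B\<close> by blast
    qed
  qed
  have "Q = D"
    unfolding Q_def eq
  proof (rule the_equality)
    fix D' assume D': "D' \<in> Coder 1 \<and> (\<forall>zs. hom zs \<longrightarrow> component D' (map snd zs)
      = scale (psign (tri (length zs) + dec (up zs))) (bracket (map snd zs)))"
    then show "D' = D" by (intro Coder_eqI[of D' 1 D]) (use D in auto)
  qed (use D in blast)
  then show "Q \<in> Coder 1" "hom zs \<Longrightarrow> component Q (map snd zs)
    = scale (psign (tri (length zs) + dec (up zs))) (bracket (map snd zs))"
    using D by auto
qed

lemma assoc_maps:
  assumes D: "lin scaleS scaleS (\<psi> h)"
  shows "multilinear scale scale (assoc_maps \<psi> h)"
    and "hom zs \<Longrightarrow> assoc_maps \<psi> h (map snd zs)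
      = scale (psign (tri (Suc (length zs)) + dec (up zs))) (component (\<psi> h) (map snd zs))"
proof -
  let ?f = "\<lambda>zs. scale (psign (tri (Suc (length zs)) + dec (up zs))) (component (\<psi> h) (map snd zs))"
  have hm: "hmult scale scale ?f"
    by (rule hmult_signed[OF multilinear_component[OF D], of "\<lambda>n. tri (Suc n)"])
  have eq: "(\<forall>ds xs. homog G ds xs \<longrightarrow>
        m xs = scale ((-1) powi (int ((length xs + 1) * (length xs + 2) div 2) + decalage ds))
                 (component (\<psi> h) xs)) \<longleftrightarrow> (\<forall>zs. hom zs \<longrightarrow> m (map snd zs) = ?f zs)" for m
    unfolding all_homog_G_iff by (simp add: powi_minus_one tri_def dec_def del: tri_Suc)
  have "\<exists>!m. multilinear scale scale m \<and> (\<forall>zs. hom zs \<longrightarrow> m (map snd zs) = ?f zs)"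
  proof (rule ex1I[of _ "hom_ext ?f"])
    show "multilinear scale scale (hom_ext ?f) \<and> (\<forall>zs. hom zs \<longrightarrow> hom_ext ?f (map snd zs) = ?f zs)"
      using multilinear_hom_ext[OF hm vsV] hom_ext_hom[OF hm] by blast
    fix m assume m: "multilinear scale scale m \<and> (\<forall>zs. hom zs \<longrightarrow> m (map snd zs) = ?f zs)"
    show "m = hom_ext ?f"
      by (rule multilinear_eqI[OF _ multilinear_hom_ext[OF hm vsV]]) (use m hom_ext_hom[OF hm] in auto)
  qed
  then have "multilinear scale scale (assoc_maps \<psi> h) \<and>
      (\<forall>zs. hom zs \<longrightarrow> assoc_maps \<psi> h (map snd zs) = ?f zs)"
    unfolding assoc_maps_def eq by (rule theI')
  then show "multilinear scale scale (assoc_maps \<psi> h)"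
    and "hom zs \<Longrightarrow> assoc_maps \<psi> h (map snd zs) = ?f zs" by blast+
qed

end

text \<open>The grading is given on \<open>G\<close>, but the coalgebra is built on
  \<open>shift G\<close>. Reindexing by \<open>?s\<close>, with inverse \<open>?t\<close>, matches
  the homogeneous decompositions of the two gradings.\<close>

lemma graded_vector_space_shift:
  assumes "graded_vector_space scale V"
  shows "graded_vector_space scale (shift V)"
proof -
  let ?P = "\<lambda>V x f. (\<forall>i. Poly_Mapping.lookup f i \<in> V i) \<and>
      x = (\<Sum>i\<in>Poly_Mapping.keys f. Poly_Mapping.lookup f i)"
  let ?s = "Poly_Mapping.map_key (\<lambda>i :: int. i + 1)" and ?t = "Poly_Mapping.map_key (\<lambda>i :: int. i - 1)"
  have inj: "inj (\<lambda>i :: int. i + 1)" "inj (\<lambda>i :: int. i - 1)" by (auto intro: injI)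
  have lookup: "Poly_Mapping.lookup (?s f) i = Poly_Mapping.lookup f (i + 1)"
    "Poly_Mapping.lookup (?t f) i = Poly_Mapping.lookup f (i - 1)" for f :: "int \<Rightarrow>\<^sub>0 'b" and i
    by (simp_all add: map_key.rep_eq inj)
  have st: "?s (?t f) = f" "?t (?s f) = f" for f :: "int \<Rightarrow>\<^sub>0 'b"
    by (simp_all add: poly_mapping_eqI lookup)
  have sum: "(\<Sum>i\<in>Poly_Mapping.keys (?s f). Poly_Mapping.lookup (?s f) i)
      = (\<Sum>i\<in>Poly_Mapping.keys f. Poly_Mapping.lookup f i)" for f :: "int \<Rightarrow>\<^sub>0 'b"
    by (rule sum.reindex_bij_witness[of _ "\<lambda>i. i - 1" "\<lambda>i. i + 1"])
      (auto simp: in_keys_iff lookup)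
  have iff: "?P (shift V) x (?s f) \<longleftrightarrow> ?P V x f" for x f
  proof -
    have "(\<forall>i. Poly_Mapping.lookup (?s f) i \<in> shift V i) \<longleftrightarrow> (\<forall>i. Poly_Mapping.lookup f i \<in> V i)"
      unfolding lookup shift_def by (metis diff_add_cancel)
    then show ?thesis unfolding sum by simp
  qed
  have "\<exists>!f. ?P (shift V) x f" for x
  proof -
    obtain f where f: "?P V x f" and uniq: "\<And>g. ?P V x g \<Longrightarrow> g = f"
      using assms unfolding graded_vector_space_def by metis
    show ?thesis
    proof (rule ex1I[of _ "?s f"])
      show "?P (shift V) x (?s f)" using f iff by blast
      fix g assume "?P (shift V) x g"
      then have "?P V x (?t g)" using iff[of "?t g" x] unfolding st by blast
      then have "?t g = f" by (rule uniq)
      then show "g = ?s f" using st(1)[of g] by simp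
    qed
  qed
  then show ?thesis using assms by (simp add: graded_vector_space_def shift_def)
qed

section \<open>Actions and their associated maps\<close>

context linf_coalgebra_char_0
begin

interpretation V: vector_space scale by (rule vsV)
interpretation S: vector_space scaleS by (rule vsS)

lemma all_homog_G_length_iff:
  "(\<forall>ds xs n. homog G ds xs \<and> n = length xs \<longrightarrow> P ds xs n)
    \<longleftrightarrow> (\<forall>zs. hom zs \<longrightarrow> P (map fst (up zs)) (map snd zs) (length zs))"
  using all_homog_G_iff[of "\<lambda>ds xs. P ds xs (length xs)"] by simp

text \<open>The summand 1 in the exponent is the sign in \<open>\<mu> = - assoc_maps \<psi>\<close>.\<close>

definition represents :: "('s \<Rightarrow> 's) \<Rightarrow> ('g list \<Rightarrow> 'g) \<Rightarrow> bool" where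
  "represents D m \<longleftrightarrow> multilinear scale scale m \<and> (\<forall>zs. hom zs \<longrightarrow> component D (map snd zs)
     = scale (psign (tri (Suc (length zs)) + 1 + dec (up zs))) (m (map snd zs)))"

lemma representsD:
  assumes "represents D m" "hom zs"
  shows "component D (map snd zs) = scale (psign (tri (Suc (length zs)) + 1 + dec (up zs))) (m (map snd zs))"
    and "m (map snd zs) = scale (psign (tri (Suc (length zs)) + 1 + dec (up zs))) (component D (map snd zs))"
  using assms unfolding represents_def by (simp_all del: tri_Suc)

lemma represents_multilinear: "represents D m \<Longrightarrow> multilinear scale scale m"
  by (simp add: represents_def)

lemma represents_unique: "represents D m \<Longrightarrow> represents D m' \<Longrightarrow> m = m'"
  by (rule multilinear_eqI[of scale]) (simp_all add: representsD(2) represents_multilinear del: tri_Suc)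

lemma represents_assoc_maps:
  assumes "\<psi> h \<in> Coder 0"
  shows "represents (\<psi> h) (\<lambda>xs. - assoc_maps \<psi> h xs)"
proof -
  note a = assoc_maps[where \<psi> = \<psi> and h = h, OF Coder_lin[OF assms]]
  have "multilinear scale scale (\<lambda>xs. - assoc_maps \<psi> h xs)"
    by (rule multilinearI) (rule lin_compose_minus[OF multilinearD[OF a(1) vsV vsV]])
  moreover have "psign (tri (Suc n) + 1 + d) * psign (tri (Suc n) + d) = (-1 :: 'k)" for n d
    by (simp add: psign_def del: tri_Suc)
  ultimately show ?thesis
    unfolding represents_def by (simp add: a(2) del: tri_Suc)
qed

text \<open>The converse of \<open>hsym_signed\<close>: the same swap of decalage signs, now with
  degrees i - 1 and j - 1 in the shifted space, turns the symmetry of the components of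
  \<open>D\<close> into skewness of \<open>m\<close>.\<close>

lemma represents_skew:
  assumes D: "D \<in> Coder 0" and m: "represents D m"
  shows "graded_skew scale G m"
  unfolding graded_skew_def powi_minus_one
proof (intro allI ballI)
  fix i j x y us vs assume "x \<in> G i" "y \<in> G j"
  then have xy: "x \<in> shift G (i - 1)" "y \<in> shift G (j - 1)" by (simp_all add: shift_def)
  have "m (us @ x # y # vs) = scale (- psign (i * j)) (m (us @ y # x # vs))"
  proof (rule multilinear_symmetricI[OF represents_multilinear[OF m] xy vsV])
    fix us vs assume h: "hom us" "hom vs"
    have 1: "hom (us @ (i - 1, x) # (j - 1, y) # vs)" and 2: "hom (us @ (j - 1, y) # (i - 1, x) # vs)"
      using xy h by simp_all
    let ?c = "tri (Suc (length us + (length vs + 2))) + 1"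
    have "(psign (?c + dec (up (us @ (i - 1, x) # (j - 1, y) # vs))) :: 'k)
        = - (psign ((i - 1 + 1) * (j - 1 + 1)) * (psign ((i - 1) * (j - 1))
            * psign (?c + dec (up (us @ (j - 1, y) # (i - 1, x) # vs)))))"
      by (rule psign_dec_up_swap)
    then show "m (map snd us @ x # y # map snd vs) = scale (- psign (i * j)) (m (map snd us @ y # x # map snd vs))"
      using representsD(2)[OF m 1] representsD(2)[OF m 2]
        component_swap[OF Coder_lin[OF D] xy, of "map snd us" "map snd vs"]
      by (simp add: mult_ac del: tri_Suc up_simps)
  qed
  then show "m (us @ x # y # vs) = - scale (psign (i * j)) (m (us @ y # x # vs))" by simp
qed

lemma represents_degree:
  assumes D: "D \<in> Coder 0" and m: "represents D m" and "homog G ds xs"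
  shows "m xs \<in> G (sum_list ds + 1 - int (length xs))"
proof -
  obtain zs where zs: "hom zs" "ds = map fst (up zs)" "xs = map snd zs"
    using assms(3) homog_G_iff by blast
  have "m xs \<in> shift G (degsum zs + 0)"
    unfolding zs(3) representsD(2)[OF m zs(1)]
    by (rule V.subspace_scale[OF subspace_V component_deg[OF D zs(1)]])
  moreover have "sum_list ds = degsum zs + int (length zs)"
    using up_simps(6)[of zs] by (simp add: zs(2) degsum_def)
  ultimately show ?thesis by (simp add: shift_def zs(3))
qed

lemma represents_exists:
  assumes m: "multilinear scale scale m" and sk: "graded_skew scale G m"
    and deg: "\<And>ds xs. homog G ds xs \<Longrightarrow> m xs \<in> G (sum_list ds + 1 - int (length xs))"
  shows "\<exists>D\<in>Coder 0. represents D m"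
proof -
  let ?k = "\<lambda>n. tri (Suc n) + 1"
  have "scale (psign (?k (length zs) + dec (up zs))) (m (map snd zs)) \<in> shift G (degsum zs + 0)"
    if "hom zs" for zs
  proof (rule V.subspace_scale[OF subspace_V])
    have "homog G (map fst (up zs)) (map snd zs)" using that homog_G_iff by blast
    from deg[OF this] have "m (map snd zs) \<in> G (degsum (up zs) + 1 - int (length zs))"
      unfolding degsum_def by simp
    then show "m (map snd zs) \<in> shift G (degsum zs + 0)" by (simp add: shift_def)
  qed
  from coderivation_exists[OF hmult_signed[OF m, of ?k] hsym_signed[OF sk, of ?k] this]
  show ?thesis unfolding represents_def using m by blast
qed

section \<open>The two equations as identities between coderivations\<close>

definition bracket_compatible :: "('g list \<Rightarrow> 'g) \<Rightarrow> bool" where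
  "bracket_compatible m \<longleftrightarrow> (\<forall>ds xs n. homog G ds xs \<and> n = length xs \<longrightarrow>
        (\<Sum>p=1..n. \<Sum>\<sigma>\<in>Sh p (n - p).
            scale (\<chi> \<sigma> ds) (m (l (first p \<sigma> xs) # rest p \<sigma> xs)))
        = (\<Sum>p=0..n. \<Sum>\<sigma>\<in>Sh p (n - p).
            scale ((-1) ^ (p + 1) * \<chi> \<sigma> ds) (l (m (first p \<sigma> xs) # rest p \<sigma> xs))))"

definition comp_Sh :: "('g list \<Rightarrow> 'g) \<Rightarrow> ('g list \<Rightarrow> 'g) \<Rightarrow> int list \<Rightarrow> 'g list \<Rightarrow> 'g" where
  "comp_Sh m m' ds xs = (\<Sum>p=0..length xs. \<Sum>\<sigma>\<in>Sh p (length xs - p).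
            scale (\<chi> \<sigma> ds) (m (m' (first p \<sigma> xs) # rest p \<sigma> xs)))"

lemma multilinear_head:
  assumes "multilinear scale scale m"
  shows "m (scale c x # ys) = scale c (m (x # ys))" "m (0 # ys) = 0"
  using lin_scale[OF multilinearD[OF assms vsV vsV, of "[]" ys]]
    lin_0[OF multilinearD[OF assms vsV vsV, of "[]" ys]] by simp_all

lemma multilinear_l: "multilinear scale scale l"
  using linf unfolding linf_algebra_def by blast

text \<open>The residual exponent \<open>r p = p + 1\<close> is the origin of the sign
  \<open>(-1) ^ (p + 1)\<close> in the equation. The remaining factor is the same as in
  \<open>component_comp_Q\<close>, so it cancels when the two are compared.\<close>

lemma component_Q_comp:
  assumes D: "D \<in> Coder 0" and m: "represents D m" and zs: "hom zs"
  shows "component (\<lambda>x. Q (D x)) (map snd zs) = scale (psign (tri (length zs) + dec (up zs)))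
    (\<Sum>p=0..length zs. \<Sum>\<sigma>\<in>Sh p (length zs - p).
      scale ((-1) ^ (p + 1) * \<chi> \<sigma> (map fst (up zs)))
        (l (m (first p \<sigma> (map snd zs)) # rest p \<sigma> (map snd zs))))"
proof -
  have par: "even (tri (Suc p) + 1 + tri (Suc q) + int q * (0 + 1 - int p) - (tri (length zs) + int (p + 1)))"
    if "length zs = p + q" for p q
  proof -
    have "tri (Suc p) + 1 + tri (Suc q) + int q * (0 + 1 - int p) - (tri (length zs) + int (p + 1))
      = 2 * (int q + 1 - int p * int q)"
      by (simp add: that tri_add algebra_simps)
    then show ?thesis by (simp only: dvd_triv_left)
  qed
  have hd: "bracket (scale c x # ys) = scale c (bracket (x # ys))" for c x ys
    by (simp add: bracket_def multilinear_head[OF multilinear_l])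
  show ?thesis
    by (subst component_comp_signed[where kD = tri and kE = "\<lambda>n. tri (Suc n) + 1" and r = "\<lambda>p. int (p + 1)"
        and mD = bracket and mE = m, OF Coder_lin[OF Q_props] D zs component_Q representsD(1)[OF m] hd par])
      (simp_all add: minus_one_power bracket_def mult.commute del: tri_Suc power_Suc)
qed

lemma component_comp_Q:
  assumes D: "D \<in> Coder 0" and m: "represents D m" and zs: "hom zs"
  shows "component (\<lambda>x. D (Q x)) (map snd zs) = scale (psign (tri (length zs) + dec (up zs)))
    (\<Sum>p=1..length zs. \<Sum>\<sigma>\<in>Sh p (length zs - p).
      scale (\<chi> \<sigma> (map fst (up zs))) (m (l (first p \<sigma> (map snd zs)) # rest p \<sigma> (map snd zs))))"
proof -
  have par: "even (tri p + (tri (Suc (Suc q)) + 1) + int q * (1 + 1 - int p) - (tri (length zs) + 0))"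
    if "length zs = p + q" for p q
  proof -
    have "tri p + (tri (Suc (Suc q)) + 1) + int q * (1 + 1 - int p) - (tri (length zs) + 0)
      = 2 * (2 * int q + 2 - int p * int q)"
      by (simp add: that tri_add algebra_simps)
    then show ?thesis by (simp only: dvd_triv_left)
  qed
  note hd = multilinear_head[OF represents_multilinear[OF m]]
  let ?T = "\<lambda>p. \<Sum>\<sigma>\<in>Sh p (length zs - p). scale (\<chi> \<sigma> (map fst (up zs)))
      (m (bracket (first p \<sigma> (map snd zs)) # rest p \<sigma> (map snd zs)))"
  have "component (\<lambda>x. D (Q x)) (map snd zs) = scale (psign (tri (length zs) + dec (up zs)))
    (\<Sum>p=0..length zs. ?T p)"
    by (subst component_comp_signed[where kE = tri and kD = "\<lambda>n. tri (Suc n) + 1" and r = "\<lambda>p. 0"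
        and mE = bracket and mD = m, OF Coder_lin[OF D] Q_props zs representsD(1)[OF m] component_Q hd(1) par])
      (simp_all del: tri_Suc)
  \<comment> \<open>The summand p = 0 contains \<open>bracket [] = 0\<close> in the leading slot;
    hence the sum in the equation starts at 1.\<close>
  also have "(\<Sum>p=0..length zs. ?T p) = (\<Sum>p=1..length zs. ?T p)"
    by (simp add: sum.atLeast_Suc_atMost[of 0] first_def bracket_def hd(2))
  also have "\<dots> = (\<Sum>p=1..length zs. \<Sum>\<sigma>\<in>Sh p (length zs - p).
      scale (\<chi> \<sigma> (map fst (up zs))) (m (l (first p \<sigma> (map snd zs)) # rest p \<sigma> (map snd zs))))"
  proof (intro sum.cong refl)
    fix p \<sigma> assume "p \<in> {1..length zs}" "\<sigma> \<in> Sh p (length zs - p)"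
    then have "first p \<sigma> (map snd zs) \<noteq> []"
      using length_first[of \<sigma> p "length zs - p" "map snd zs"] by fastforce
    then show "scale (\<chi> \<sigma> (map fst (up zs))) (m (bracket (first p \<sigma> (map snd zs)) # rest p \<sigma> (map snd zs)))
      = scale (\<chi> \<sigma> (map fst (up zs))) (m (l (first p \<sigma> (map snd zs)) # rest p \<sigma> (map snd zs)))"
      by (simp add: bracket_def)
  qed
  finally show ?thesis .
qed

text \<open>Here the global sign is decided. The summand 1 of \<open>represents\<close> enters twice
  through the factors and once through the composite. Without it the exponents would differ by an
  odd number; the one surplus 1 makes the residual sign trivial.\<close>

lemma component_comp_represents:
  assumes D: "D \<in> Coder 0" and m: "represents D m" and D': "D' \<in> Coder 0" and m': "represents D' m'"
    and zs: "hom zs"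
  shows "component (\<lambda>x. D (D' x)) (map snd zs) = scale (psign (tri (Suc (length zs)) + 1 + dec (up zs)))
    (comp_Sh m m' (map fst (up zs)) (map snd zs))"
proof -
  have par: "even (tri (Suc p) + 1 + (tri (Suc (Suc q)) + 1) + int q * (0 + 1 - int p)
      - (tri (Suc (length zs)) + 1 + 0))"
    if "length zs = p + q" for p q
  proof -
    have "tri (Suc p) + 1 + (tri (Suc (Suc q)) + 1) + int q * (0 + 1 - int p)
      - (tri (Suc (length zs)) + 1 + 0) = 2 * (int q + 2 - int p * int q)"
      by (simp add: that tri_add algebra_simps)
    then show ?thesis by (simp only: dvd_triv_left)
  qed
  note hd = multilinear_head[OF represents_multilinear[OF m]]
  show ?thesis unfolding comp_Sh_def
    by (subst component_comp_signed[where kE = "\<lambda>n. tri (Suc n) + 1" and kD = "\<lambda>n. tri (Suc n) + 1"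
        and r = "\<lambda>p. 0" and mE = m' and mD = m,
        OF Coder_lin[OF D] D' zs representsD(1)[OF m] representsD(1)[OF m'] hd(1) par])
      (simp_all del: tri_Suc)
qed

lemma commutator_Q_iff:
  assumes D: "D \<in> Coder 0" and m: "represents D m"
  shows "commutator 1 0 Q D = (\<lambda>x. 0) \<longleftrightarrow> bracket_compatible m"
proof -
  have comp: "component (commutator 1 0 Q D) xs = component (\<lambda>x. Q (D x)) xs - component (\<lambda>x. D (Q x)) xs" for xs
    by (simp add: component_def commutator_def lin_diff[OF proj])
  have "commutator 1 0 Q D \<in> Coder (1 + 0)" by (rule commutator_Coder[OF Q_props D])
  then have "commutator 1 0 Q D = (\<lambda>x. 0)
      \<longleftrightarrow> (\<forall>zs. hom zs \<longrightarrow> component (commutator 1 0 Q D) (map snd zs) = 0)"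
    by (metis (mono_tags, lifting) Coder_eq_0 component_def lin_0[OF proj])
  also have "\<dots> \<longleftrightarrow> bracket_compatible m"
  proof -
    have "bracket_compatible m \<longleftrightarrow> (\<forall>zs. hom zs \<longrightarrow>
        (\<Sum>p=1..length zs. \<Sum>\<sigma>\<in>Sh p (length zs - p). scale (\<chi> \<sigma> (map fst (up zs)))
            (m (l (first p \<sigma> (map snd zs)) # rest p \<sigma> (map snd zs))))
        = (\<Sum>p=0..length zs. \<Sum>\<sigma>\<in>Sh p (length zs - p). scale ((-1) ^ (p + 1) * \<chi> \<sigma> (map fst (up zs)))
            (l (m (first p \<sigma> (map snd zs)) # rest p \<sigma> (map snd zs)))))"
      unfolding bracket_compatible_def by (rule all_homog_G_length_iff)
    moreover have "component (commutator 1 0 Q D) (map snd zs) = 0 \<longleftrightarrow>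
        (\<Sum>p=1..length zs. \<Sum>\<sigma>\<in>Sh p (length zs - p). scale (\<chi> \<sigma> (map fst (up zs)))
            (m (l (first p \<sigma> (map snd zs)) # rest p \<sigma> (map snd zs))))
        = (\<Sum>p=0..length zs. \<Sum>\<sigma>\<in>Sh p (length zs - p). scale ((-1) ^ (p + 1) * \<chi> \<sigma> (map fst (up zs)))
            (l (m (first p \<sigma> (map snd zs)) # rest p \<sigma> (map snd zs))))"
      if "hom zs" for zs
      unfolding comp component_Q_comp[OF D m that] component_comp_Q[OF D m that] right_minus_eq
        V.scale_cancel_left
      by (simp only: psign_nonzero simp_thms) (rule eq_commute)
    ultimately show ?thesis by blast
  qed
  finally show ?thesis .
qed

lemma commutator_represents_iff:
  assumes D: "D \<in> Coder 0" "represents D m" and D': "D' \<in> Coder 0" "represents D' m'"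
    and D'': "D'' \<in> Coder 0" "represents D'' m''"
  shows "D'' = commutator 0 0 D D' \<longleftrightarrow>
    (\<forall>ds xs. homog G ds xs \<longrightarrow> m'' xs = comp_Sh m m' ds xs - comp_Sh m' m ds xs)"
proof -
  have comp: "component (commutator 0 0 D D') xs = component (\<lambda>x. D (D' x)) xs - component (\<lambda>x. D' (D x)) xs" for xs
    by (simp add: component_def commutator_def lin_diff[OF proj])
  have "commutator 0 0 D D' \<in> Coder 0" using commutator_Coder[OF D(1) D'(1)] by simp
  then have "D'' = commutator 0 0 D D' \<longleftrightarrow>
      (\<forall>zs. hom zs \<longrightarrow> component D'' (map snd zs) = component (commutator 0 0 D D') (map snd zs))"
    using Coder_eqI[OF D''(1)] by blast
  also have "\<dots> \<longleftrightarrow> (\<forall>ds xs. homog G ds xs \<longrightarrow> m'' xs = comp_Sh m m' ds xs - comp_Sh m' m ds xs)"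
    unfolding all_homog_G_iff
    by (simp add: comp component_comp_represents[OF D D'] component_comp_represents[OF D' D]
        representsD(1)[OF D''(2)] del: tri_Suc flip: V.scale_right_diff_distrib)
  finally show ?thesis .
qed

lemma vector_space_fun: "vector_space (\<lambda>c D x. scaleS c (D x))"
  by unfold_locales
    (simp_all add: fun_eq_iff S.scale_right_distrib S.scale_left_distrib)

text \<open>The source is concentrated in degree 0 with zero differential. Conditions in other
  degrees have a zero argument and reduce to 0 = 0 or to the zero map being a coderivation. In
  degree 0 the differential condition reads [Q, \<psi>(h)] = \<psi>(0) = 0.\<close>

lemma lie_action_iff:
  assumes br: "lie_algebra scaleH br"
  shows "lie_action scaleH br \<psi> \<longleftrightarrow> lin scaleH (\<lambda>c D x. scaleS c (D x)) \<psi> \<and> (\<forall>h. \<psi> h \<in> Coder 0) \<and>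
    (\<forall>h. commutator 1 0 Q (\<psi> h) = (\<lambda>x. 0)) \<and> (\<forall>h h'. \<psi> (br h h') = commutator 0 0 (\<psi> h) (\<psi> h'))"
    (is "_ \<longleftrightarrow> ?L \<and> ?C \<and> ?Q \<and> ?B")
proof
  assume A: "lie_action scaleH br \<psi>"
  then have L: ?L and *: "\<And>i. \<psi> ` (if i = 0 then UNIV else {0}) \<subseteq> Coder i"
      "\<And>i j x y. x \<in> (if i = 0 then UNIV else {0}) \<Longrightarrow> y \<in> (if j = 0 then UNIV else {0}) \<Longrightarrow>
          \<psi> (br x y) = commutator i j (\<psi> x) (\<psi> y)"
      "\<And>i x. x \<in> (if i = 0 then UNIV else {0}) \<Longrightarrow> \<psi> 0 = commutator 1 i Q (\<psi> x)"
    unfolding lie_action_def dgla_hom_def by blast+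
  have "\<psi> 0 = (\<lambda>x. 0)" using lin_0[OF L] by (simp add: zero_fun_def)
  then show "?L \<and> ?C \<and> ?Q \<and> ?B" using L *(1)[of 0] *(2)[of _ 0 _ 0] *(3)[of _ 0] by auto
next
  assume A: "?L \<and> ?C \<and> ?Q \<and> ?B"
  then have L: ?L by blast
  have \<psi>0: "\<psi> 0 = (\<lambda>x. 0)" using lin_0[OF L] by (simp add: zero_fun_def)
  have br0: "br 0 y = 0" "br x 0 = 0" for x y
    using br lin_0[of scaleH scaleH "br x"] lin_0[of scaleH scaleH "\<lambda>x. br x y"]
    unfolding lie_algebra_def by blast+
  have c0: "commutator i j (\<lambda>x. 0) D = (\<lambda>x. 0)" "commutator i j D (\<lambda>x. 0) = (\<lambda>x. 0)"
    if "lin scaleS scaleS D" for i j D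
    by (simp_all add: commutator_def fun_eq_iff lin_0[OF that])
  have lin: "lin scaleS scaleS (\<psi> h)" for h using A Coder_lin by blast
  have 1: "\<psi> ` (if i = 0 then UNIV else {0}) \<subseteq> Coder i" for i
    using A \<psi>0 Coder_zero by auto
  have 2: "\<psi> (br x y) = commutator i j (\<psi> x) (\<psi> y)"
    if "x \<in> (if i = 0 then UNIV else {0})" "y \<in> (if j = 0 then UNIV else {0})" for i j x y
  proof -
    have "i = 0 \<and> j = 0 \<or> x = 0 \<or> y = 0" using that by (cases "i = 0"; cases "j = 0") simp_all
    then consider "i = 0" "j = 0" | "x = 0" | "y = 0" by blast
    then show ?thesis by cases (use A in \<open>simp_all add: br0 \<psi>0 c0[OF lin]\<close>)
  qed
  have 3: "\<psi> 0 = commutator 1 i Q (\<psi> x)" if "x \<in> (if i = 0 then UNIV else {0})" for i x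
  proof (cases "i = 0")
    case True then show ?thesis using A \<psi>0 by simp
  next
    case False
    then show ?thesis using that \<psi>0 c0(2)[OF Coder_lin[OF Q_props]] by simp
  qed
  show "lie_action scaleH br \<psi>"
    unfolding lie_action_def dgla_hom_def using L 1 2 3 by blast
qed

lemma lin_fun_iff:
  assumes "vector_space scaleH"
  shows "lin scaleH (\<lambda>c D x. scaleS c (D x)) \<psi> \<longleftrightarrow> (\<forall>x. lin scaleH scaleS (\<lambda>h. \<psi> h x))"
  using assms vsS vector_space_fun by (auto simp: lin_iff fun_eq_iff)

text \<open>Coderivations with equal components agree, so linearity of \<psi> can be tested on
  components of homogeneous lists, where it is linearity of \<mu> up to a sign.\<close>

lemma represents_linear_iff:
  assumes H: "vector_space scaleH" and C: "\<And>h. \<psi> h \<in> Coder 0" and m: "\<And>h. represents (\<psi> h) (\<mu> h)"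
  shows "lin scaleH (\<lambda>c D x. scaleS c (D x)) \<psi> \<longleftrightarrow> (\<forall>xs. lin scaleH scale (\<lambda>h. \<mu> h xs))"
proof
  interpret H: vector_space scaleH by fact
  assume "lin scaleH (\<lambda>c D x. scaleS c (D x)) \<psi>"
  then have lin: "lin scaleH scale (\<lambda>h. component (\<psi> h) xs)" for xs
    unfolding component_def lin_fun_iff[OF H] by (intro lin_compose[OF _ proj]) blast
  have lm: "lin scaleH scale (\<lambda>h. \<mu> h (map snd zs))" if "hom zs" for zs
    unfolding representsD(2)[OF m that] by (rule lin_compose_scale[OF lin])
  note ml = represents_multilinear[OF m, THEN multilinearD, OF vsV vsV]
  show "\<forall>xs. lin scaleH scale (\<lambda>h. \<mu> h xs)"
  proof
    fix xs show "lin scaleH scale (\<lambda>h. \<mu> h xs)"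
      by (rule homogeneous_induct[of "\<lambda>xs. lin scaleH scale (\<lambda>h. \<mu> h xs)"])
        (simp_all add: lm lin_add[OF ml] lin_compose_add)
  qed
next
  interpret H: vector_space scaleH by fact
  assume "\<forall>xs. lin scaleH scale (\<lambda>h. \<mu> h xs)"
  then have lin: "lin scaleH scale (\<lambda>h. component (\<psi> h) (map snd zs))" if "hom zs" for zs
    unfolding representsD(1)[OF m that] by (intro lin_compose_scale) blast
  have comp: "component (\<lambda>x. scaleS c (\<psi> h x) + \<psi> h' x) xs = scale c (component (\<psi> h) xs) + component (\<psi> h') xs"
    for c h h' xs by (simp add: component_def lin_add[OF proj] lin_scale[OF proj])
  \<comment> \<open>One identity yields both conditions: c = 1 gives additivity, hence \<psi>(0) =
    0, and then h' = 0 gives compatibility with scalars.\<close>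
  have comb: "\<psi> (scaleH c h + h') = (\<lambda>x. scaleS c (\<psi> h x) + \<psi> h' x)" for c h h'
    by (rule Coder_eqI[OF C Coder_add_scale[OF C C]]) (simp add: comp lin_add[OF lin] lin_scale[OF lin])
  have add: "\<psi> (h + h') = (\<lambda>x. \<psi> h x + \<psi> h' x)" for h h' using comb[of 1 h h'] by simp
  have "\<psi> 0 = (\<lambda>x. 0)" using add[of 0 0] by (simp add: fun_eq_iff)
  then have "\<psi> (scaleH c h) = (\<lambda>x. scaleS c (\<psi> h x))" for c h using comb[of c h 0] by simp
  then show "lin scaleH (\<lambda>c D x. scaleS c (D x)) \<psi>"
    unfolding lin_fun_iff[OF H] using add by (auto intro!: linI H vsS)
qed

text \<open>Decalage works for each h separately and matches degree 0 coderivations with skew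
  families of the right degree. Conditions linking different h, namely linearity and the bracket,
  are compared afterwards in \<open>iff\<close>, which serves both inclusions of the image.\<close>

theorem bij_betw_action_maps:
  assumes br: "lie_algebra scaleH br"
  shows "bij_betw (\<lambda>\<psi> h xs. - assoc_maps \<psi> h xs) {\<psi>. lie_action scaleH br \<psi>}
    {\<mu>. action_maps scaleH scale G \<mu> \<and> (\<forall>h. bracket_compatible (\<mu> h)) \<and>
      (\<forall>h h' ds xs. homog G ds xs \<longrightarrow>
        \<mu> (br h h') xs = comp_Sh (\<mu> h) (\<mu> h') ds xs - comp_Sh (\<mu> h') (\<mu> h) ds xs)}"
    (is "bij_betw ?\<Phi> ?A ?B")
proof -
  have H: "vector_space scaleH" using br by (simp add: lie_algebra_def)
  have iff: "lie_action scaleH br \<psi> \<longleftrightarrow> \<mu> \<in> ?B"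
    if C: "\<And>h. \<psi> h \<in> Coder 0" and m: "\<And>h. represents (\<psi> h) (\<mu> h)" for \<psi> \<mu>
  proof -
    have "action_maps scaleH scale G \<mu> \<longleftrightarrow> (\<forall>xs. lin scaleH scale (\<lambda>h. \<mu> h xs))"
      unfolding action_maps_def
      using represents_multilinear[OF m] represents_skew[OF C m] represents_degree[OF C m] by blast
    then show ?thesis
      unfolding lie_action_iff[OF br] represents_linear_iff[OF H C m] commutator_Q_iff[OF C m]
        commutator_represents_iff[OF C m C m C m]
      using C by blast
  qed
  have C: "\<psi> h \<in> Coder 0" if "\<psi> \<in> ?A" for \<psi> h using that lie_action_iff[OF br] by blast
  show ?thesis
  proof (rule bij_betw_imageI)
    show "inj_on ?\<Phi> ?A"
    proof (rule inj_onI)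
      fix \<psi> \<psi>' assume A: "\<psi> \<in> ?A" "\<psi>' \<in> ?A" and eq: "?\<Phi> \<psi> = ?\<Phi> \<psi>'"
      show "\<psi> = \<psi>'"
      proof
        fix h
        have e: "(\<lambda>xs. - assoc_maps \<psi>' h xs) = (\<lambda>xs. - assoc_maps \<psi> h xs)"
          using fun_cong[OF eq, of h] by simp
        note r = represents_assoc_maps[where \<psi> = \<psi> and h = h, OF C[OF A(1)]]
          represents_assoc_maps[where \<psi> = \<psi>' and h = h, OF C[OF A(2)], unfolded e]
        show "\<psi> h = \<psi>' h"
        proof (rule Coder_eqI[OF C[OF A(1)] C[OF A(2)]])
          fix zs :: "(int \<times> 'g) list" assume zs: "hom zs"
          show "component (\<psi> h) (map snd zs) = component (\<psi>' h) (map snd zs)"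
            unfolding representsD(1)[OF r(1) zs] representsD(1)[OF r(2) zs] ..
        qed
      qed
    qed
    show "?\<Phi> ` ?A = ?B"
    proof (intro equalityI subsetI)
      fix \<mu> assume "\<mu> \<in> ?\<Phi> ` ?A"
      then obtain \<psi> where \<psi>: "\<psi> \<in> ?A" "\<mu> = ?\<Phi> \<psi>" by blast
      have "lie_action scaleH br \<psi> \<longleftrightarrow> \<mu> \<in> ?B"
        unfolding \<psi>(2) by (rule iff[OF C[OF \<psi>(1)] represents_assoc_maps[where \<psi> = \<psi>, OF C[OF \<psi>(1)]]])
      then show "\<mu> \<in> ?B" using \<psi>(1) by blast
    next
      fix \<mu> assume \<mu>: "\<mu> \<in> ?B"
      then have "\<exists>D\<in>Coder 0. represents D (\<mu> h)" for h
        by (intro represents_exists) (auto simp: action_maps_def)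
      then obtain \<psi> where \<psi>: "\<And>h. \<psi> h \<in> Coder 0" "\<And>h. represents (\<psi> h) (\<mu> h)" by metis
      then have "\<psi> \<in> ?A" using iff \<mu> by blast
      moreover have "\<mu> = ?\<Phi> \<psi>"
        by (rule ext) (rule represents_unique[OF \<psi>(2) represents_assoc_maps[where \<psi> = \<psi>, OF \<psi>(1)]])
      ultimately show "\<mu> \<in> ?\<Phi> ` ?A" by blast
    qed
  qed
qed

end

theorem proposition3p14:
  fixes scaleH :: "'k::real_normed_field \<Rightarrow> 'h \<Rightarrow> 'h::ab_group_add"
    and br :: "'h \<Rightarrow> 'h \<Rightarrow> 'h"
    and scale :: "'k \<Rightarrow> 'g \<Rightarrow> 'g::ab_group_add"
    and G :: "int \<Rightarrow> 'g set"
    and l :: "'g list \<Rightarrow> 'g"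
    and scaleS :: "'k \<Rightarrow> 's \<Rightarrow> 's::ab_group_add"
    and odot :: "'g list \<Rightarrow> 's"
    and scaleT :: "'k \<Rightarrow> 't \<Rightarrow> 't::ab_group_add"
    and tens :: "'s \<Rightarrow> 's \<Rightarrow> 't"
  assumes "lie_algebra scaleH br"
    and "linf_algebra scale G l"
    and "symmetric_algebra scale (shift G) scaleS odot"
    and "tensor_product scaleS scaleS scaleT tens"
  shows "bij_betw
    (\<lambda>\<psi> h xs. - linf_coalgebra.assoc_maps scale G scaleS odot \<psi> h xs)
    {\<psi>. linf_coalgebra.lie_action scale G scaleS odot scaleT tens l scaleH br \<psi>}
    {\<mu>. action_maps scaleH scale G \<mu> \<and>
      (\<forall>h ds xs n. homog G ds xs \<and> n = length xs \<longrightarrow>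
        (\<Sum>p=1..n. \<Sum>\<sigma>\<in>Sh p (n - p).
            scale (\<chi> \<sigma> ds) (\<mu> h (l (first p \<sigma> xs) # rest p \<sigma> xs)))
        = (\<Sum>p=0..n. \<Sum>\<sigma>\<in>Sh p (n - p).
            scale ((-1) ^ (p + 1) * \<chi> \<sigma> ds) (l (\<mu> h (first p \<sigma> xs) # rest p \<sigma> xs)))) \<and>
      (\<forall>h h' ds xs n. homog G ds xs \<and> n = length xs \<longrightarrow>
        \<mu> (br h h') xs
        = (\<Sum>p=0..n. \<Sum>\<sigma>\<in>Sh p (n - p).
            scale (\<chi> \<sigma> ds) (\<mu> h (\<mu> h' (first p \<sigma> xs) # rest p \<sigma> xs)))
        - (\<Sum>p=0..n. \<Sum>\<sigma>\<in>Sh p (n - p).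
            scale (\<chi> \<sigma> ds) (\<mu> h' (\<mu> h (first p \<sigma> xs) # rest p \<sigma> xs))))}"
proof -
  have graded: "graded_vector_space scale (shift G)"
    using assms(2) by (auto simp: linf_algebra_def intro: graded_vector_space_shift)
  \<comment> \<open>A \<open>real_normed_field\<close> has characteristic 0, which the uniqueness of
    coderivations requires.\<close>
  interpret linf_coalgebra_char_0 scale G scaleS odot scaleT tens l
    by unfold_locales (use assms graded in auto)
  have 1: "(\<forall>h ds xs n. homog G ds xs \<and> n = length xs \<longrightarrow>
        (\<Sum>p=1..n. \<Sum>\<sigma>\<in>Sh p (n - p).
            scale (\<chi> \<sigma> ds) (\<mu> h (l (first p \<sigma> xs) # rest p \<sigma> xs)))
        = (\<Sum>p=0..n. \<Sum>\<sigma>\<in>Sh p (n - p).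
            scale ((-1) ^ (p + 1) * \<chi> \<sigma> ds) (l (\<mu> h (first p \<sigma> xs) # rest p \<sigma> xs))))
      \<longleftrightarrow> (\<forall>h. bracket_compatible (\<mu> h))" for \<mu> :: "'h \<Rightarrow> 'g list \<Rightarrow> 'g"
    unfolding bracket_compatible_def by blast
  have 2: "(\<forall>h h' ds xs n. homog G ds xs \<and> n = length xs \<longrightarrow>
        \<mu> (br h h') xs
        = (\<Sum>p=0..n. \<Sum>\<sigma>\<in>Sh p (n - p).
            scale (\<chi> \<sigma> ds) (\<mu> h (\<mu> h' (first p \<sigma> xs) # rest p \<sigma> xs)))
        - (\<Sum>p=0..n. \<Sum>\<sigma>\<in>Sh p (n - p).
            scale (\<chi> \<sigma> ds) (\<mu> h' (\<mu> h (first p \<sigma> xs) # rest p \<sigma> xs))))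
      \<longleftrightarrow> (\<forall>h h' ds xs. homog G ds xs \<longrightarrow>
        \<mu> (br h h') xs = comp_Sh (\<mu> h) (\<mu> h') ds xs - comp_Sh (\<mu> h') (\<mu> h) ds xs)"
    for \<mu> :: "'h \<Rightarrow> 'g list \<Rightarrow> 'g"
    unfolding comp_Sh_def by blast
  show ?thesis unfolding 1 2 by (rule bij_betw_action_maps[OF assms(1)])
qed

end
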